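(* For each $\lambda$ belonging to some index set $\Lambda$, let $(G^\lambda,P^\lambda)$ be a quasi-lattice ordered group, and let $E^\lambda$ be a product system over $P^\lambda$. If each $E^\lambda$ is compactly aligned, then so is their free product $*E^\lambda$.
   Context: Semigroups over which product systems are taken are countable and discrete with identity $e$ (in particular $*P^\lambda$ is countable). Product systems. A product system over $P$ is a family $p:E\to P$ of nontrivial separable complex Hilbert spaces $E_t:=p^{-1}(t)$ with an associative multiplication $E\times E\to E$ such that $p(xy)=p(x)p(y)$ and for all $s,t\in P$ the map $x\otimes y\in E_s\otimes E_t\mapsto xy\in E_{st}$ extends to a unitary isomorphism; also $\dim E_e=1$, so $E$ has an identity $\Omega\in E_e$. For $S\in\mathcal B(E_s)$, $S\otimes 1$ denotes the operator on $E_{st}$ with $(S\otimes 1)(xy)=(Sx)y$ for $x\in E_s$, $y\in E_t$. Orders. $(G,P)$ is quasi-lattice ordered if $P$ is a subsemigroup of the group $G$ with $P\cap P^{-1}=\{e\}$ and, for the left-invariant partial order $s\le t\iff s^{-1}t\in P$ on $G$, every finite subset of $G$ with an upper bound in $P$ has a least upper bound in $P$. For $s,t\in P$ with a common upper bound, $s\vee t$ is the least upper bound. If the $(G^\lambda,P^\lambda)$ are quasi-lattice ordered, so is $( *G^\lambda,*P^\lambda)$, where $*P^\lambda$ is the subsemigroup of $*G^\lambda$ generated by the $P^\lambda$. Compact alignment. $E$ is compactly aligned if whenever $s,t\in P$ have a common upper bound and $S\in\mathcal K(E_s)$, $T\in\mathcal K(E_t)$ are compact operators, the operator $(S\otimes1)(T\otimes1)$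 is compact on $E_{s\vee t}$. Free products. The free product $E=*E^\lambda$ is the product system over $*P^\lambda$ whose fiber over a reduced word $s=s_1s_2\cdots s_n$ ($s_i\in P^{\lambda_i}\setminus\{e\}$, $\lambda_i\ne\lambda_{i+1}$) is $E^{\lambda_1}_{s_1}\otimes\cdots\otimes E^{\lambda_n}_{s_n}$, whose fiber over $e$ is $\mathbb C$ (identified with each $E^\lambda_e$ via its identity element), and whose multiplication is given on elementary tensors by concatenation, multiplying in $E^\lambda$ the last factor of the first tensor with the first factor of the second when both lie in the same $E^\lambda$. *)

theory Defs
  imports
    "HOL-Analysis.Analysis"
    "HOL-Algebra.Algebra"
    "HOL-Algebra.Algebraic_Closure_Type"
begin

section \<open>Complex Hilbert spaces with explicit carriers\<close>

text \<open>
  The fibres of a product system are Hilbert spaces of varying dimension, so a Hilbert space is a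
  record with a carrier: a module over the field of complex numbers together with an inner
  product (linear in the first argument). The fields \<open>mult\<close> and \<open>one\<close> which modules inherit from
  rings play no role.
\<close>

abbreviation complex_field :: "complex ring" where
  "complex_field \<equiv> ring_of_type_algebra"

record 'x hspace = "(complex, 'x) module" +
  ip :: "'x \<Rightarrow> 'x \<Rightarrow> complex"

definition hnorm :: "('x, 'b) hspace_scheme \<Rightarrow> 'x \<Rightarrow> real" where
  "hnorm H x = sqrt (Re (ip H x x))"

text \<open>
  The locale \<^locale>\<open>Metric_space\<close> wants symmetry and nonnegativity of the distance also outside of
  the carrier, hence the case distinction.
\<close>

definition hdist :: "('x, 'b) hspace_scheme \<Rightarrow> 'x \<Rightarrow> 'x \<Rightarrow> real" where
  "hdist H x y =
     (if x \<in> carrier H \<and> y \<in> carrier H then hnorm H (x \<ominus>\<^bsub>H\<^esub> y) else 0)"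

abbreviation htopology :: "('x, 'b) hspace_scheme \<Rightarrow> 'x topology" where
  "htopology H \<equiv> Metric_space.mtopology (carrier H) (hdist H)"

locale hilbert_space = module complex_field H
  for H :: "('x, 'b) hspace_scheme" (structure) +
  assumes ip_add_left:
      "\<lbrakk>x \<in> carrier H; y \<in> carrier H; z \<in> carrier H\<rbrakk> \<Longrightarrow> ip H (x \<oplus> y) z = ip H x z + ip H y z"
    and ip_smult_left:
      "\<lbrakk>x \<in> carrier H; z \<in> carrier H\<rbrakk> \<Longrightarrow> ip H (c \<odot> x) z = c * ip H x z"
    and ip_cnj:
      "\<lbrakk>x \<in> carrier H; y \<in> carrier H\<rbrakk> \<Longrightarrow> ip H y x = cnj (ip H x y)"
    and ip_pos:
      "\<lbrakk>x \<in> carrier H; x \<noteq> \<zero>\<rbrakk> \<Longrightarrow> Re (ip H x x) > 0"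
    and complete: "Metric_space.mcomplete (carrier H) (hdist H)"

definition total_in :: "('x, 'b) hspace_scheme \<Rightarrow> 'x set \<Rightarrow> bool" where
  "total_in H A \<longleftrightarrow>
     A \<subseteq> carrier H \<and>
     htopology H closure_of ((\<lambda>W. submodule W complex_field H) hull A) = carrier H"

definition linear_operator :: "('x, 'b) hspace_scheme \<Rightarrow> ('x \<Rightarrow> 'x) \<Rightarrow> bool" where
  "linear_operator H S \<longleftrightarrow>
     S \<in> carrier H \<rightarrow> carrier H \<and>
     (\<forall>x\<in>carrier H. \<forall>y\<in>carrier H. S (x \<oplus>\<^bsub>H\<^esub> y) = S x \<oplus>\<^bsub>H\<^esub> S y) \<and>
     (\<forall>c. \<forall>x\<in>carrier H. S (c \<odot>\<^bsub>H\<^esub> x) = c \<odot>\<^bsub>H\<^esub> S x)"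

definition bounded_operator :: "('x, 'b) hspace_scheme \<Rightarrow> ('x \<Rightarrow> 'x) \<Rightarrow> bool" where
  "bounded_operator H S \<longleftrightarrow>
     linear_operator H S \<and> (\<exists>B. \<forall>x\<in>carrier H. hnorm H (S x) \<le> B * hnorm H x)"

definition compact_operator :: "('x, 'b) hspace_scheme \<Rightarrow> ('x \<Rightarrow> 'x) \<Rightarrow> bool" where
  "compact_operator H S \<longleftrightarrow>
     linear_operator H S \<and>
     compactin (htopology H) (htopology H closure_of (S ` {x \<in> carrier H. hnorm H x \<le> 1}))"

text \<open>
  \<open>hilbert_tensor Hs K \<tau>\<close> says that \<open>K\<close>, with the elementary tensors
  \<open>\<tau> [x\<^sub>1, \<dots>, x\<^sub>n] = x\<^sub>1 \<otimes> \<dots> \<otimes> x\<^sub>n\<close>, is the Hilbert space tensor product of the spaces in the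
  list \<open>Hs\<close>: the linear map from the algebraic tensor product into \<open>K\<close> induced by the multilinear
  map \<open>\<tau>\<close> is isometric with dense range, i.e. \<open>K\<close> is a completion of the algebraic tensor product.
  This determines \<open>(K, \<tau>)\<close> up to a unique unitary isomorphism. For the empty list, \<open>K\<close> is
  one-dimensional with distinguished unit vector \<open>\<tau> []\<close>, i.e. \<open>K\<close> is the space of complex numbers.
\<close>

definition tensor_args :: "('x, 'b) hspace_scheme list \<Rightarrow> 'x list set" where
  "tensor_args Hs = {xs. list_all2 (\<lambda>x H. x \<in> carrier H) xs Hs}"

definition hilbert_tensor ::
  "('x, 'b) hspace_scheme list \<Rightarrow> ('y, 'c) hspace_scheme \<Rightarrow> ('x list \<Rightarrow> 'y) \<Rightarrow> bool" where
  "hilbert_tensor Hs K \<tau> \<longleftrightarrow>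
     hilbert_space K \<and>
     \<tau> \<in> tensor_args Hs \<rightarrow> carrier K \<and>
     (\<forall>xs\<in>tensor_args Hs. \<forall>i<length Hs. \<forall>a\<in>carrier (Hs ! i). \<forall>b\<in>carrier (Hs ! i).
        \<tau> (xs[i := a \<oplus>\<^bsub>Hs ! i\<^esub> b]) = \<tau> (xs[i := a]) \<oplus>\<^bsub>K\<^esub> \<tau> (xs[i := b])) \<and>
     (\<forall>xs\<in>tensor_args Hs. \<forall>i<length Hs. \<forall>c. \<forall>a\<in>carrier (Hs ! i).
        \<tau> (xs[i := c \<odot>\<^bsub>Hs ! i\<^esub> a]) = c \<odot>\<^bsub>K\<^esub> \<tau> (xs[i := a])) \<and>
     (\<forall>xs\<in>tensor_args Hs. \<forall>ys\<in>tensor_args Hs.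
        ip K (\<tau> xs) (\<tau> ys) = (\<Prod>i<length Hs. ip (Hs ! i) (xs ! i) (ys ! i))) \<and>
     total_in K (\<tau> ` tensor_args Hs)"

section \<open>Quasi-lattice ordered groups\<close>

definition left_order :: "('g, 'b) monoid_scheme \<Rightarrow> 'g set \<Rightarrow> 'g gorder" where
  "left_order G P = \<lparr>carrier = carrier G, eq = (=), le = (\<lambda>s t. inv\<^bsub>G\<^esub> s \<otimes>\<^bsub>G\<^esub> t \<in> P)\<rparr>"

locale quasi_lattice_ordered = group G for G :: "('g, 'b) monoid_scheme" (structure) +
  fixes P :: "'g set"
  assumes submonoid: "submonoid P G"
    and pointed: "P \<inter> (\<lambda>x. inv x) ` P = {\<one>}"
    and lub: "\<lbrakk>finite A; A \<subseteq> carrier G; Upper (left_order G P) A \<inter> P \<noteq> {}\<rbrakk>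
      \<Longrightarrow> \<exists>r. least (left_order G P) r (Upper (left_order G P) A \<inter> P)"

section \<open>Product systems\<close>

text \<open>
  \<open>pspace\<close> is the total space \<open>E\<close>, \<open>pproj\<close> the projection \<open>p\<close>, and \<open>pfib E t\<close> the fibre
  \<open>p\<^sup>-\<^sup>1(t)\<close> with its Hilbert space structure.
\<close>

record ('g, 'x) prodsys =
  pspace :: "'x set"
  pproj :: "'x \<Rightarrow> 'g"
  pmult :: "'x \<Rightarrow> 'x \<Rightarrow> 'x" (infixl \<open>\<cdot>\<index>\<close> 70)
  pfib :: "'g \<Rightarrow> 'x hspace"

locale product_system = monoid M
  for M :: "('g, 'b) monoid_scheme" +
  fixes E :: "('g, 'x) prodsys" (structure)
  assumes countable: "countable (carrier M)"
    and proj: "pproj E \<in> pspace E \<rightarrow> carrier M"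
    and fibre: "t \<in> carrier M \<Longrightarrow> carrier (pfib E t) = {x \<in> pspace E. pproj E x = t}"
    and hilbert: "t \<in> carrier M \<Longrightarrow> hilbert_space (pfib E t)"
    and nontrivial: "t \<in> carrier M \<Longrightarrow> carrier (pfib E t) \<noteq> {\<zero>\<^bsub>pfib E t\<^esub>}"
    and separable: "t \<in> carrier M \<Longrightarrow> separable_space (htopology (pfib E t))"
    and mult_closed: "\<lbrakk>x \<in> pspace E; y \<in> pspace E\<rbrakk> \<Longrightarrow> x \<cdot> y \<in> pspace E"
    and mult_assoc:
      "\<lbrakk>x \<in> pspace E; y \<in> pspace E; z \<in> pspace E\<rbrakk> \<Longrightarrow> (x \<cdot> y) \<cdot> z = x \<cdot> (y \<cdot> z)"
    and proj_mult: "\<lbrakk>x \<in> pspace E; y \<in> pspace E\<rbrakk> \<Longrightarrow> pproj E (x \<cdot> y) = pproj E x \<otimes>\<^bsub>M\<^esub> pproj E y"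
    \<comment> \<open>the multiplication extends to a unitary isomorphism from the tensor product of the
        fibres over \<open>s\<close> and \<open>t\<close> onto the fibre over \<open>s \<otimes> t\<close>\<close>
    and unitary: "\<lbrakk>s \<in> carrier M; t \<in> carrier M\<rbrakk> \<Longrightarrow>
      hilbert_tensor [pfib E s, pfib E t] (pfib E (s \<otimes>\<^bsub>M\<^esub> t)) (\<lambda>xs. xs ! 0 \<cdot> xs ! 1)"
    and dim_one: "\<exists>v\<in>carrier (pfib E \<one>\<^bsub>M\<^esub>). v \<noteq> \<zero>\<^bsub>pfib E \<one>\<^bsub>M\<^esub>\<^esub> \<and>
      carrier (pfib E \<one>\<^bsub>M\<^esub>) = range (\<lambda>c. c \<odot>\<^bsub>pfib E \<one>\<^bsub>M\<^esub>\<^esub> v)"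

text \<open>
  \<open>amplify G E s t S\<close> is the operator \<open>S \<otimes> 1\<close> on the fibre over \<open>s \<otimes> t\<close>. It is unique as an
  extensional function, the products \<open>x \<cdot> y\<close> being total.
\<close>

definition amplify ::
  "('g, 'b) monoid_scheme \<Rightarrow> ('g, 'x) prodsys \<Rightarrow> 'g \<Rightarrow> 'g \<Rightarrow> ('x \<Rightarrow> 'x) \<Rightarrow> 'x \<Rightarrow> 'x" where
  "amplify G E s t S =
     (THE A. A \<in> extensional (carrier (pfib E (s \<otimes>\<^bsub>G\<^esub> t))) \<and>
        bounded_operator (pfib E (s \<otimes>\<^bsub>G\<^esub> t)) A \<and>
        (\<forall>x\<in>carrier (pfib E s). \<forall>y\<in>carrier (pfib E t). A (x \<cdot>\<^bsub>E\<^esub> y) = S x \<cdot>\<^bsub>E\<^esub> y))"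

text \<open>
  For \<open>s, t \<in> P\<close> every upper bound of \<open>s\<close> and \<open>t\<close> lies in \<open>P\<close>, so the join with respect to
  \<^const>\<open>left_order\<close> is the least upper bound in \<open>P\<close>.
\<close>

definition compactly_aligned ::
  "('g, 'b) monoid_scheme \<Rightarrow> 'g set \<Rightarrow> ('g, 'x) prodsys \<Rightarrow> bool" where
  "compactly_aligned G P E \<longleftrightarrow>
     (\<forall>s\<in>P. \<forall>t\<in>P. Upper (left_order G P) {s, t} \<inter> P \<noteq> {} \<longrightarrow>
       (\<forall>S T. compact_operator (pfib E s) S \<longrightarrow> compact_operator (pfib E t) T \<longrightarrow>
         (let r = s \<squnion>\<^bsub>left_order G P\<^esub> t in
           compact_operator (pfib E r)
             (amplify G E s (inv\<^bsub>G\<^esub> s \<otimes>\<^bsub>G\<^esub> r) S \<circ> amplify G E t (inv\<^bsub>G\<^esub> t \<otimes>\<^bsub>G\<^esub> r) T))))"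

section \<open>Free products of groups and semigroups\<close>

type_synonym ('l, 'g) word = "('l \<times> 'g) list"

definition reduced_words :: "'l set \<Rightarrow> ('l \<Rightarrow> ('g, 'b) monoid_scheme) \<Rightarrow> ('l, 'g) word set" where
  "reduced_words \<Lambda> G =
     {w. (\<forall>(l, g)\<in>set w. l \<in> \<Lambda> \<and> g \<in> carrier (G l) \<and> g \<noteq> \<one>\<^bsub>G l\<^esub>) \<and> distinct_adj (map fst w)}"

fun letter_mult ::
  "('l \<Rightarrow> ('g, 'b) monoid_scheme) \<Rightarrow> 'l \<times> 'g \<Rightarrow> ('l, 'g) word \<Rightarrow> ('l, 'g) word" where
  "letter_mult G a [] = [a]"
| "letter_mult G (l, g) ((m, h) # w) =
     (if l \<noteq> m then (l, g) # (m, h) # w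
      else if g \<otimes>\<^bsub>G l\<^esub> h = \<one>\<^bsub>G l\<^esub> then w
      else (l, g \<otimes>\<^bsub>G l\<^esub> h) # w)"

definition free_prod_group ::
  "'l set \<Rightarrow> ('l \<Rightarrow> ('g, 'b) monoid_scheme) \<Rightarrow> ('l, 'g) word monoid" where
  "free_prod_group \<Lambda> G =
     \<lparr>carrier = reduced_words \<Lambda> G, mult = (\<lambda>u v. foldr (letter_mult G) u v), one = []\<rparr>"

definition free_prod_semigroup ::
  "'l set \<Rightarrow> ('l \<Rightarrow> ('g, 'b) monoid_scheme) \<Rightarrow> ('l \<Rightarrow> 'g set) \<Rightarrow> ('l, 'g) word set" where
  "free_prod_semigroup \<Lambda> G P =
     (\<lambda>H. submonoid H (free_prod_group \<Lambda> G)) hull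
       {[(l, p)] | l p. l \<in> \<Lambda> \<and> p \<in> P l \<and> p \<noteq> \<one>\<^bsub>G l\<^esub>}"

section \<open>Free products of product systems\<close>

text \<open>
  Concatenation of the elementary tensors with factors \<open>xs\<close> over the word \<open>s\<close> and \<open>ys\<close> over the
  word \<open>t\<close>.
\<close>

definition tensor_concat ::
  "('l \<Rightarrow> ('g, 'x) prodsys) \<Rightarrow> ('l, 'g) word \<Rightarrow> ('l, 'g) word \<Rightarrow> 'x list \<Rightarrow> 'x list \<Rightarrow> 'x list" where
  "tensor_concat E s t xs ys =
     (if s \<noteq> [] \<and> t \<noteq> [] \<and> fst (last s) = fst (hd t)
      then butlast xs @ [last xs \<cdot>\<^bsub>E (fst (hd t))\<^esub> hd ys] @ tl ys
      else xs @ ys)"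

definition word_fibres ::
  "('l \<Rightarrow> ('g, 'x) prodsys) \<Rightarrow> ('l, 'g) word \<Rightarrow> 'x hspace list" where
  "word_fibres E s = map (\<lambda>(l, g). pfib (E l) g) s"

text \<open>
  Like the Hilbert space tensor product, the free product is described up to isomorphism:
  \<open>ten s [x\<^sub>1, \<dots>, x\<^sub>n]\<close> is the elementary tensor \<open>x\<^sub>1 \<otimes> \<dots> \<otimes> x\<^sub>n\<close> in the fibre of \<open>F\<close> over the reduced
  word \<open>s\<close>. For the empty word, \<open>ten [] []\<close> is the number \<open>1\<close>.
\<close>

locale free_product_system =
  fixes \<Lambda> :: "'l set"
    and G :: "'l \<Rightarrow> ('g, 'b) monoid_scheme"
    and P :: "'l \<Rightarrow> 'g set"
    and E :: "'l \<Rightarrow> ('g, 'x) prodsys"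
    and F :: "(('l, 'g) word, 'y) prodsys"
    and ten :: "('l, 'g) word \<Rightarrow> 'x list \<Rightarrow> 'y"
  assumes product_system:
      "product_system ((free_prod_group \<Lambda> G)\<lparr>carrier := free_prod_semigroup \<Lambda> G P\<rparr>) F"
    and fibre:
      "s \<in> free_prod_semigroup \<Lambda> G P \<Longrightarrow> hilbert_tensor (word_fibres E s) (pfib F s) (ten s)"
    and mult:
      "\<lbrakk>s \<in> free_prod_semigroup \<Lambda> G P; t \<in> free_prod_semigroup \<Lambda> G P;
        xs \<in> tensor_args (word_fibres E s); ys \<in> tensor_args (word_fibres E t)\<rbrakk> \<Longrightarrow>
       ten s xs \<cdot>\<^bsub>F\<^esub> ten t ys = ten (s \<otimes>\<^bsub>free_prod_group \<Lambda> G\<^esub> t) (tensor_concat E s t xs ys)"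

end

theory Submission
  imports Defs
begin

text \<open>
  Words \<open>s\<close> and \<open>t\<close> over the positive letters have a common upper bound only if one of them is below
  the other, or if \<open>s = u a\<close> and \<open>t = u b\<close> with letters \<open>a\<close>, \<open>b\<close> of the same factor, and then
  \<open>s \<or> t = u c\<close> with \<open>c = a \<or> b\<close>. In the first case \<open>(S \<otimes> 1) (T \<otimes> 1)\<close> is the product of a compact and
  a bounded operator. In the second case approximate \<open>S\<close> and \<open>T\<close> by finite sums of rank one operators
  whose ranges are spanned by elementary tensors \<open>y z\<close> with \<open>y\<close> over \<open>u\<close>. Since
  \<open>(S \<otimes> 1) (y \<zeta>) = ((x \<mapsto> S (y x)) \<otimes> 1) \<zeta>\<close>, this reduces compactness over \<open>u c\<close> to compactness of
  \<open>(R \<otimes> 1) (R' \<otimes> 1)\<close> over \<open>c\<close> with \<open>R\<close>, \<open>R'\<close> of rank one over \<open>a\<close>, \<open>b\<close>, which is the compact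
  alignment of the factor.
\<close>

section \<open>Hilbert spaces with carriers\<close>

text \<open>\<open>T \<otimes> 1\<close> need not be compact even if \<open>T\<close> has rank one,
  so over \<open>u c\<close> only the product of the two amplifications can be treated. It is
  handled by factoring. If \<open>T w = \<phi>(w) y z\<close>, then \<open>T \<otimes> 1\<close> is
  \<open>\<phi> \<otimes> 1\<close>, with values in the fibre over \<open>b' = b^{-1} c\<close>,
  followed by \<open>\<eta> \<mapsto> y z \<eta>\<close>. What is left is
  \<open>\<eta> \<mapsto> (S \<otimes> 1) (y z \<eta>)\<close>. Since
  \<open>x \<mapsto> S (y x)\<close> is compact from the fibre over \<open>a\<close> to the fibre
  over \<open>u a\<close>, it can be approximated by maps
  \<open>x \<mapsto> \<phi>(x) x1 x2\<close>; left multiplication by \<open>x1\<close> then comes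
  out in front, and the rest lives over \<open>c\<close>. Two points shape the preliminaries. These
  maps run between different fibres, so bounded and compact maps are set up for pairs of spaces. And
  \<open>f \<otimes> 1\<close> has to exist with the same bound as \<open>f\<close>, since
  approximation errors must survive amplification. Bounded functionals do the work of adjoints,
  which are never formed.\<close>

lemma complex_field_simps [simp]:
  "carrier complex_field = UNIV" "\<one>\<^bsub>complex_field\<^esub> = 1"
  "a \<oplus>\<^bsub>complex_field\<^esub> b = a + b" "a \<otimes>\<^bsub>complex_field\<^esub> b = a * b" "\<zero>\<^bsub>complex_field\<^esub> = 0"
  by (simp_all add: ring_of_type_algebra_def)

text \<open>The algebraic span whose closure appears in \<open>total_in\<close>, named for use in
  inductions.\<close>

definition hspan :: "('x, 'b) hspace_scheme \<Rightarrow> 'x set \<Rightarrow> 'x set" where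
  "hspan H A = (\<lambda>W. submodule W complex_field H) hull A"

context hilbert_space
begin

lemma smult_in [simp]: "x \<in> carrier H \<Longrightarrow> c \<odot> x \<in> carrier H"
  by simp

lemma minus_in [simp]: "x \<in> carrier H \<Longrightarrow> y \<in> carrier H \<Longrightarrow> x \<ominus> y \<in> carrier H"
  by (simp add: minus_eq)

lemma smult_0 [simp]: "x \<in> carrier H \<Longrightarrow> 0 \<odot> x = \<zero>"
  using smult_l_null[of x] by simp

lemma smult_zero [simp]: "c \<odot> \<zero> = \<zero>"
  using smult_r_null[of c] by simp

lemma smult_1 [simp]: "x \<in> carrier H \<Longrightarrow> 1 \<odot> x = x"
  using smult_one[of x] by simp

lemma smult_smult: "x \<in> carrier H \<Longrightarrow> a \<odot> (b \<odot> x) = (a * b) \<odot> x"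
  using smult_assoc1[of a b x] by simp

lemma smult_add_left: "x \<in> carrier H \<Longrightarrow> (a + b) \<odot> x = a \<odot> x \<oplus> b \<odot> x"
  using smult_l_distr[of a b x] by simp

section \<open>Inner product and norm\<close>

lemma ip_zero_left [simp]: "z \<in> carrier H \<Longrightarrow> ip H \<zero> z = 0"
  using ip_smult_left[of \<zero> z 0] by simp

lemma ip_uminus_left: "x \<in> carrier H \<Longrightarrow> z \<in> carrier H \<Longrightarrow> ip H (\<ominus> x) z = - ip H x z"
  using ip_add_left[of x "\<ominus> x" z] by (simp add: r_neg eq_neg_iff_add_eq_0 add.commute)

lemma ip_minus_left:
  "x \<in> carrier H \<Longrightarrow> y \<in> carrier H \<Longrightarrow> z \<in> carrier H \<Longrightarrow> ip H (x \<ominus> y) z = ip H x z - ip H y z"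
  by (simp add: minus_eq ip_add_left ip_uminus_left)

lemma ip_zero_right [simp]: "z \<in> carrier H \<Longrightarrow> ip H z \<zero> = 0"
  using ip_cnj[of \<zero> z] by simp

lemma ip_add_right:
  "x \<in> carrier H \<Longrightarrow> y \<in> carrier H \<Longrightarrow> z \<in> carrier H \<Longrightarrow> ip H z (x \<oplus> y) = ip H z x + ip H z y"
  by (simp add: ip_cnj[of _ z] ip_add_left)

lemma ip_minus_right:
  "x \<in> carrier H \<Longrightarrow> y \<in> carrier H \<Longrightarrow> z \<in> carrier H \<Longrightarrow> ip H z (x \<ominus> y) = ip H z x - ip H z y"
  by (simp add: ip_cnj[of _ z] ip_minus_left)

lemma ip_smult_right:
  "x \<in> carrier H \<Longrightarrow> z \<in> carrier H \<Longrightarrow> ip H z (c \<odot> x) = cnj c * ip H z x"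
  by (simp add: ip_cnj[of _ z] ip_smult_left)

lemmas ip_simps = ip_add_left ip_minus_left ip_smult_left ip_add_right ip_minus_right ip_smult_right

lemma ip_self_eq_0: "x \<in> carrier H \<Longrightarrow> ip H x x = 0 \<longleftrightarrow> x = \<zero>"
  using ip_pos[of x] by fastforce

lemma minus_eq_zero:
  assumes "x \<in> carrier H" "y \<in> carrier H"
  shows "x \<ominus> y = \<zero> \<longleftrightarrow> x = y"
proof
  assume "x \<ominus> y = \<zero>"
  moreover have "x = (x \<ominus> y) \<oplus> y" using assms by (simp add: minus_eq a_assoc l_neg)
  ultimately show "x = y" using assms by simp
qed (use assms in \<open>simp add: minus_eq r_neg\<close>)

text \<open>
  Identities between vectors are reduced to identities between complex numbers by pairing with
  an arbitrary vector.
\<close>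

lemma ip_ext:
  assumes "x \<in> carrier H" "y \<in> carrier H" "\<And>z. z \<in> carrier H \<Longrightarrow> ip H x z = ip H y z"
  shows "x = y"
proof -
  have "ip H (x \<ominus> y) (x \<ominus> y) = 0"
    using assms by (simp add: ip_minus_left)
  then show ?thesis
    using assms(1,2) ip_self_eq_0[of "x \<ominus> y"] minus_eq_zero[of x y] by simp
qed

lemma ip_self_Re_nonneg: "x \<in> carrier H \<Longrightarrow> 0 \<le> Re (ip H x x)"
  using ip_pos[of x] by (cases "x = \<zero>") auto

lemma ip_self: "x \<in> carrier H \<Longrightarrow> ip H x x = of_real ((hnorm H x)\<^sup>2)"
proof -
  assume x: "x \<in> carrier H"
  have "Im (ip H x x) = Im (cnj (ip H x x))" by (rule arg_cong[OF ip_cnj[OF x x]])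
  then show ?thesis using ip_self_Re_nonneg[OF x] by (simp add: hnorm_def complex_eq_iff)
qed

lemma hnorm_sq: "x \<in> carrier H \<Longrightarrow> (hnorm H x)\<^sup>2 = Re (ip H x x)"
  by (simp add: ip_self)

lemma hnorm_nonneg [simp]: "x \<in> carrier H \<Longrightarrow> 0 \<le> hnorm H x"
  by (simp add: hnorm_def ip_self_Re_nonneg)

lemma hnorm_zero [simp]: "hnorm H \<zero> = 0"
  by (simp add: hnorm_def)

lemma hnorm_eq_0: "x \<in> carrier H \<Longrightarrow> hnorm H x = 0 \<longleftrightarrow> x = \<zero>"
  using ip_self_eq_0[of x] ip_self[of x] by auto

text \<open>The hypothesis is an inequality because it arises from estimates, such as a bound by
  every positive \<open>\<epsilon>\<close>.\<close>

lemma eq_of_hnorm_minus: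
  assumes "x \<in> carrier H" "y \<in> carrier H" "hnorm H (x \<ominus> y) \<le> 0"
  shows "x = y"
proof -
  have "hnorm H (x \<ominus> y) = 0" using hnorm_nonneg[OF minus_in[OF assms(1,2)]] assms(3) by linarith
  then show ?thesis using assms hnorm_eq_0[of "x \<ominus> y"] minus_eq_zero[of x y] by simp
qed

lemma hnorm_smult [simp]: "x \<in> carrier H \<Longrightarrow> hnorm H (c \<odot> x) = cmod c * hnorm H x"
proof -
  assume x: "x \<in> carrier H"
  have "c * (cnj c * ip H x x) = complex_of_real ((cmod c)\<^sup>2) * ip H x x"
    by (simp only: complex_norm_square mult.assoc)
  then have "ip H (c \<odot> x) (c \<odot> x) = complex_of_real ((cmod c)\<^sup>2) * ip H x x"
    using x by (simp only: ip_simps smult_in mult.left_commute)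
  then have "Re (ip H (c \<odot> x) (c \<odot> x)) = (cmod c)\<^sup>2 * Re (ip H x x)"
    by simp
  then have "(hnorm H (c \<odot> x))\<^sup>2 = (cmod c * hnorm H x)\<^sup>2"
    using x by (simp only: hnorm_sq smult_in power_mult_distrib)
  then show ?thesis using x by (simp add: power2_eq_iff_nonneg)
qed

lemma cauchy_schwarz:
  assumes x: "x \<in> carrier H" and y: "y \<in> carrier H"
  shows "cmod (ip H x y) \<le> hnorm H x * hnorm H y"
proof (cases "y = \<zero>")
  case False
  let ?n = "(hnorm H y)\<^sup>2"
  let ?a = "ip H x y"
  have n: "?n > 0" using False y hnorm_eq_0 by simp
  \<comment> \<open>\<open>?w\<close> is the component of \<open>x\<close> orthogonal to
    \<open>y\<close>, scaled by the squared norm of \<open>y\<close> so that no division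
    occurs.\<close>
  let ?w = "complex_of_real ?n \<odot> x \<ominus> ?a \<odot> y"
  have "ip H ?w ?w = of_real ?n * (of_real ?n * of_real ((hnorm H x)\<^sup>2) - ?a * cnj ?a)"
    using x y by (simp add: ip_simps ip_self[OF x] ip_self[OF y] ip_cnj[of x y] algebra_simps)
  also have "\<dots> = of_real (?n * (?n * (hnorm H x)\<^sup>2 - (cmod ?a)\<^sup>2))"
    by (simp only: complex_norm_square[symmetric] of_real_mult of_real_diff)
  finally have e: "ip H ?w ?w = of_real (?n * (?n * (hnorm H x)\<^sup>2 - (cmod ?a)\<^sup>2))" .
  have "0 \<le> Re (ip H ?w ?w)" using x y ip_self_Re_nonneg by simp
  then have "0 \<le> ?n * (?n * (hnorm H x)\<^sup>2 - (cmod ?a)\<^sup>2)" unfolding e by (simp only: Re_complex_of_real)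
  then have "(cmod ?a)\<^sup>2 \<le> (hnorm H x * hnorm H y)\<^sup>2"
    using n by (simp add: zero_le_mult_iff power_mult_distrib mult.commute)
  then show ?thesis using x y by (simp add: power2_le_iff_abs_le)
qed (use x in simp)

lemma hnorm_add:
  assumes x: "x \<in> carrier H" and y: "y \<in> carrier H"
  shows "hnorm H (x \<oplus> y) \<le> hnorm H x + hnorm H y"
proof -
  have "(hnorm H (x \<oplus> y))\<^sup>2 = (hnorm H x)\<^sup>2 + (hnorm H y)\<^sup>2 + 2 * Re (ip H x y)"
    using x y by (simp add: hnorm_sq ip_simps ip_cnj[of x y])
  also have "\<dots> \<le> (hnorm H x)\<^sup>2 + (hnorm H y)\<^sup>2 + 2 * (hnorm H x * hnorm H y)"
    using cauchy_schwarz[OF x y] complex_Re_le_cmod[of "ip H x y"] by simp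
  also have "\<dots> = (hnorm H x + hnorm H y)\<^sup>2"
    by (simp add: power2_sum)
  finally show ?thesis using x y by (simp add: power2_le_iff_abs_le)
qed

lemma hnorm_uminus: "x \<in> carrier H \<Longrightarrow> y \<in> carrier H \<Longrightarrow> hnorm H (x \<ominus> y) = hnorm H (y \<ominus> x)"
  by (simp add: hnorm_def ip_simps algebra_simps)

lemma hnorm_triangle:
  assumes "x \<in> carrier H" "y \<in> carrier H" "z \<in> carrier H"
  shows "hnorm H (x \<ominus> z) \<le> hnorm H (x \<ominus> y) + hnorm H (y \<ominus> z)"
proof -
  have "x \<ominus> z = (x \<ominus> y) \<oplus> (y \<ominus> z)"
    by (rule ip_ext) (use assms in \<open>simp_all add: ip_simps\<close>)
  then show ?thesis using assms hnorm_add[of "x \<ominus> y" "y \<ominus> z"] by simp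
qed

lemma hnorm_le_minus:
  assumes "x \<in> carrier H" "y \<in> carrier H"
  shows "hnorm H x \<le> hnorm H y + hnorm H (x \<ominus> y)"
proof -
  have "y \<oplus> (x \<ominus> y) = x"
    by (rule ip_ext) (use assms in \<open>simp_all add: ip_simps\<close>)
  then show ?thesis using assms hnorm_add[of y "x \<ominus> y"] by simp
qed

lemma hnorm_add_diff:
  assumes "a \<in> carrier H" "b \<in> carrier H" "a' \<in> carrier H" "b' \<in> carrier H"
  shows "hnorm H ((a \<oplus> b) \<ominus> (a' \<oplus> b')) \<le> hnorm H (a \<ominus> a') + hnorm H (b \<ominus> b')"
proof -
  have "(a \<oplus> b) \<ominus> (a' \<oplus> b') = (a \<ominus> a') \<oplus> (b \<ominus> b')"
    by (rule ip_ext) (use assms in \<open>simp_all add: ip_simps\<close>)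
  then show ?thesis using assms hnorm_add by simp
qed

lemma smult_minus:
  assumes "x \<in> carrier H" "y \<in> carrier H"
  shows "c \<odot> x \<ominus> c \<odot> y = c \<odot> (x \<ominus> y)"
  by (rule ip_ext) (use assms in \<open>simp_all add: ip_simps algebra_simps\<close>)

lemma minus_conv_add: "x \<in> carrier H \<Longrightarrow> y \<in> carrier H \<Longrightarrow> x \<ominus> y = x \<oplus> (-1) \<odot> y"
  by (rule ip_ext) (simp_all add: ip_simps)

lemma pythagoras:
  assumes "x \<in> carrier H" "y \<in> carrier H" "ip H x y = 0"
  shows "(hnorm H (x \<oplus> y))\<^sup>2 = (hnorm H x)\<^sup>2 + (hnorm H y)\<^sup>2"
  using assms ip_cnj[of x y] by (simp add: hnorm_sq ip_simps)

text \<open>The last conclusion shows that \<open>e\<close> lies in every submodule containing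
  \<open>x\<close>; Gram-Schmidt inside a submodule relies on this.\<close>

lemma normalize:
  assumes x: "x \<in> carrier H" "x \<noteq> \<zero>"
  obtains e where "e \<in> carrier H" "ip H e e = 1" "x = complex_of_real (hnorm H x) \<odot> e"
    "e = complex_of_real (inverse (hnorm H x)) \<odot> x"
proof
  let ?n = "complex_of_real (hnorm H x)" and ?i = "complex_of_real (inverse (hnorm H x))"
  have n: "hnorm H x \<noteq> 0" using x hnorm_eq_0 by simp
  then have *: "?n * ?i = 1" by (simp flip: of_real_mult)
  show "?i \<odot> x \<in> carrier H" using x by simp
  show "x = ?n \<odot> (?i \<odot> x)" using x(1) by (simp only: smult_smult * smult_1)
  have "ip H (?i \<odot> x) (?i \<odot> x) = ?i * (?i * (?n * ?n))"
    using x(1) by (simp add: ip_smult_left ip_smult_right ip_self[OF x(1)] power2_eq_square)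
  also have "\<dots> = (?n * ?i) * (?n * ?i)" by (simp only: ac_simps)
  finally show "ip H (?i \<odot> x) (?i \<odot> x) = 1" by (simp only: * mult_1)
qed (rule refl)

section \<open>Metric topology, submodules and spans\<close>

sublocale hmetric: Metric_space "carrier H" "hdist H"
proof
  show "hdist H x y = 0 \<longleftrightarrow> x = y" if "x \<in> carrier H" "y \<in> carrier H" for x y
    using that by (simp add: hdist_def hnorm_eq_0 minus_eq_zero)
qed (auto simp: hdist_def hnorm_uminus hnorm_triangle)

lemma in_mball: "x \<in> carrier H \<Longrightarrow> y \<in> hmetric.mball x r \<longleftrightarrow> y \<in> carrier H \<and> hnorm H (y \<ominus> x) < r"
  by (auto simp: hmetric.in_mball hdist_def hnorm_uminus)

lemma in_hclosure:
  "x \<in> htopology H closure_of A \<longleftrightarrow>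
     x \<in> carrier H \<and> (\<forall>\<epsilon>>0. \<exists>y\<in>A. y \<in> carrier H \<and> hnorm H (y \<ominus> x) < \<epsilon>)"
  by (auto simp: hmetric.metric_closure_of hdist_def) (metis hnorm_uminus)+

lemma hcomplete:
  assumes v: "\<And>n. v n \<in> carrier H"
    and cauchy: "\<And>\<epsilon>. \<epsilon> > 0 \<Longrightarrow> \<exists>N::nat. \<forall>m\<ge>N. \<forall>n\<ge>N. hnorm H (v m \<ominus> v n) < \<epsilon>"
  obtains x where "x \<in> carrier H" "\<And>\<epsilon>. \<epsilon> > 0 \<Longrightarrow> \<exists>N. \<forall>n\<ge>N. hnorm H (v n \<ominus> x) < \<epsilon>"
proof -
  have "hmetric.MCauchy v"
    unfolding hmetric.MCauchy_def using v cauchy by (fastforce simp: hdist_def)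
  then obtain x where x: "limitin (htopology H) v x sequentially"
    using complete unfolding hmetric.mcomplete_def by blast
  show thesis
  proof
    show xH: "x \<in> carrier H" using x by (simp add: hmetric.limitin_metric)
    show "\<exists>N. \<forall>n\<ge>N. hnorm H (v n \<ominus> x) < \<epsilon>" if "\<epsilon> > 0" for \<epsilon>
      using x that xH v by (auto simp: hmetric.limitin_metric eventually_sequentially hdist_def)
  qed
qed

text \<open>Negation is multiplication by -1, which supplies the closure under additive
  inverses.\<close>

lemma submodule_iff:
  "submodule W complex_field H \<longleftrightarrow>
    W \<subseteq> carrier H \<and> \<zero> \<in> W \<and> (\<forall>x\<in>W. \<forall>y\<in>W. x \<oplus> y \<in> W) \<and> (\<forall>c. \<forall>x\<in>W. c \<odot> x \<in> W)"
  (is "_ \<longleftrightarrow> ?rhs")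
proof
  assume "submodule W complex_field H"
  then interpret submodule W complex_field H .
  from submodule_axioms show ?rhs
    using subgroup.subset[of W "add_monoid H"] subgroup.m_closed[of W "add_monoid H"]
      subgroup.one_closed[of W "add_monoid H"] by (auto simp: submodule_def submodule_axioms_def)
next
  assume r: ?rhs
  show "submodule W complex_field H"
  proof (rule submoduleI)
    fix x assume "x \<in> W"
    moreover have "\<ominus> x = (-1) \<odot> x" if "x \<in> carrier H"
      by (rule ip_ext) (use that in \<open>simp_all add: ip_uminus_left ip_simps\<close>)
    ultimately show "\<ominus> x \<in> W" using r by (metis subsetD)
  qed (use r in auto)
qed

lemma submodule_hspan: "A \<subseteq> carrier H \<Longrightarrow> submodule (hspan H A) complex_field H"
proof -
  assume A: "A \<subseteq> carrier H"
  \<comment> \<open>The whole carrier is one of the submodules that are intersected, which keeps the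
    hull inside the carrier.\<close>
  have "submodule (carrier H) complex_field H" by (simp add: submodule_iff)
  then show ?thesis using A unfolding submodule_iff hspan_def hull_def by auto
qed

lemma hspan_induct:
  assumes "x \<in> hspan H A" "A \<subseteq> carrier H"
    and "\<And>x. x \<in> A \<Longrightarrow> Q x" "Q \<zero>"
    and "\<And>x y. x \<in> carrier H \<Longrightarrow> y \<in> carrier H \<Longrightarrow> Q x \<Longrightarrow> Q y \<Longrightarrow> Q (x \<oplus> y)"
    and "\<And>c x. x \<in> carrier H \<Longrightarrow> Q x \<Longrightarrow> Q (c \<odot> x)"
  shows "Q x"
proof -
  have "submodule {x \<in> carrier H. Q x} complex_field H" using assms by (simp add: submodule_iff)
  then have "hspan H A \<subseteq> {x \<in> carrier H. Q x}"
    unfolding hspan_def by (intro hull_minimal) (use assms in auto)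
  then show ?thesis using assms(1) by auto
qed

lemma total_in_approx:
  assumes "total_in H A" "x \<in> carrier H" "\<epsilon> > 0"
  obtains y where "y \<in> hspan H A" "y \<in> carrier H" "hnorm H (y \<ominus> x) < \<epsilon>"
proof -
  have "x \<in> htopology H closure_of (hspan H A)"
    using assms by (simp add: total_in_def hspan_def)
  then show thesis using assms that by (auto simp: in_hclosure)
qed

end

section \<open>Bounded linear maps\<close>

text \<open>\<open>linear_operator\<close> has equal source and target. Maps between different
  fibres are needed as well, such as \<open>\<eta> \<mapsto> z \<cdot> \<eta>\<close> or a
  functional tensored with the identity.\<close>

definition hlinear ::
  "('x, 'b) hspace_scheme \<Rightarrow> ('y, 'c) hspace_scheme \<Rightarrow> ('x \<Rightarrow> 'y) \<Rightarrow> bool" where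
  "hlinear H K f \<longleftrightarrow>
     f \<in> carrier H \<rightarrow> carrier K \<and>
     (\<forall>x\<in>carrier H. \<forall>y\<in>carrier H. f (x \<oplus>\<^bsub>H\<^esub> y) = f x \<oplus>\<^bsub>K\<^esub> f y) \<and>
     (\<forall>c. \<forall>x\<in>carrier H. f (c \<odot>\<^bsub>H\<^esub> x) = c \<odot>\<^bsub>K\<^esub> f x)"

text \<open>The bound is an explicit argument so that it can be tracked: amplification keeps it, and
  approximation errors are measured by it.\<close>

definition hbounded ::
  "('x, 'b) hspace_scheme \<Rightarrow> ('y, 'c) hspace_scheme \<Rightarrow> real \<Rightarrow> ('x \<Rightarrow> 'y) \<Rightarrow> bool" where
  "hbounded H K B f \<longleftrightarrow>
     hlinear H K f \<and> 0 \<le> B \<and> (\<forall>x\<in>carrier H. hnorm K (f x) \<le> B * hnorm H x)"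

text \<open>The values are plain complex numbers, so that a rank one map into any fibre can be
  written with a scalar \<open>\<phi> x\<close> in front of a fixed vector.\<close>

definition hfunctional :: "('x, 'b) hspace_scheme \<Rightarrow> real \<Rightarrow> ('x \<Rightarrow> complex) \<Rightarrow> bool" where
  "hfunctional H B \<phi> \<longleftrightarrow> 0 \<le> B \<and>
     (\<forall>x\<in>carrier H. \<forall>y\<in>carrier H. \<phi> (x \<oplus>\<^bsub>H\<^esub> y) = \<phi> x + \<phi> y) \<and>
     (\<forall>c. \<forall>x\<in>carrier H. \<phi> (c \<odot>\<^bsub>H\<^esub> x) = c * \<phi> x) \<and>
     (\<forall>x\<in>carrier H. cmod (\<phi> x) \<le> B * hnorm H x)"

lemma hlinear_in: "hlinear H K f \<Longrightarrow> x \<in> carrier H \<Longrightarrow> f x \<in> carrier K"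
  and hlinear_add:
    "hlinear H K f \<Longrightarrow> x \<in> carrier H \<Longrightarrow> y \<in> carrier H \<Longrightarrow> f (x \<oplus>\<^bsub>H\<^esub> y) = f x \<oplus>\<^bsub>K\<^esub> f y"
  and hlinear_smult: "hlinear H K f \<Longrightarrow> x \<in> carrier H \<Longrightarrow> f (c \<odot>\<^bsub>H\<^esub> x) = c \<odot>\<^bsub>K\<^esub> f x"
  by (auto simp: hlinear_def)

lemma hbounded_linear: "hbounded H K B f \<Longrightarrow> hlinear H K f"
  and hbounded_nonneg: "hbounded H K B f \<Longrightarrow> 0 \<le> B"
  and hbounded_le: "hbounded H K B f \<Longrightarrow> x \<in> carrier H \<Longrightarrow> hnorm K (f x) \<le> B * hnorm H x"
  by (auto simp: hbounded_def)

lemmas hbounded_in = hlinear_in[OF hbounded_linear]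
  and hbounded_add = hlinear_add[OF hbounded_linear]
  and hbounded_smult = hlinear_smult[OF hbounded_linear]

locale hilbert_pair = H: hilbert_space H + K: hilbert_space K
  for H :: "('x, 'b) hspace_scheme" and K :: "('y, 'c) hspace_scheme"
begin

lemma hlinear_zero: "hlinear H K f \<Longrightarrow> f \<zero>\<^bsub>H\<^esub> = \<zero>\<^bsub>K\<^esub>"
  using hlinear_smult[of H K f "\<zero>\<^bsub>H\<^esub>" 0] hlinear_in[of H K f "\<zero>\<^bsub>H\<^esub>"] by simp

lemma hlinear_minus:
  "hlinear H K f \<Longrightarrow> x \<in> carrier H \<Longrightarrow> y \<in> carrier H \<Longrightarrow> f (x \<ominus>\<^bsub>H\<^esub> y) = f x \<ominus>\<^bsub>K\<^esub> f y"
  by (simp add: H.minus_conv_add K.minus_conv_add hlinear_in hlinear_add hlinear_smult)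

lemma hlinear_cong:
  assumes "hlinear H K f" "\<And>x. x \<in> carrier H \<Longrightarrow> g x = f x"
  shows "hlinear H K g"
  using assms by (auto simp: hlinear_def Pi_iff)

lemma hbounded_cong:
  assumes "hbounded H K B f" "\<And>x. x \<in> carrier H \<Longrightarrow> g x = f x"
  shows "hbounded H K B g"
  using assms hlinear_cong[of f g] by (auto simp: hbounded_def)

lemma hlinear_plus:
  assumes "hlinear H K f" "hlinear H K g"
  shows "hlinear H K (\<lambda>x. f x \<oplus>\<^bsub>K\<^esub> g x)"
  unfolding hlinear_def
proof (intro conjI ballI allI)
  show "f (x \<oplus>\<^bsub>H\<^esub> y) \<oplus>\<^bsub>K\<^esub> g (x \<oplus>\<^bsub>H\<^esub> y) = f x \<oplus>\<^bsub>K\<^esub> g x \<oplus>\<^bsub>K\<^esub> (f y \<oplus>\<^bsub>K\<^esub> g y)"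
    if "x \<in> carrier H" "y \<in> carrier H" for x y
    using that assms by (intro K.ip_ext) (simp_all add: hlinear_in hlinear_add K.ip_simps)
  show "f (c \<odot>\<^bsub>H\<^esub> x) \<oplus>\<^bsub>K\<^esub> g (c \<odot>\<^bsub>H\<^esub> x) = c \<odot>\<^bsub>K\<^esub> (f x \<oplus>\<^bsub>K\<^esub> g x)"
    if "x \<in> carrier H" for c x
    using that assms
    by (intro K.ip_ext) (simp_all add: hlinear_in hlinear_smult K.ip_simps algebra_simps)
qed (use assms in \<open>simp add: Pi_iff hlinear_in\<close>)

lemma hbounded_plus:
  assumes "hbounded H K B f" "hbounded H K C g"
  shows "hbounded H K (B + C) (\<lambda>x. f x \<oplus>\<^bsub>K\<^esub> g x)"
  unfolding hbounded_def
proof (intro conjI ballI)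
  show "hnorm K (f x \<oplus>\<^bsub>K\<^esub> g x) \<le> (B + C) * hnorm H x" if "x \<in> carrier H" for x
    using K.hnorm_add[of "f x" "g x"] that hbounded_le[OF assms(1) that] hbounded_le[OF assms(2) that]
      hbounded_in[OF assms(1) that] hbounded_in[OF assms(2) that]
    by (simp add: algebra_simps)
qed (use assms hlinear_plus[of f g] in \<open>simp_all add: hbounded_def\<close>)

lemma hlinear_diff:
  assumes f: "hlinear H K f" and g: "hlinear H K g"
  shows "hlinear H K (\<lambda>x. f x \<ominus>\<^bsub>K\<^esub> g x)"
  unfolding hlinear_def
proof (intro conjI ballI allI)
  note in_K = hlinear_in[OF f] hlinear_in[OF g]
  show "(\<lambda>x. f x \<ominus>\<^bsub>K\<^esub> g x) \<in> carrier H \<rightarrow> carrier K" using in_K by simp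
  show "f (x \<oplus>\<^bsub>H\<^esub> y) \<ominus>\<^bsub>K\<^esub> g (x \<oplus>\<^bsub>H\<^esub> y) = f x \<ominus>\<^bsub>K\<^esub> g x \<oplus>\<^bsub>K\<^esub> (f y \<ominus>\<^bsub>K\<^esub> g y)"
    if "x \<in> carrier H" "y \<in> carrier H" for x y
    unfolding hlinear_add[OF f that] hlinear_add[OF g that]
    using that in_K by (intro K.ip_ext) (simp_all add: K.ip_simps)
  show "f (c \<odot>\<^bsub>H\<^esub> x) \<ominus>\<^bsub>K\<^esub> g (c \<odot>\<^bsub>H\<^esub> x) = c \<odot>\<^bsub>K\<^esub> (f x \<ominus>\<^bsub>K\<^esub> g x)"
    if "x \<in> carrier H" for c x
    unfolding hlinear_smult[OF f that] hlinear_smult[OF g that]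
    using that in_K by (intro K.ip_ext) (simp_all add: K.ip_simps algebra_simps)
qed

lemma hbounded_diff:
  assumes f: "hbounded H K B f" and g: "hbounded H K C g"
  shows "hbounded H K (B + C) (\<lambda>x. f x \<ominus>\<^bsub>K\<^esub> g x)"
  unfolding hbounded_def
proof (intro conjI ballI)
  show "hnorm K (f x \<ominus>\<^bsub>K\<^esub> g x) \<le> (B + C) * hnorm H x" if x: "x \<in> carrier H" for x
  proof -
    have in_K: "f x \<in> carrier K" "g x \<in> carrier K" using hbounded_in[OF f x] hbounded_in[OF g x] by auto
    then have "hnorm K (f x \<ominus>\<^bsub>K\<^esub> g x) \<le> hnorm K (f x) + hnorm K ((-1) \<odot>\<^bsub>K\<^esub> g x)"
      using K.hnorm_add[of "f x" "(-1) \<odot>\<^bsub>K\<^esub> g x"] by (simp add: K.minus_conv_add)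
    then show ?thesis
      using in_K hbounded_le[OF f x] hbounded_le[OF g x] by (simp add: algebra_simps)
  qed
qed (use f g hlinear_diff[of f g] in \<open>simp_all add: hbounded_def\<close>)

text \<open>Homogeneity: a nonzero vector is its norm times a unit vector. Estimates obtained from
  nets live on the unit ball and become bounds in this way.\<close>

lemma hbounded_unit_ball:
  assumes f: "hlinear H K f" and B: "0 \<le> B"
    and le: "\<And>x. x \<in> carrier H \<Longrightarrow> hnorm H x \<le> 1 \<Longrightarrow> hnorm K (f x) \<le> B"
  shows "hbounded H K B f"
  unfolding hbounded_def
proof (intro conjI ballI f B)
  fix x assume x: "x \<in> carrier H"
  show "hnorm K (f x) \<le> B * hnorm H x"
  proof (cases "x = \<zero>\<^bsub>H\<^esub>")
    case False
    then obtain e where e: "e \<in> carrier H" "ip H e e = 1" "x = complex_of_real (hnorm H x) \<odot>\<^bsub>H\<^esub> e"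
      using H.normalize x by metis
    have "hnorm H e = 1" using e(2) by (simp add: hnorm_def)
    then have "hnorm K (f e) \<le> B" using le e(1) by simp
    moreover have "hnorm K (f x) = hnorm H x * hnorm K (f e)"
      using e(1) f x by (subst e(3)) (simp add: hlinear_smult hlinear_in)
    ultimately show ?thesis
      using mult_left_mono[OF _ H.hnorm_nonneg[OF x], of "hnorm K (f e)" B] by (simp only: mult.commute)
  qed (simp add: hlinear_zero[OF f])
qed

text \<open>The difference of the two maps is bounded and vanishes on the span of \<open>A\<close>,
  so its value at \<open>x\<close> is its value at \<open>x - y\<close> for \<open>y\<close> in the
  span close to \<open>x\<close>.\<close>

lemma hbounded_eq_on_total:
  assumes f: "hbounded H K B f" and g: "hbounded H K C g" and A: "total_in H A"
    and eq: "\<And>x. x \<in> A \<Longrightarrow> f x = g x" and x: "x \<in> carrier H"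
  shows "f x = g x"
proof -
  have AH: "A \<subseteq> carrier H" using A by (simp add: total_in_def)
  have span: "f y = g y" if "y \<in> hspan H A" for y
    using that AH eq
    by (rule H.hspan_induct)
      (auto simp: hlinear_zero[OF hbounded_linear[OF f]] hlinear_zero[OF hbounded_linear[OF g]] hbounded_add[OF f] hbounded_add[OF g]
        hbounded_smult[OF f] hbounded_smult[OF g])
  let ?h = "\<lambda>x. f x \<ominus>\<^bsub>K\<^esub> g x"
  have h: "hbounded H K (B + C) ?h" using f g by (rule hbounded_diff)
  have "hnorm K (?h x) \<le> 0"
  proof (rule field_le_epsilon)
    fix \<epsilon> :: real assume \<epsilon>: "0 < \<epsilon>"
    \<comment> \<open>The summand 1 makes the divisor positive when both bounds are 0.\<close>
    have BC: "0 < B + C + 1" using hbounded_nonneg[OF h] by simp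
    then obtain y where y: "y \<in> hspan H A" "y \<in> carrier H" "hnorm H (y \<ominus>\<^bsub>H\<^esub> x) < \<epsilon> / (B + C + 1)"
      using H.total_in_approx[OF A x] \<epsilon> by (metis divide_pos_pos)
    have "?h y = \<zero>\<^bsub>K\<^esub>" using span y hbounded_in[OF g] by (simp add: K.minus_eq_zero)
    then have "?h x = ?h (x \<ominus>\<^bsub>H\<^esub> y)"
      using hlinear_minus[OF hbounded_linear[OF h] x y(2)] hbounded_in[OF h x]
      by (simp add: K.minus_conv_add)
    also have "hnorm K \<dots> \<le> (B + C) * hnorm H (x \<ominus>\<^bsub>H\<^esub> y)"
      using hbounded_le[OF h, of "x \<ominus>\<^bsub>H\<^esub> y"] x y by simp
    also have "\<dots> \<le> (B + C + 1) * hnorm H (y \<ominus>\<^bsub>H\<^esub> x)"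
      using x y by (simp add: H.hnorm_uminus[of x] mult_right_mono)
    also have "\<dots> \<le> \<epsilon>" using y(3) BC by (simp add: field_simps)
    finally show "hnorm K (?h x) \<le> 0 + \<epsilon>" by simp
  qed
  then show ?thesis using K.eq_of_hnorm_minus[OF hbounded_in[OF f x] hbounded_in[OF g x]] by blast
qed

text \<open>
  The extension is the closure of the graph \<open>R\<close>, which is again the graph of a bounded map.
\<close>

lemma hbounded_extension:
  fixes R :: "'x \<Rightarrow> 'y \<Rightarrow> bool"
  assumes RH: "\<And>a b. R a b \<Longrightarrow> a \<in> carrier H" and RK: "\<And>a b. R a b \<Longrightarrow> b \<in> carrier K"
    and add: "\<And>a b a' b'. R a b \<Longrightarrow> R a' b' \<Longrightarrow> R (a \<oplus>\<^bsub>H\<^esub> a') (b \<oplus>\<^bsub>K\<^esub> b')"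
    and smult: "\<And>c a b. R a b \<Longrightarrow> R (c \<odot>\<^bsub>H\<^esub> a) (c \<odot>\<^bsub>K\<^esub> b)"
    and le: "\<And>a b. R a b \<Longrightarrow> hnorm K b \<le> B * hnorm H a" and B: "0 \<le> B"
    and dense: "\<And>x \<epsilon>. x \<in> carrier H \<Longrightarrow> \<epsilon> > 0 \<Longrightarrow> \<exists>a b. R a b \<and> hnorm H (a \<ominus>\<^bsub>H\<^esub> x) < \<epsilon>"
  obtains f where "hbounded H K B f" "\<And>a b. R a b \<Longrightarrow> f a = b"
proof -
  define L where "L x y \<longleftrightarrow> x \<in> carrier H \<and> y \<in> carrier K \<and>
    (\<forall>\<epsilon>>0. \<exists>a b. R a b \<and> hnorm H (a \<ominus>\<^bsub>H\<^esub> x) < \<epsilon> \<and> hnorm K (b \<ominus>\<^bsub>K\<^esub> y) < \<epsilon>)" for x y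
  have R_diff: "R (a \<ominus>\<^bsub>H\<^esub> a') (b \<ominus>\<^bsub>K\<^esub> b')" if "R a b" "R a' b'" for a b a' b'
    using add[OF that(1) smult[OF that(2), of "-1"]] RH[OF that(1)] RH[OF that(2)] RK[OF that(1)] RK[OF that(2)]
    by (simp add: H.minus_conv_add K.minus_conv_add)
  have RL: "L a b" if "R a b" for a b
  proof -
    have "a \<ominus>\<^bsub>H\<^esub> a = \<zero>\<^bsub>H\<^esub>" "b \<ominus>\<^bsub>K\<^esub> b = \<zero>\<^bsub>K\<^esub>"
      using RH[OF that] RK[OF that] by (simp_all add: H.minus_eq_zero K.minus_eq_zero)
    then have "\<exists>a' b'. R a' b' \<and> hnorm H (a' \<ominus>\<^bsub>H\<^esub> a) < \<epsilon> \<and> hnorm K (b' \<ominus>\<^bsub>K\<^esub> b) < \<epsilon>" if "\<epsilon> > 0" for \<epsilon>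
      using \<open>R a b\<close> \<open>\<epsilon> > 0\<close> by (intro exI[where x = a], intro exI[where x = b]) simp
    then show ?thesis
      unfolding L_def using RH[OF that] RK[OF that] by simp
  qed
  have L_add: "L (x \<oplus>\<^bsub>H\<^esub> x') (y \<oplus>\<^bsub>K\<^esub> y')" if "L x y" "L x' y'" for x y x' y'
    unfolding L_def
  proof (intro conjI allI impI)
    fix \<epsilon> :: real assume "0 < \<epsilon>"
    then have "0 < \<epsilon> / 2" by simp
    then obtain a b a' b' where ab: "R a b" "hnorm H (a \<ominus>\<^bsub>H\<^esub> x) < \<epsilon> / 2" "hnorm K (b \<ominus>\<^bsub>K\<^esub> y) < \<epsilon> / 2"
      and ab': "R a' b'" "hnorm H (a' \<ominus>\<^bsub>H\<^esub> x') < \<epsilon> / 2" "hnorm K (b' \<ominus>\<^bsub>K\<^esub> y') < \<epsilon> / 2"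
      using \<open>L x y\<close> \<open>L x' y'\<close> unfolding L_def by meson
    have "hnorm H (a \<oplus>\<^bsub>H\<^esub> a' \<ominus>\<^bsub>H\<^esub> (x \<oplus>\<^bsub>H\<^esub> x')) < \<epsilon>"
      using H.hnorm_add_diff[of a a' x x'] ab ab' RH that by (auto simp: L_def)
    moreover have "hnorm K (b \<oplus>\<^bsub>K\<^esub> b' \<ominus>\<^bsub>K\<^esub> (y \<oplus>\<^bsub>K\<^esub> y')) < \<epsilon>"
      using K.hnorm_add_diff[of b b' y y'] ab ab' RK that by (auto simp: L_def)
    ultimately show "\<exists>a b. R a b \<and> hnorm H (a \<ominus>\<^bsub>H\<^esub> (x \<oplus>\<^bsub>H\<^esub> x')) < \<epsilon> \<and> hnorm K (b \<ominus>\<^bsub>K\<^esub> (y \<oplus>\<^bsub>K\<^esub> y')) < \<epsilon>"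
      using add ab(1) ab'(1) by blast
  qed (use that in \<open>auto simp: L_def\<close>)
  have L_smult: "L (c \<odot>\<^bsub>H\<^esub> x) (c \<odot>\<^bsub>K\<^esub> y)" if "L x y" for c x y
    unfolding L_def
  proof (intro conjI allI impI)
    fix \<epsilon> :: real assume "0 < \<epsilon>"
    \<comment> \<open>The summand 1 covers the scalar \<open>c = 0\<close>.\<close>
    then have "0 < \<epsilon> / (cmod c + 1)" by (simp add: add_nonneg_pos)
    then obtain a b where ab: "R a b" "hnorm H (a \<ominus>\<^bsub>H\<^esub> x) < \<epsilon> / (cmod c + 1)" "hnorm K (b \<ominus>\<^bsub>K\<^esub> y) < \<epsilon> / (cmod c + 1)"
      using \<open>L x y\<close> unfolding L_def by meson
    have *: "cmod c * r < \<epsilon>" if "r < \<epsilon> / (cmod c + 1)" "0 \<le> r" for r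
    proof -
      have "cmod c * r \<le> (cmod c + 1) * r" using that by (simp add: mult_right_mono)
      also have "\<dots> < \<epsilon>"
        using that pos_less_divide_eq[of "cmod c + 1" r \<epsilon>] by (simp add: add_nonneg_pos mult.commute)
      finally show ?thesis .
    qed
    have "hnorm H (c \<odot>\<^bsub>H\<^esub> a \<ominus>\<^bsub>H\<^esub> c \<odot>\<^bsub>H\<^esub> x) < \<epsilon>" "hnorm K (c \<odot>\<^bsub>K\<^esub> b \<ominus>\<^bsub>K\<^esub> c \<odot>\<^bsub>K\<^esub> y) < \<epsilon>"
      using *[OF ab(2)] *[OF ab(3)] ab(1) RH RK that
      by (auto simp: L_def H.smult_minus K.smult_minus)
    then show "\<exists>a b. R a b \<and> hnorm H (a \<ominus>\<^bsub>H\<^esub> c \<odot>\<^bsub>H\<^esub> x) < \<epsilon> \<and> hnorm K (b \<ominus>\<^bsub>K\<^esub> c \<odot>\<^bsub>K\<^esub> y) < \<epsilon>"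
      using smult ab(1) by blast
  qed (use that in \<open>auto simp: L_def\<close>)
  have L_le: "hnorm K y \<le> B * hnorm H x" if "L x y" for x y
  proof (rule field_le_epsilon)
    fix \<epsilon> :: real assume \<epsilon>: "0 < \<epsilon>"
    then have "0 < \<epsilon> / (B + 1)" using B by simp
    then obtain a b where ab: "R a b" "hnorm H (a \<ominus>\<^bsub>H\<^esub> x) < \<epsilon> / (B + 1)" "hnorm K (b \<ominus>\<^bsub>K\<^esub> y) < \<epsilon> / (B + 1)"
      using \<open>L x y\<close> unfolding L_def by meson
    have xy: "x \<in> carrier H" "y \<in> carrier K" using that by (auto simp: L_def)
    have "hnorm K y \<le> hnorm K b + \<epsilon> / (B + 1)"
      using K.hnorm_le_minus[OF xy(2) RK[OF ab(1)]] ab xy RK by (simp add: K.hnorm_uminus[of y])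
    also have "hnorm K b \<le> B * (hnorm H x + \<epsilon> / (B + 1))"
    proof (rule order_trans[OF le[OF ab(1)]])
      show "B * hnorm H a \<le> B * (hnorm H x + \<epsilon> / (B + 1))"
        using H.hnorm_le_minus[OF RH[OF ab(1)] xy(1)] ab B by (intro mult_left_mono) auto
    qed
    finally have "hnorm K y \<le> B * (hnorm H x + \<epsilon> / (B + 1)) + \<epsilon> / (B + 1)" by simp
    also have "\<dots> = B * hnorm H x + (B + 1) * (\<epsilon> / (B + 1))" by (simp only: distrib_left distrib_right mult_1 add.assoc)
    also have "(B + 1) * (\<epsilon> / (B + 1)) = \<epsilon>" using B by simp
    finally show "hnorm K y \<le> B * hnorm H x + \<epsilon>" .
  qed
  have L_total: "\<exists>y. L x y" if x: "x \<in> carrier H" for x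
  proof -
    \<comment> \<open>A sequence of graph points whose first components converge to
      \<open>x\<close>; the second components will turn out to converge too, and their limit is the
      value at \<open>x\<close>.\<close>
    have "\<exists>a b. R a b \<and> hnorm H (a \<ominus>\<^bsub>H\<^esub> x) < inverse (Suc n)" for n
      using dense[OF x, of "inverse (Suc n)"] by simp
    then have "\<exists>p. R (fst p) (snd p) \<and> hnorm H (fst p \<ominus>\<^bsub>H\<^esub> x) < inverse (Suc n)" for n
      by simp
    then obtain p where p: "\<And>n. R (fst (p n)) (snd (p n)) \<and> hnorm H (fst (p n) \<ominus>\<^bsub>H\<^esub> x) < inverse (Suc n)"
      by metis
    define a b where "a n = fst (p n)" and "b n = snd (p n)" for n
    then have ab: "\<And>n. R (a n) (b n)" "\<And>n. hnorm H (a n \<ominus>\<^bsub>H\<^esub> x) < inverse (Suc n)"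
      using p by auto
    note abH = RH[OF ab(1)] and abK = RK[OF ab(1)]
    have small: "\<exists>N. \<forall>n\<ge>N. C * inverse (real (Suc n)) < \<epsilon>" if "\<epsilon> > 0" "C \<ge> 0" for C \<epsilon> :: real
    proof -
      have "0 < \<epsilon> / (C + 1)" using that by simp
      from reals_Archimedean[OF this] obtain N where N: "inverse (real (Suc N)) < \<epsilon> / (C + 1)" ..
      have "C * inverse (real (Suc n)) < \<epsilon>" if "n \<ge> N" for n
      proof -
        have "inverse (real (Suc n)) \<le> inverse (real (Suc N))" using that by simp
        then have "inverse (real (Suc n)) < \<epsilon> / (C + 1)" using N by linarith
        then have "(C + 1) * inverse (real (Suc n)) < \<epsilon>"
          using \<open>C \<ge> 0\<close> by (simp add: pos_less_divide_eq mult.commute)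
        moreover have "C * inverse (real (Suc n)) \<le> (C + 1) * inverse (real (Suc n))"
          by (intro mult_right_mono) auto
        ultimately show ?thesis by linarith
      qed
      then show ?thesis by blast
    qed
    obtain y where y: "y \<in> carrier K" "\<And>\<epsilon>. \<epsilon> > 0 \<Longrightarrow> \<exists>N. \<forall>n\<ge>N. hnorm K (b n \<ominus>\<^bsub>K\<^esub> y) < \<epsilon>"
    \<comment> \<open>Differences of graph points are graph points, so the bound \<open>B\<close>
      makes \<open>b\<close> a Cauchy sequence along with \<open>a\<close>.\<close>
    proof (rule K.hcomplete[of b])
      fix \<epsilon> :: real assume "\<epsilon> > 0"
      then obtain N where N: "\<forall>n\<ge>N. (2 * B) * inverse (real (Suc n)) < \<epsilon>"
        using small[of \<epsilon> "2 * B"] B by auto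
      have "hnorm K (b m \<ominus>\<^bsub>K\<^esub> b n) < \<epsilon>" if "m \<ge> N" "n \<ge> N" for m n
      proof -
        have "hnorm K (b m \<ominus>\<^bsub>K\<^esub> b n) \<le> B * hnorm H (a m \<ominus>\<^bsub>H\<^esub> a n)"
          by (intro le R_diff ab)
        also have "\<dots> \<le> B * (inverse (Suc m) + inverse (Suc n))"
          using H.hnorm_triangle[OF abH[of m] x abH[of n]] ab(2)[of m] ab(2)[of n] H.hnorm_uminus[OF x abH[of n]]
          by (intro mult_left_mono B) linarith
        also have "\<dots> = B * inverse (Suc m) + B * inverse (Suc n)"
          by (rule distrib_left)
        also have "\<dots> < \<epsilon>"
          using N[rule_format, OF that(1)] N[rule_format, OF that(2)] by linarith
        finally show ?thesis .
      qed
      then show "\<exists>N. \<forall>m\<ge>N. \<forall>n\<ge>N. hnorm K (b m \<ominus>\<^bsub>K\<^esub> b n) < \<epsilon>" by blast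
    qed (use abK in auto)
    have "L x y"
      unfolding L_def
    proof (intro conjI allI impI x y)
      fix \<epsilon> :: real assume \<epsilon>: "\<epsilon> > 0"
      obtain N where N: "\<forall>n\<ge>N. hnorm K (b n \<ominus>\<^bsub>K\<^esub> y) < \<epsilon>" using y(2)[OF \<epsilon>] by blast
      obtain M where M: "\<forall>n\<ge>M. 1 * inverse (real (Suc n)) < \<epsilon>" using small[OF \<epsilon>, of 1] by auto
      have "hnorm H (a (max N M) \<ominus>\<^bsub>H\<^esub> x) < \<epsilon>" "hnorm K (b (max N M) \<ominus>\<^bsub>K\<^esub> y) < \<epsilon>"
        using N[rule_format, of "max N M"] M[rule_format, of "max N M"] ab(2)[of "max N M"] by linarith+
      then show "\<exists>a b. R a b \<and> hnorm H (a \<ominus>\<^bsub>H\<^esub> x) < \<epsilon> \<and> hnorm K (b \<ominus>\<^bsub>K\<^esub> y) < \<epsilon>"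
        using ab(1) by blast
    qed
    then show ?thesis ..
  qed
  have L_unique: "y = y'" if "L x y" "L x y'" for x y y'
  proof -
    have xy: "x \<in> carrier H" "y \<in> carrier K" "y' \<in> carrier K" using that by (auto simp: L_def)
    \<comment> \<open>Two values over the same \<open>x\<close> differ by a value over 0, and the
      bound forces that to vanish.\<close>
    have "L (x \<ominus>\<^bsub>H\<^esub> x) (y \<ominus>\<^bsub>K\<^esub> y')"
      using L_add[OF that(1) L_smult[OF that(2), of "-1"]] xy by (simp add: H.minus_conv_add K.minus_conv_add)
    then have "hnorm K (y \<ominus>\<^bsub>K\<^esub> y') \<le> 0" using L_le[of "x \<ominus>\<^bsub>H\<^esub> x"] xy H.minus_eq_zero[of x x] by fastforce
    then show ?thesis using xy K.eq_of_hnorm_minus by blast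
  qed
  define f where "f x = (THE y. L x y)" for x
  have f: "L x y \<longleftrightarrow> f x = y" if "x \<in> carrier H" for x y
    unfolding f_def using L_total[OF that] L_unique by (metis the_equality)
  show thesis
  proof
    show "hbounded H K B f"
      unfolding hbounded_def hlinear_def
    proof (intro conjI ballI allI B)
      have Lf: "L x (f x)" if "x \<in> carrier H" for x using f that by simp
      show "f \<in> carrier H \<rightarrow> carrier K" using Lf by (auto simp: L_def)
      show "f (x \<oplus>\<^bsub>H\<^esub> y) = f x \<oplus>\<^bsub>K\<^esub> f y" if "x \<in> carrier H" "y \<in> carrier H" for x y
        using f L_add[OF Lf[OF that(1)] Lf[OF that(2)]] that by simp
      show "f (c \<odot>\<^bsub>H\<^esub> x) = c \<odot>\<^bsub>K\<^esub> f x" if "x \<in> carrier H" for c x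
        using f L_smult[OF Lf[OF that]] that by simp
      show "hnorm K (f x) \<le> B * hnorm H x" if "x \<in> carrier H" for x
        using L_le Lf that by blast
    qed
    show "f a = b" if "R a b" for a b using RL[OF that] f RH[OF that] by simp
  qed
qed

end

lemma hlinear_comp:
  "hlinear H K f \<Longrightarrow> hlinear K L g \<Longrightarrow> hlinear H L (\<lambda>x. g (f x))"
  by (simp add: hlinear_def Pi_iff)

lemma hbounded_comp:
  assumes "hbounded H K B f" "hbounded K L C g"
  shows "hbounded H L (C * B) (\<lambda>x. g (f x))"
  unfolding hbounded_def
proof (intro conjI ballI)
  show "hnorm L (g (f x)) \<le> C * B * hnorm H x" if "x \<in> carrier H" for x
  proof -
    have "hnorm L (g (f x)) \<le> C * hnorm K (f x)"
      using that assms by (simp add: hbounded_le hbounded_in)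
    also have "\<dots> \<le> C * (B * hnorm H x)"
      using that assms by (intro mult_left_mono) (auto simp: hbounded_le hbounded_nonneg)
    finally show ?thesis by (simp add: mult.assoc)
  qed
qed (use assms hlinear_comp[of H K f L g] in \<open>simp_all add: hbounded_def\<close>)

section \<open>Orthonormal families\<close>

text \<open>The span of a finite list, by recursion, so that inductions along orthonormal lists can
  split off one vector at a time; \<open>hspan\<close> serves arbitrary sets.\<close>

primrec lspan :: "('x, 'b) hspace_scheme \<Rightarrow> 'x list \<Rightarrow> 'x set" where
  "lspan H [] = {\<zero>\<^bsub>H\<^esub>}"
| "lspan H (e # es) = {c \<odot>\<^bsub>H\<^esub> e \<oplus>\<^bsub>H\<^esub> y | c y. y \<in> lspan H es}"

text \<open>Each vector is paired with the later ones; conjugate symmetry gives the other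
  pairings.\<close>

primrec orthonormal :: "('x, 'b) hspace_scheme \<Rightarrow> 'x list \<Rightarrow> bool" where
  "orthonormal H [] \<longleftrightarrow> True"
| "orthonormal H (e # es) \<longleftrightarrow>
     e \<in> carrier H \<and> ip H e e = 1 \<and> (\<forall>d\<in>set es. ip H e d = 0) \<and> orthonormal H es"

text \<open>For orthonormal \<open>es\<close> this is the orthogonal projection onto
  \<open>lspan H es\<close>.\<close>

primrec hproj :: "('x, 'b) hspace_scheme \<Rightarrow> 'x list \<Rightarrow> 'x \<Rightarrow> 'x" where
  "hproj H [] w = \<zero>\<^bsub>H\<^esub>"
| "hproj H (e # es) w = ip H w e \<odot>\<^bsub>H\<^esub> e \<oplus>\<^bsub>H\<^esub> hproj H es w"

context hilbert_space
begin

lemma orthonormal_subset: "orthonormal H es \<Longrightarrow> set es \<subseteq> carrier H"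
  by (induction es) auto

lemma lspan_subset:
  assumes "submodule W complex_field H" "set es \<subseteq> W"
  shows "lspan H es \<subseteq> W"
  using assms(2) by (induction es) (use assms(1) in \<open>auto simp: submodule_iff\<close>)

lemma lspan_in: "set es \<subseteq> carrier H \<Longrightarrow> y \<in> lspan H es \<Longrightarrow> y \<in> carrier H"
  by (induction es arbitrary: y) auto

lemma lspan_submodule:
  assumes "set es \<subseteq> carrier H"
  shows "submodule (lspan H es) complex_field H"
  using assms
proof (induction es)
  case Nil
  then show ?case by (simp add: submodule_iff)
next
  case (Cons e es)
  then have e: "e \<in> carrier H" and es: "set es \<subseteq> carrier H" by auto
  have IH: "\<zero> \<in> lspan H es" "\<And>x y. x \<in> lspan H es \<Longrightarrow> y \<in> lspan H es \<Longrightarrow> x \<oplus> y \<in> lspan H es"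
    "\<And>c x. x \<in> lspan H es \<Longrightarrow> c \<odot> x \<in> lspan H es"
    using Cons.IH[OF es] by (auto simp: submodule_iff)
  have "\<zero> \<in> lspan H (e # es)"
    using IH(1) e by simp (metis smult_0 l_zero zero_closed)
  moreover have "x \<oplus> y \<in> lspan H (e # es)" if "x \<in> lspan H (e # es)" "y \<in> lspan H (e # es)" for x y
  proof -
    from that obtain a x' b y' where *: "x = a \<odot> e \<oplus> x'" "x' \<in> lspan H es" "y = b \<odot> e \<oplus> y'" "y' \<in> lspan H es"
      by auto
    then have "x \<oplus> y = (a + b) \<odot> e \<oplus> (x' \<oplus> y')"
      using e lspan_in[OF es] by (intro ip_ext) (auto simp: ip_simps algebra_simps)
    then show ?thesis using IH(2)[OF *(2,4)] by auto
  qed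
  moreover have "c \<odot> x \<in> lspan H (e # es)" if "x \<in> lspan H (e # es)" for c x
  proof -
    from that obtain a x' where *: "x = a \<odot> e \<oplus> x'" "x' \<in> lspan H es" by auto
    then have "c \<odot> x = (c * a) \<odot> e \<oplus> c \<odot> x'"
      using e lspan_in[OF es] by (intro ip_ext) (auto simp: ip_simps algebra_simps)
    then show ?thesis using IH(3)[OF *(2)] by auto
  qed
  ultimately show ?case using lspan_in[OF Cons.prems] unfolding submodule_iff by blast
qed

lemma lspan_Cons_mono:
  assumes "set (e # es) \<subseteq> carrier H" "y \<in> lspan H es"
  shows "y \<in> lspan H (e # es)"
proof -
  have "y = 0 \<odot> e \<oplus> y" using assms lspan_in[of es y] by simp
  then show ?thesis using assms(2) by auto
qed

lemma set_subset_lspan: "set es \<subseteq> carrier H \<Longrightarrow> d \<in> set es \<Longrightarrow> d \<in> lspan H es"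
proof (induction es)
  case (Cons e es)
  show ?case
  proof (cases "d = e")
    case True
    have "\<zero> \<in> lspan H es" using lspan_submodule[of es] Cons.prems by (auto simp: submodule_iff)
    moreover have "d = 1 \<odot> e \<oplus> \<zero>" using True Cons.prems by simp
    ultimately show ?thesis by auto
  next
    case False
    then show ?thesis using Cons by (intro lspan_Cons_mono) auto
  qed
qed simp

lemma orthogonal_lspan:
  assumes "e \<in> carrier H" "set es \<subseteq> carrier H" "\<forall>d\<in>set es. ip H e d = 0" "y \<in> lspan H es"
  shows "ip H e y = 0"
  using assms(2-4)
proof (induction es arbitrary: y)
  case (Cons d es)
  then obtain c y' where y: "y = c \<odot> d \<oplus> y'" "y' \<in> lspan H es" by auto
  then show ?case using Cons assms(1) lspan_in[of es y'] by (simp add: ip_simps)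
qed (use assms(1) in simp)

lemma hproj_lspan: "hproj H es w \<in> lspan H es"
  by (induction es) auto

lemma hproj_in: "set es \<subseteq> carrier H \<Longrightarrow> hproj H es w \<in> carrier H"
  using hproj_lspan lspan_in by blast

lemma hproj_orthogonal:
  assumes "orthonormal H es" "w \<in> carrier H" "y \<in> lspan H es"
  shows "ip H (w \<ominus> hproj H es w) y = 0"
  using assms(1,3)
proof (induction es arbitrary: y)
  case (Cons e es)
  then obtain c y' where y: "y = c \<odot> e \<oplus> y'" "y' \<in> lspan H es" by auto
  have e: "e \<in> carrier H" "ip H e e = 1" "\<forall>d\<in>set es. ip H e d = 0" "orthonormal H es"
    using Cons.prems by auto
  have es: "set es \<subseteq> carrier H" using e orthonormal_subset by blast
  let ?p = "hproj H es w"
  have p: "?p \<in> carrier H" using hproj_in es by blast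
  have y': "y' \<in> carrier H" using lspan_in es y by blast
  have "ip H e ?p = 0" using orthogonal_lspan e(1) es e(3) hproj_lspan by blast
  then have 1: "ip H ?p e = 0" using ip_cnj[of e ?p] e(1) p by simp
  have 2: "ip H e y' = 0" using orthogonal_lspan e(1) es e(3) y(2) by blast
  have "ip H (w \<ominus> ?p) y' = 0" using Cons.IH[OF e(4) y(2)] .
  then have 3: "ip H w y' = ip H ?p y'" using assms(2) p y' by (simp add: ip_simps)
  show ?case unfolding y(1) hproj.simps
    using assms(2) e(1,2) p y' 1 2 3 by (simp add: ip_simps algebra_simps)
qed (use assms(2) in simp)

text \<open>With \<open>p\<close> the projection of \<open>w\<close>, split \<open>w - q\<close>
  into \<open>w - p\<close> and \<open>p - q\<close>. The second lies in the span, so the two are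
  orthogonal and the theorem of Pythagoras applies.\<close>

lemma hproj_best:
  assumes "orthonormal H es" "w \<in> carrier H" "q \<in> lspan H es"
  shows "hnorm H (w \<ominus> hproj H es w) \<le> hnorm H (w \<ominus> q)"
proof -
  let ?p = "hproj H es w"
  have es: "set es \<subseteq> carrier H" using assms(1) by (rule orthonormal_subset)
  have p: "?p \<in> carrier H" and q: "q \<in> carrier H" using hproj_in lspan_in es assms by auto
  have "ip H (w \<ominus> ?p) ?p = 0" "ip H (w \<ominus> ?p) q = 0"
    using hproj_orthogonal[OF assms(1,2)] hproj_lspan assms(3) by blast+
  then have "ip H (w \<ominus> ?p) (?p \<ominus> q) = 0" using p q assms(2) by (simp add: ip_minus_right)
  then have "(hnorm H ((w \<ominus> ?p) \<oplus> (?p \<ominus> q)))\<^sup>2 = (hnorm H (w \<ominus> ?p))\<^sup>2 + (hnorm H (?p \<ominus> q))\<^sup>2"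
    using p q assms(2) by (intro pythagoras) auto
  moreover have "(w \<ominus> ?p) \<oplus> (?p \<ominus> q) = w \<ominus> q"
    using p q assms(2) by (intro ip_ext) (simp_all add: ip_simps)
  ultimately have "(hnorm H (w \<ominus> ?p))\<^sup>2 \<le> (hnorm H (w \<ominus> q))\<^sup>2" by simp
  then show ?thesis using p q assms(2) by (simp add: power2_le_iff_abs_le)
qed

text \<open>A vector already in the span of the earlier ones is skipped, so linear dependence is
  harmless. Staying inside \<open>W\<close> matters when \<open>W\<close> is the span of a
  prescribed total set: the projection onto \<open>es\<close> then has its range in that
  span.\<close>

lemma gram_schmidt:
  assumes W: "submodule W complex_field H" and ys: "set ys \<subseteq> W"
  obtains es where "orthonormal H es" "set es \<subseteq> W" "set ys \<subseteq> lspan H es"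
proof -
  have "\<exists>es. orthonormal H es \<and> set es \<subseteq> W \<and> set ys \<subseteq> lspan H es"
    using ys
  proof (induction ys)
    case Nil
    show ?case by (rule exI[of _ "[]"]) simp
  next
    case (Cons y ys)
    then obtain es where es: "orthonormal H es" "set es \<subseteq> W" "set ys \<subseteq> lspan H es" by auto
    have WH: "W \<subseteq> carrier H" using W by (simp add: submodule_iff)
    have esH: "set es \<subseteq> carrier H" using es WH by auto
    have y: "y \<in> carrier H" "y \<in> W" using Cons.prems WH by auto
    let ?p = "hproj H es y"
    have p: "?p \<in> lspan H es" by (rule hproj_lspan)
    have pW: "?p \<in> W" using p lspan_subset[OF W es(2)] by blast
    have pH: "?p \<in> carrier H" using pW WH by blast
    show ?case
    proof (cases "y \<ominus> ?p = \<zero>")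
      case True
      then have "y = ?p" using y(1) pH minus_eq_zero by blast
      then have "y \<in> lspan H es" using p by simp
      then show ?thesis using es by auto
    next
      case False
      have rH: "y \<ominus> ?p \<in> carrier H" using y(1) pH by simp
      let ?n = "complex_of_real (hnorm H (y \<ominus> ?p))"
      obtain e c where e: "e \<in> carrier H" "ip H e e = 1" "y \<ominus> ?p = ?n \<odot> e" "e = c \<odot> (y \<ominus> ?p)"
        using normalize[OF rH False] by metis
      have "y \<ominus> ?p \<in> W" using minus_conv_add[OF y(1) pH] W y(2) pW by (simp add: submodule_iff)
      then have eW: "e \<in> W" using W e(4) by (simp add: submodule_iff)
      have "ip H e d = 0" if "d \<in> set es" for d
      proof -
        have d: "d \<in> lspan H es" "d \<in> carrier H" using set_subset_lspan[OF esH that] that esH by auto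
        show ?thesis
          using hproj_orthogonal[OF es(1) y(1) d(1)] d(2) rH by (subst e(4)) (simp add: ip_smult_left)
      qed
      then have "orthonormal H (e # es)" using e es(1) by simp
      moreover have "y = ?n \<odot> e \<oplus> ?p"
        unfolding e(3)[symmetric] using y(1) pH by (intro ip_ext) (simp_all add: ip_simps)
      then have "y \<in> lspan H (e # es)" using p by auto
      moreover have "set ys \<subseteq> lspan H (e # es)" using es(3) lspan_Cons_mono[of e es] e(1) esH by auto
      ultimately show ?thesis using eW es(2) by (intro exI[of _ "e # es"]) auto
    qed
  qed
  then show thesis using that by blast
qed

end

section \<open>Compact maps\<close>

abbreviation has_net where
  "has_net H K f \<epsilon> \<equiv> \<exists>Y. finite Y \<and> Y \<subseteq> carrier K \<and>
     (\<forall>x\<in>carrier H. hnorm H x \<le> 1 \<longrightarrow> (\<exists>y\<in>Y. hnorm K (f x \<ominus>\<^bsub>K\<^esub> y) < \<epsilon>))"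

text \<open>Total boundedness of the image of the unit ball. In this form sums, limits and
  compositions reduce to rescaling nets.\<close>

definition hcompact ::
  "('x, 'b) hspace_scheme \<Rightarrow> ('y, 'c) hspace_scheme \<Rightarrow> ('x \<Rightarrow> 'y) \<Rightarrow> bool" where
  "hcompact H K f \<longleftrightarrow> hlinear H K f \<and>
     (\<forall>\<epsilon>>0. has_net H K f \<epsilon>)"

lemma hcompact_linear: "hcompact H K f \<Longrightarrow> hlinear H K f"
  by (simp add: hcompact_def)

lemma hcompact_net:
  assumes "hcompact H K f" "\<epsilon> > 0"
  shows "has_net H K f \<epsilon>"
  using assms unfolding hcompact_def by blast

lemma hcompactI:
  assumes "hlinear H K f"
    and "\<And>\<epsilon>. \<epsilon> > 0 \<Longrightarrow> has_net H K f \<epsilon>"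
  shows "hcompact H K f"
  using assms by (simp add: hcompact_def)

lemma (in hilbert_space) hlinear_self_iff: "hlinear H H f \<longleftrightarrow> linear_operator H f"
  by (auto simp: hlinear_def linear_operator_def)

text \<open>In a complete space a set has compact closure exactly if it is totally bounded. What
  remains is a mismatch of centres: \<open>has_net\<close> allows them anywhere, total boundedness
  wants them in the set.\<close>

lemma (in hilbert_space) compact_operator_iff: "compact_operator H f \<longleftrightarrow> hcompact H H f"
proof (cases "hlinear H H f")
  case lin: True
  let ?S = "f ` {x \<in> carrier H. hnorm H x \<le> 1}"
  have S: "?S \<subseteq> carrier H" using hlinear_in[OF lin] by auto
  have "hmetric.mtotally_bounded ?S \<longleftrightarrow> (\<forall>\<epsilon>>0. has_net H H f \<epsilon>)" (is "_ \<longleftrightarrow> ?r")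
  proof
    assume tb: "hmetric.mtotally_bounded ?S"
    show ?r
    proof (intro allI impI)
      fix \<epsilon> :: real assume "\<epsilon> > 0"
      then obtain Y where Y: "finite Y" "Y \<subseteq> ?S" "?S \<subseteq> (\<Union>y\<in>Y. hmetric.mball y \<epsilon>)"
        using tb unfolding hmetric.mtotally_bounded_def by meson
      have "\<exists>y\<in>Y. hnorm H (f x \<ominus> y) < \<epsilon>" if "x \<in> carrier H" "hnorm H x \<le> 1" for x
      proof -
        have "f x \<in> (\<Union>y\<in>Y. hmetric.mball y \<epsilon>)" using Y(3) that by blast
        then obtain y where y: "y \<in> Y" "f x \<in> hmetric.mball y \<epsilon>" by blast
        then have "y \<in> carrier H" using Y(2) S by blast
        from y(2)[unfolded in_mball[OF this]] show ?thesis using y(1) by blast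
      qed
      then have "\<forall>x\<in>carrier H. hnorm H x \<le> 1 \<longrightarrow> (\<exists>y\<in>Y. hnorm H (f x \<ominus> y) < \<epsilon>)"
        by (intro ballI impI)
      with Y(1) order_trans[OF Y(2) S] show "has_net H H f \<epsilon>"
        by (intro exI[of _ Y] conjI)
    qed
  next
    assume r: ?r
    show "hmetric.mtotally_bounded ?S"
      unfolding hmetric.mtotally_bounded_def
    proof (intro allI impI)
      fix \<epsilon> :: real assume "\<epsilon> > 0"
      then have "\<epsilon> / 2 > 0" by simp
      then obtain Y where Y: "finite Y" "Y \<subseteq> carrier H"
        "\<forall>x\<in>carrier H. hnorm H x \<le> 1 \<longrightarrow> (\<exists>y\<in>Y. hnorm H (f x \<ominus> y) < \<epsilon> / 2)"
        using r by (elim allE impE exE conjE) (assumption, rule that)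
      \<comment> \<open>Each centre \<open>y\<close> is moved to a point of the image at distance
        less than \<epsilon>/2, at the cost of doubling the radius.\<close>
      define g where "g y = (SOME s. s \<in> ?S \<and> hnorm H (s \<ominus> y) < \<epsilon> / 2)" for y
      have g: "g y \<in> ?S \<and> hnorm H (g y \<ominus> y) < \<epsilon> / 2" if "s \<in> ?S" "hnorm H (s \<ominus> y) < \<epsilon> / 2" for s y
        unfolding g_def using that by (rule_tac someI[of _ s]) blast
      let ?Y = "g ` {y \<in> Y. \<exists>s\<in>?S. hnorm H (s \<ominus> y) < \<epsilon> / 2}"
      have cover: "?S \<subseteq> (\<Union>y\<in>?Y. hmetric.mball y \<epsilon>)"
      proof
        fix s assume s: "s \<in> ?S"
        obtain x where x: "x \<in> carrier H" "hnorm H x \<le> 1" "s = f x" using s by blast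
        then obtain y where y: "y \<in> Y" "hnorm H (s \<ominus> y) < \<epsilon> / 2"
          using bspec[OF Y(3) x(1)] by blast
        have gy: "g y \<in> ?S" "hnorm H (g y \<ominus> y) < \<epsilon> / 2" using g[OF s y(2)] by auto
        have sH: "s \<in> carrier H" "g y \<in> carrier H" "y \<in> carrier H"
          using subsetD[OF S s] subsetD[OF S gy(1)] subsetD[OF Y(2) y(1)] .
        have "hnorm H (s \<ominus> g y) < \<epsilon>"
          using hnorm_triangle[OF sH(1,3,2)] y(2) gy(2) hnorm_uminus[OF sH(3,2)] by linarith
        then have "s \<in> hmetric.mball (g y) \<epsilon>" using sH(1) by (simp only: in_mball[OF sH(2)])
        moreover have "g y \<in> ?Y" using y s by blast
        ultimately show "s \<in> (\<Union>y\<in>?Y. hmetric.mball y \<epsilon>)" by (rule UN_I[rotated])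
      qed
      have "finite ?Y" "?Y \<subseteq> ?S" using Y(1) g by auto
      with cover show "\<exists>K. finite K \<and> K \<subseteq> ?S \<and> ?S \<subseteq> (\<Union>x\<in>K. hmetric.mball x \<epsilon>)"
        by (intro exI[of _ ?Y] conjI)
    qed
  qed
  moreover have "compact_operator H f \<longleftrightarrow> hmetric.mtotally_bounded ?S"
    using lin S hlinear_self_iff[of f] hmetric.mtotally_bounded_eq_compact_closure_of[OF complete, of ?S]
      compact_operator_def[of H f] by blast
  ultimately show ?thesis using lin by (simp only: hcompact_def simp_thms)
next
  case False
  then show ?thesis by (simp add: compact_operator_def hcompact_def flip: hlinear_self_iff)
qed

section \<open>Stability properties of compact maps\<close>

context hilbert_pair
begin

lemma hcompact_cong:
  assumes "hcompact H K f" "\<And>x. x \<in> carrier H \<Longrightarrow> g x = f x"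
  shows "hcompact H K g"
  using assms hlinear_cong[of f g] unfolding hcompact_def by simp

lemma hcompact_bounded:
  assumes f: "hcompact H K f"
  obtains B where "hbounded H K B f"
proof -
  obtain Y where Y: "finite Y" "Y \<subseteq> carrier K"
    "\<forall>x\<in>carrier H. hnorm H x \<le> 1 \<longrightarrow> (\<exists>y\<in>Y. hnorm K (f x \<ominus>\<^bsub>K\<^esub> y) < 1)"
    using hcompact_net[OF f zero_less_one] by (elim exE conjE) (rule that)
  \<comment> \<open>The sum of the norms dominates the norm of each centre; the added 1 is the
    radius of the net.\<close>
  define B where "B = (\<Sum>y\<in>Y. hnorm K y) + 1"
  have "hbounded H K B f"
  proof (rule hbounded_unit_ball)
    show "0 \<le> B" unfolding B_def using Y(2) by (intro add_nonneg_nonneg sum_nonneg) auto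
    fix x assume x: "x \<in> carrier H" "hnorm H x \<le> 1"
    then obtain y where y: "y \<in> Y" "hnorm K (f x \<ominus>\<^bsub>K\<^esub> y) < 1" using Y(3) by blast
    have "hnorm K y \<le> (\<Sum>y\<in>Y. hnorm K y)" using y(1) Y(1,2) by (intro member_le_sum) auto
    then show "hnorm K (f x) \<le> B"
      using K.hnorm_le_minus[OF hlinear_in[OF hcompact_linear[OF f] x(1)] subsetD[OF Y(2) y(1)]] y(2)
      unfolding B_def by linarith
  qed (rule hcompact_linear[OF f])
  then show thesis by (rule that)
qed

lemma hcompact_zero: "hcompact H K (\<lambda>_. \<zero>\<^bsub>K\<^esub>)"
proof (rule hcompactI)
  have "\<zero>\<^bsub>K\<^esub> \<ominus>\<^bsub>K\<^esub> \<zero>\<^bsub>K\<^esub> = \<zero>\<^bsub>K\<^esub>" by (simp add: K.minus_eq_zero)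
  then show "has_net H K (\<lambda>x. \<zero>\<^bsub>K\<^esub>) \<epsilon>" if "\<epsilon> > 0" for \<epsilon>
    using that by (intro exI[of _ "{\<zero>\<^bsub>K\<^esub>}"]) simp
qed (simp add: hlinear_def)

lemma hcompact_plus:
  assumes f: "hcompact H K f" and g: "hcompact H K g"
  shows "hcompact H K (\<lambda>x. f x \<oplus>\<^bsub>K\<^esub> g x)"
proof (rule hcompactI)
  fix \<epsilon> :: real assume "\<epsilon> > 0"
  then have \<epsilon>: "\<epsilon> / 2 > 0" by simp
  obtain Y where Y: "finite Y" "Y \<subseteq> carrier K"
    "\<forall>x\<in>carrier H. hnorm H x \<le> 1 \<longrightarrow> (\<exists>y\<in>Y. hnorm K (f x \<ominus>\<^bsub>K\<^esub> y) < \<epsilon> / 2)"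
    using hcompact_net[OF f \<epsilon>] by (elim exE conjE) (rule that)
  obtain Z where Z: "finite Z" "Z \<subseteq> carrier K"
    "\<forall>x\<in>carrier H. hnorm H x \<le> 1 \<longrightarrow> (\<exists>y\<in>Z. hnorm K (g x \<ominus>\<^bsub>K\<^esub> y) < \<epsilon> / 2)"
    using hcompact_net[OF g \<epsilon>] by (elim exE conjE) (rule that)
  let ?Y = "(\<lambda>(y, z). y \<oplus>\<^bsub>K\<^esub> z) ` (Y \<times> Z)"
  have "\<exists>y\<in>?Y. hnorm K (f x \<oplus>\<^bsub>K\<^esub> g x \<ominus>\<^bsub>K\<^esub> y) < \<epsilon>" if x: "x \<in> carrier H" "hnorm H x \<le> 1" for x
  proof -
    obtain y z where yz: "y \<in> Y" "hnorm K (f x \<ominus>\<^bsub>K\<^esub> y) < \<epsilon> / 2" "z \<in> Z" "hnorm K (g x \<ominus>\<^bsub>K\<^esub> z) < \<epsilon> / 2"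
      using bspec[OF Y(3) x(1)] bspec[OF Z(3) x(1)] x(2) by blast
    have "hnorm K (f x \<oplus>\<^bsub>K\<^esub> g x \<ominus>\<^bsub>K\<^esub> (y \<oplus>\<^bsub>K\<^esub> z)) < \<epsilon>"
      using K.hnorm_add_diff[OF hlinear_in[OF hcompact_linear[OF f] x(1)]
          hlinear_in[OF hcompact_linear[OF g] x(1)] subsetD[OF Y(2) yz(1)] subsetD[OF Z(2) yz(3)]]
        yz(2,4) by linarith
    then show ?thesis using yz(1,3) by (intro bexI[of _ "y \<oplus>\<^bsub>K\<^esub> z"]) auto
  qed
  moreover have "?Y \<subseteq> carrier K" using Y(2) Z(2) by auto
  moreover have "finite ?Y" using Y(1) Z(1) by simp
  ultimately show "has_net H K (\<lambda>x. f x \<oplus>\<^bsub>K\<^esub> g x) \<epsilon>"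
    by blast
qed (rule hlinear_plus[OF hcompact_linear[OF f] hcompact_linear[OF g]])

text \<open>A net of radius \<epsilon>/2 for an approximant with error \<epsilon>/2 is a net of
  radius \<epsilon> for \<open>f\<close>.\<close>

lemma hcompact_approx:
  assumes f: "hlinear H K f"
    and approx: "\<And>\<epsilon>. \<epsilon> > 0 \<Longrightarrow>
      \<exists>g. hcompact H K g \<and> (\<forall>x\<in>carrier H. hnorm K (f x \<ominus>\<^bsub>K\<^esub> g x) \<le> \<epsilon> * hnorm H x)"
  shows "hcompact H K f"
proof (rule hcompactI[OF f])
  fix \<epsilon> :: real assume "\<epsilon> > 0"
  then have \<epsilon>: "\<epsilon> / 2 > 0" by simp
  from approx[OF this] obtain g
    where g: "hcompact H K g" "\<forall>x\<in>carrier H. hnorm K (f x \<ominus>\<^bsub>K\<^esub> g x) \<le> \<epsilon> / 2 * hnorm H x" by blast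
  obtain Y where Y: "finite Y" "Y \<subseteq> carrier K"
    "\<forall>x\<in>carrier H. hnorm H x \<le> 1 \<longrightarrow> (\<exists>y\<in>Y. hnorm K (g x \<ominus>\<^bsub>K\<^esub> y) < \<epsilon> / 2)"
    using hcompact_net[OF g(1) \<epsilon>] by (elim exE conjE) (rule that)
  have "\<exists>y\<in>Y. hnorm K (f x \<ominus>\<^bsub>K\<^esub> y) < \<epsilon>" if x: "x \<in> carrier H" "hnorm H x \<le> 1" for x
  proof -
    obtain y where y: "y \<in> Y" "hnorm K (g x \<ominus>\<^bsub>K\<^esub> y) < \<epsilon> / 2" using bspec[OF Y(3) x(1)] x(2) by blast
    have "\<epsilon> / 2 * hnorm H x \<le> \<epsilon> / 2 * 1" using x(2) \<epsilon> by (intro mult_left_mono) auto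
    then have "hnorm K (f x \<ominus>\<^bsub>K\<^esub> g x) \<le> \<epsilon> / 2" using g(2) x(1) by fastforce
    then have "hnorm K (f x \<ominus>\<^bsub>K\<^esub> y) < \<epsilon>"
      using K.hnorm_triangle[OF hlinear_in[OF f x(1)] hlinear_in[OF hcompact_linear[OF g(1)] x(1)]
          subsetD[OF Y(2) y(1)]] y(2) by linarith
    then show ?thesis using y by blast
  qed
  then show "has_net H K f \<epsilon>"
    using Y(1,2) by blast
qed

text \<open>\<open>\<phi>\<close> maps the unit ball into the disc of radius \<open>B\<close> in the
  complex plane, which is totally bounded; a net of the disc times \<open>d\<close> is the required
  net.\<close>

lemma hcompact_rank_one:
  assumes \<phi>: "hfunctional H B \<phi>" and d: "d \<in> carrier K"
  shows "hcompact H K (\<lambda>x. \<phi> x \<odot>\<^bsub>K\<^esub> d)"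
proof (rule hcompactI)
  show "hlinear H K (\<lambda>x. \<phi> x \<odot>\<^bsub>K\<^esub> d)"
    unfolding hlinear_def using \<phi> d by (simp add: hfunctional_def K.smult_smult K.smult_add_left)
  fix \<epsilon> :: real assume "\<epsilon> > 0"
  then have n: "0 < \<epsilon> / (hnorm K d + 1)" using d by (simp add: add_nonneg_pos)
  have "\<forall>e>0. \<exists>C. finite C \<and> cball (0::complex) B \<subseteq> (\<Union>x\<in>C. ball x e)"
    using compact_cball[of "0::complex" B] unfolding compact_eq_totally_bounded by (rule conjunct2)
  from this[rule_format, OF n] obtain C
    where C: "finite C" "cball (0::complex) B \<subseteq> (\<Union>x\<in>C. ball x (\<epsilon> / (hnorm K d + 1)))"
    by (elim exE conjE) (rule that)
  let ?Y = "(\<lambda>c. c \<odot>\<^bsub>K\<^esub> d) ` C"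
  have "\<exists>y\<in>?Y. hnorm K (\<phi> x \<odot>\<^bsub>K\<^esub> d \<ominus>\<^bsub>K\<^esub> y) < \<epsilon>" if x: "x \<in> carrier H" "hnorm H x \<le> 1" for x
  proof -
    have "cmod (\<phi> x) \<le> B * hnorm H x" "0 \<le> B" using \<phi> x(1) by (auto simp: hfunctional_def)
    moreover have "B * hnorm H x \<le> B * 1" using x(2) \<open>0 \<le> B\<close> by (rule mult_left_mono)
    ultimately have "\<phi> x \<in> cball 0 B" by simp
    from subsetD[OF C(2) this] obtain c where c: "c \<in> C" "cmod (\<phi> x - c) < \<epsilon> / (hnorm K d + 1)"
      by (auto simp: dist_norm norm_minus_commute)
    have "\<phi> x \<odot>\<^bsub>K\<^esub> d \<ominus>\<^bsub>K\<^esub> c \<odot>\<^bsub>K\<^esub> d = (\<phi> x - c) \<odot>\<^bsub>K\<^esub> d"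
      using d by (intro K.ip_ext) (simp_all add: K.ip_simps algebra_simps)
    then have "hnorm K (\<phi> x \<odot>\<^bsub>K\<^esub> d \<ominus>\<^bsub>K\<^esub> c \<odot>\<^bsub>K\<^esub> d) = cmod (\<phi> x - c) * hnorm K d"
      using d by simp
    also have "\<dots> \<le> cmod (\<phi> x - c) * (hnorm K d + 1)" by (simp add: mult_left_mono)
    also have "\<dots> < \<epsilon>" using c(2) d by (simp add: pos_less_divide_eq add_nonneg_pos)
    finally show ?thesis using c(1) by blast
  qed
  moreover have "?Y \<subseteq> carrier K" using d by auto
  ultimately show "has_net H K (\<lambda>x. \<phi> x \<odot>\<^bsub>K\<^esub> d) \<epsilon>"
    using C(1) by blast
qed

end

lemma hcompact_comp_left:
  assumes "hilbert_space K" "hilbert_space L" and f: "hcompact H K f" and g: "hbounded K L B g"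
  shows "hcompact H L (\<lambda>x. g (f x))"
proof (rule hcompactI)
  interpret hilbert_pair K L using assms(1,2) by (rule hilbert_pair.intro)
  show "hlinear H L (\<lambda>x. g (f x))" using hlinear_comp hcompact_linear[OF f] hbounded_linear[OF g] by blast
  fix \<epsilon> :: real assume "\<epsilon> > 0"
  have B: "0 < B + 1" using hbounded_nonneg[OF g] by simp
  then have n: "0 < \<epsilon> / (B + 1)" using \<open>\<epsilon> > 0\<close> by simp
  obtain Y where Y: "finite Y" "Y \<subseteq> carrier K"
    "\<forall>x\<in>carrier H. hnorm H x \<le> 1 \<longrightarrow> (\<exists>y\<in>Y. hnorm K (f x \<ominus>\<^bsub>K\<^esub> y) < \<epsilon> / (B + 1))"
    using hcompact_net[OF f n] by (elim exE conjE) (rule that)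
  have "\<exists>y\<in>g ` Y. hnorm L (g (f x) \<ominus>\<^bsub>L\<^esub> y) < \<epsilon>" if x: "x \<in> carrier H" "hnorm H x \<le> 1" for x
  proof -
    obtain y where y: "y \<in> Y" "hnorm K (f x \<ominus>\<^bsub>K\<^esub> y) < \<epsilon> / (B + 1)" using bspec[OF Y(3) x(1)] x(2) by blast
    have yK: "f x \<in> carrier K" "y \<in> carrier K" using hlinear_in[OF hcompact_linear[OF f] x(1)] y(1) Y(2) by auto
    then have "hnorm L (g (f x) \<ominus>\<^bsub>L\<^esub> g y) = hnorm L (g (f x \<ominus>\<^bsub>K\<^esub> y))"
      using hlinear_minus[OF hbounded_linear[OF g]] by simp
    also have "\<dots> \<le> B * hnorm K (f x \<ominus>\<^bsub>K\<^esub> y)" using hbounded_le[OF g] yK by simp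
    also have "\<dots> \<le> (B + 1) * hnorm K (f x \<ominus>\<^bsub>K\<^esub> y)" using yK by (simp add: mult_right_mono)
    also have "\<dots> < \<epsilon>" using y(2) B by (simp add: pos_less_divide_eq mult.commute)
    finally show ?thesis using y(1) by blast
  qed
  moreover have "g ` Y \<subseteq> carrier L" using Y(2) hbounded_in[OF g] by blast
  ultimately show "has_net H L (\<lambda>x. g (f x)) \<epsilon>"
    using Y(1) by blast
qed

lemma hcompact_comp_right:
  assumes "hilbert_space H" "hilbert_space K" "hilbert_space L"
    and f: "hbounded H K B f" and g: "hcompact K L g"
  shows "hcompact H L (\<lambda>x. g (f x))"
proof (rule hcompactI)
  interpret HK: hilbert_pair H K using assms(1,2) by (rule hilbert_pair.intro)
  interpret KL: hilbert_pair K L using assms(2,3) by (rule hilbert_pair.intro)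
  show "hlinear H L (\<lambda>x. g (f x))" using hlinear_comp hcompact_linear[OF g] hbounded_linear[OF f] by blast
  fix \<epsilon> :: real assume "\<epsilon> > 0"
  \<comment> \<open>A positive radius for the image of the unit ball under \<open>f\<close>. Vectors
    are scaled by \<open>1/C\<close> into the unit ball of \<open>K\<close>, and the net of
    \<open>g\<close> is scaled back by \<open>C\<close>.\<close>
  define C where "C = B + 1"
  have C: "0 < C" "B \<le> C" using hbounded_nonneg[OF f] by (auto simp: C_def)
  then have n: "0 < \<epsilon> / C" using \<open>\<epsilon> > 0\<close> by simp
  obtain Y where Y: "finite Y" "Y \<subseteq> carrier L"
    "\<forall>x\<in>carrier K. hnorm K x \<le> 1 \<longrightarrow> (\<exists>y\<in>Y. hnorm L (g x \<ominus>\<^bsub>L\<^esub> y) < \<epsilon> / C)"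
    using hcompact_net[OF g n] by (elim exE conjE) (rule that)
  let ?c = "complex_of_real C"
  let ?Y = "(\<lambda>y. ?c \<odot>\<^bsub>L\<^esub> y) ` Y"
  have "\<exists>y\<in>?Y. hnorm L (g (f x) \<ominus>\<^bsub>L\<^esub> y) < \<epsilon>" if x: "x \<in> carrier H" "hnorm H x \<le> 1" for x
  proof -
    have fx: "f x \<in> carrier K" using hbounded_in[OF f x(1)] .
    let ?z = "complex_of_real (inverse C) \<odot>\<^bsub>K\<^esub> f x"
    have z: "?z \<in> carrier K" using fx by simp
    have "hnorm K (f x) \<le> B * 1"
      using hbounded_le[OF f x(1)] mult_left_mono[OF x(2) hbounded_nonneg[OF f]] by simp
    then have "inverse C * hnorm K (f x) \<le> inverse C * C" using C by (intro mult_left_mono) auto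
    moreover have "hnorm K ?z = inverse C * hnorm K (f x)"
      using C(1) fx by (simp only: HK.K.hnorm_smult norm_of_real) simp
    ultimately have "hnorm K ?z \<le> 1" using C(1) by simp
    with z obtain y where y: "y \<in> Y" "hnorm L (g ?z \<ominus>\<^bsub>L\<^esub> y) < \<epsilon> / C" using bspec[OF Y(3) z] by blast
    have yL: "y \<in> carrier L" "g ?z \<in> carrier L" using y(1) Y(2) hlinear_in[OF hcompact_linear[OF g] z] by auto
    have "?c * complex_of_real (inverse C) = 1" using C(1) by (simp flip: of_real_mult)
    then have "f x = ?c \<odot>\<^bsub>K\<^esub> ?z" using fx by (simp only: HK.K.smult_smult HK.K.smult_1)
    then have "g (f x) = ?c \<odot>\<^bsub>L\<^esub> g ?z" using hlinear_smult[OF hcompact_linear[OF g] z, of ?c] by simp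
    then have "hnorm L (g (f x) \<ominus>\<^bsub>L\<^esub> ?c \<odot>\<^bsub>L\<^esub> y) = C * hnorm L (g ?z \<ominus>\<^bsub>L\<^esub> y)"
      using yL C by (simp add: KL.K.smult_minus)
    also have "\<dots> < \<epsilon>" using y(2) C by (simp add: pos_less_divide_eq mult.commute)
    finally show ?thesis using y(1) by blast
  qed
  moreover have "?Y \<subseteq> carrier L" using Y(2) by auto
  ultimately show "has_net H L (\<lambda>x. g (f x)) \<epsilon>"
    using Y(1) by blast
qed

text \<open>The vectors \<open>d\<close> come from \<open>D\<close> itself and not from its span.
  Later \<open>D\<close> consists of products of two vectors, and an induction over this predicate
  then meets only rank one maps onto such products.\<close>

inductive finite_rank ::
  "('x, 'b) hspace_scheme \<Rightarrow> ('y, 'c) hspace_scheme \<Rightarrow> 'y set \<Rightarrow> ('x \<Rightarrow> 'y) \<Rightarrow> bool"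
  for H K D where
  zero: "finite_rank H K D (\<lambda>_. \<zero>\<^bsub>K\<^esub>)"
| rank_one: "hfunctional H B \<phi> \<Longrightarrow> d \<in> D \<Longrightarrow> finite_rank H K D (\<lambda>x. \<phi> x \<odot>\<^bsub>K\<^esub> d)"
| plus: "finite_rank H K D f \<Longrightarrow> finite_rank H K D g \<Longrightarrow> finite_rank H K D (\<lambda>x. f x \<oplus>\<^bsub>K\<^esub> g x)"

context hilbert_pair
begin

lemma hfunctional_scale:
  assumes "hfunctional H B \<phi>"
  shows "hfunctional H (cmod c * B) (\<lambda>x. \<phi> x * c)"
proof -
  have "cmod (\<phi> x * c) \<le> cmod c * B * hnorm H x" if "x \<in> carrier H" for x
  proof -
    have "cmod (\<phi> x) * cmod c \<le> (B * hnorm H x) * cmod c"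
      using assms that by (intro mult_right_mono) (auto simp: hfunctional_def)
    then show ?thesis by (simp add: norm_mult ac_simps)
  qed
  then show ?thesis using assms by (simp add: hfunctional_def algebra_simps)
qed

text \<open>A sum of vectors gives a sum of rank one maps, and a scalar in front of the vector is
  moved into the functional. The functional changes in that step, so the induction runs over all
  functionals at once.\<close>

lemma finite_rank_span:
  assumes D: "D \<subseteq> carrier K" and d: "d \<in> hspan K D" and \<phi>: "hfunctional H B \<phi>"
  shows "finite_rank H K D (\<lambda>x. \<phi> x \<odot>\<^bsub>K\<^esub> d)"
proof -
  have "\<forall>\<phi> B. hfunctional H B \<phi> \<longrightarrow> finite_rank H K D (\<lambda>x. \<phi> x \<odot>\<^bsub>K\<^esub> d)"
    using d D
  proof (rule K.hspan_induct)
    show "\<forall>\<phi> B. hfunctional H B \<phi> \<longrightarrow> finite_rank H K D (\<lambda>x. \<phi> x \<odot>\<^bsub>K\<^esub> \<zero>\<^bsub>K\<^esub>)"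
      by (simp add: finite_rank.zero)
    show "\<forall>\<phi> B. hfunctional H B \<phi> \<longrightarrow> finite_rank H K D (\<lambda>x'. \<phi> x' \<odot>\<^bsub>K\<^esub> (x \<oplus>\<^bsub>K\<^esub> y))"
      if "x \<in> carrier K" "y \<in> carrier K"
        "\<forall>\<phi> B. hfunctional H B \<phi> \<longrightarrow> finite_rank H K D (\<lambda>x'. \<phi> x' \<odot>\<^bsub>K\<^esub> x)"
        "\<forall>\<phi> B. hfunctional H B \<phi> \<longrightarrow> finite_rank H K D (\<lambda>x. \<phi> x \<odot>\<^bsub>K\<^esub> y)" for x y
      using that by (simp add: K.smult_r_distr finite_rank.plus)
    show "\<forall>\<phi> B. hfunctional H B \<phi> \<longrightarrow> finite_rank H K D (\<lambda>x'. \<phi> x' \<odot>\<^bsub>K\<^esub> (c \<odot>\<^bsub>K\<^esub> x))"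
      if "x \<in> carrier K" "\<forall>\<phi> B. hfunctional H B \<phi> \<longrightarrow> finite_rank H K D (\<lambda>x'. \<phi> x' \<odot>\<^bsub>K\<^esub> x)" for c x
    proof (intro allI impI)
      fix \<phi> B assume "hfunctional H B \<phi>"
      from hfunctional_scale[OF this, of c] have "finite_rank H K D (\<lambda>x'. (\<phi> x' * c) \<odot>\<^bsub>K\<^esub> x)"
        using that(2) by blast
      then show "finite_rank H K D (\<lambda>x'. \<phi> x' \<odot>\<^bsub>K\<^esub> (c \<odot>\<^bsub>K\<^esub> x))" using that(1) by (simp add: K.smult_smult)
    qed
  qed (auto intro: finite_rank.rank_one)
  then show ?thesis using \<phi> by blast
qed

lemma hfunctional_ip:
  assumes f: "hbounded H K B f" and e: "e \<in> carrier K"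
  shows "hfunctional H (B * hnorm K e) (\<lambda>x. ip K (f x) e)"
proof -
  have "cmod (ip K (f x) e) \<le> B * hnorm K e * hnorm H x" if x: "x \<in> carrier H" for x
  proof -
    have "cmod (ip K (f x) e) \<le> hnorm K (f x) * hnorm K e"
      using K.cauchy_schwarz hbounded_in[OF f x] e by blast
    also have "\<dots> \<le> (B * hnorm H x) * hnorm K e"
      using hbounded_le[OF f x] e by (intro mult_right_mono) auto
    finally show ?thesis by (simp add: ac_simps)
  qed
  then show ?thesis
    using e hbounded_nonneg[OF f] hbounded_in[OF f]
    by (simp add: hfunctional_def hbounded_add[OF f] hbounded_smult[OF f] K.ip_simps)
qed

text \<open>
  The approximants are \<open>P \<circ> f\<close> for the projection \<open>P\<close> onto the span of an orthonormal family
  which almost contains the image of the unit ball.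
\<close>

lemma hcompact_finite_rank_approx:
  assumes f: "hcompact H K f" and D: "total_in K D" and \<epsilon>: "\<epsilon> > 0"
  obtains g where "finite_rank H K D g" "hbounded H K \<epsilon> (\<lambda>x. f x \<ominus>\<^bsub>K\<^esub> g x)"
proof -
  obtain B where B: "hbounded H K B f" using hcompact_bounded[OF f] .
  have DK: "D \<subseteq> carrier K" using D by (simp add: total_in_def)
  have \<epsilon>2: "\<epsilon> / 2 > 0" using \<epsilon> by simp
  obtain Y where Y: "finite Y" "Y \<subseteq> carrier K"
    "\<forall>x\<in>carrier H. hnorm H x \<le> 1 \<longrightarrow> (\<exists>y\<in>Y. hnorm K (f x \<ominus>\<^bsub>K\<^esub> y) < \<epsilon> / 2)"
    using hcompact_net[OF f \<epsilon>2] by (elim exE conjE) (rule that)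
  \<comment> \<open>The centres of the net are moved into the span of \<open>D\<close>, so that the
    orthonormal family built from them lies there too.\<close>
  have "\<forall>y\<in>Y. \<exists>q. q \<in> hspan K D \<and> q \<in> carrier K \<and> hnorm K (q \<ominus>\<^bsub>K\<^esub> y) < \<epsilon> / 2"
    using K.total_in_approx[OF D _ \<epsilon>2] Y(2) by (metis subsetD)
  then obtain q where q: "\<And>y. y \<in> Y \<Longrightarrow> q y \<in> hspan K D \<and> q y \<in> carrier K \<and> hnorm K (q y \<ominus>\<^bsub>K\<^esub> y) < \<epsilon> / 2"
    by metis
  obtain ys where ys: "set ys = q ` Y" using Y(1) finite_list by (metis finite_imageI)
  obtain es where es: "orthonormal K es" "set es \<subseteq> hspan K D" "set ys \<subseteq> lspan K es"
    using K.gram_schmidt[OF K.submodule_hspan[OF DK], of ys] q ys by auto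
  have esK: "set es \<subseteq> carrier K" using K.orthonormal_subset[OF es(1)] .
  let ?g = "\<lambda>x. hproj K es (f x)"
  have fr: "finite_rank H K D (\<lambda>x. hproj K es (f x))"
    using es(2) esK
  proof (induction es)
    case (Cons e es)
    then show ?case
      using finite_rank_span[OF DK _ hfunctional_ip[OF B]] by (auto intro!: finite_rank.plus)
  qed (simp add: finite_rank.zero)
  have "hbounded H K \<epsilon> (\<lambda>x. f x \<ominus>\<^bsub>K\<^esub> ?g x)"
  proof (rule hbounded_unit_ball)
    have "hlinear H K ?g"
      using esK
    proof (induction es)
      case (Cons e es)
      then show ?case
        using hcompact_linear[OF hcompact_rank_one[OF hfunctional_ip[OF B]]] by (auto intro!: hlinear_plus)
    qed (simp add: hlinear_def)
    then show "hlinear H K (\<lambda>x. f x \<ominus>\<^bsub>K\<^esub> ?g x)"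
      using hlinear_diff hcompact_linear[OF f] by blast
    fix x assume x: "x \<in> carrier H" "hnorm H x \<le> 1"
    obtain y where y: "y \<in> Y" "hnorm K (f x \<ominus>\<^bsub>K\<^esub> y) < \<epsilon> / 2" using bspec[OF Y(3) x(1)] x(2) by blast
    have fx: "f x \<in> carrier K" using hbounded_in[OF B x(1)] .
    have "q y \<in> lspan K es" using es(3) ys y by blast
    \<comment> \<open>The projection approximates \<open>f x\<close> at least as well as
      \<open>q y\<close> does, and \<open>q y\<close> is within \<epsilon>/2 + \<epsilon>/2 of
      it.\<close>
    then have "hnorm K (f x \<ominus>\<^bsub>K\<^esub> ?g x) \<le> hnorm K (f x \<ominus>\<^bsub>K\<^esub> q y)" using K.hproj_best[OF es(1) fx] by blast
    also have "\<dots> \<le> hnorm K (f x \<ominus>\<^bsub>K\<^esub> y) + hnorm K (y \<ominus>\<^bsub>K\<^esub> q y)"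
      using K.hnorm_triangle[OF fx subsetD[OF Y(2) y(1)]] q[OF y(1)] by blast
    also have "\<dots> \<le> \<epsilon>"
      using y(2) q[OF y(1)] K.hnorm_uminus[OF subsetD[OF Y(2) y(1)], of "q y"] by linarith
    finally show "hnorm K (f x \<ominus>\<^bsub>K\<^esub> ?g x) \<le> \<epsilon>" .
  qed (use \<epsilon> in simp)
  then show thesis using that fr by blast
qed

end

section \<open>Operators on product systems\<close>

lemma hilbert_tensor_add:
  assumes "hilbert_tensor Hs K \<tau>" "xs \<in> tensor_args Hs" "i < length Hs"
    and "a \<in> carrier (Hs ! i)" "b \<in> carrier (Hs ! i)"
  shows "\<tau> (xs[i := a \<oplus>\<^bsub>Hs ! i\<^esub> b]) = \<tau> (xs[i := a]) \<oplus>\<^bsub>K\<^esub> \<tau> (xs[i := b])"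
  using assms unfolding hilbert_tensor_def by blast

lemma hilbert_tensor_smult:
  assumes "hilbert_tensor Hs K \<tau>" "xs \<in> tensor_args Hs" "i < length Hs" "a \<in> carrier (Hs ! i)"
  shows "\<tau> (xs[i := c \<odot>\<^bsub>Hs ! i\<^esub> a]) = c \<odot>\<^bsub>K\<^esub> \<tau> (xs[i := a])"
  using assms unfolding hilbert_tensor_def by blast

lemma hilbert_tensor_ip:
  assumes "hilbert_tensor Hs K \<tau>" "xs \<in> tensor_args Hs" "ys \<in> tensor_args Hs"
  shows "ip K (\<tau> xs) (\<tau> ys) = (\<Prod>i<length Hs. ip (Hs ! i) (xs ! i) (ys ! i))"
  using assms unfolding hilbert_tensor_def by blast

lemma hilbert_tensor_total: "hilbert_tensor Hs K \<tau> \<Longrightarrow> total_in K (\<tau> ` tensor_args Hs)"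
  unfolding hilbert_tensor_def by blast

lemma hilbert_tensor_in: "hilbert_tensor Hs K \<tau> \<Longrightarrow> xs \<in> tensor_args Hs \<Longrightarrow> \<tau> xs \<in> carrier K"
  unfolding hilbert_tensor_def by blast

lemma tensor_args_pair: "tensor_args [H, K] = {[x, y] | x y. x \<in> carrier H \<and> y \<in> carrier K}"
  by (auto simp: tensor_args_def list_all2_Cons2)

text \<open>Relates the sum of the \<open>x_i e_i\<close> to the sum of the
  \<open>f(x_i) e_i\<close>, for the vectors \<open>e_i\<close> of the list: the graph of
  \<open>f \<otimes> 1\<close> on tensors with these second factors. It is a relation because, for a
  general list, the \<open>x_i\<close> are not determined by the sum. \<open>u\<close> and
  \<open>v\<close> are the indices of the fibres that contain the two sums.\<close>

primrec ampl_graph ::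
  "('g, 'x) prodsys \<Rightarrow> 'g \<Rightarrow> 'g \<Rightarrow> 'g \<Rightarrow> ('x \<Rightarrow> 'x) \<Rightarrow> 'x list \<Rightarrow> 'x \<Rightarrow> 'x \<Rightarrow> bool" where
  "ampl_graph E s u v f [] a b \<longleftrightarrow> a = \<zero>\<^bsub>pfib E u\<^esub> \<and> b = \<zero>\<^bsub>pfib E v\<^esub>"
| "ampl_graph E s u v f (e # es) a b \<longleftrightarrow>
     (\<exists>x\<in>carrier (pfib E s). \<exists>a' b'. ampl_graph E s u v f es a' b' \<and>
        a = x \<cdot>\<^bsub>E\<^esub> e \<oplus>\<^bsub>pfib E u\<^esub> a' \<and> b = f x \<cdot>\<^bsub>E\<^esub> e \<oplus>\<^bsub>pfib E v\<^esub> b')"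

section \<open>Multiplication of fibres and its amplified maps\<close>

context product_system
begin

abbreviation mult_M (infixl \<open>\<star>\<close> 70) where "s \<star> t \<equiv> s \<otimes>\<^bsub>M\<^esub> t"

lemma hilbert_pair: "s \<in> carrier M \<Longrightarrow> t \<in> carrier M \<Longrightarrow> hilbert_pair (pfib E s) (pfib E t)"
  by (simp add: hilbert hilbert_pair.intro)

lemma mult_in:
  assumes "s \<in> carrier M" "t \<in> carrier M" "x \<in> carrier (pfib E s)" "y \<in> carrier (pfib E t)"
  shows "x \<cdot> y \<in> carrier (pfib E (s \<star> t))"
  using assms by (simp add: fibre mult_closed proj_mult)

lemma mult_assoc_fib:
  assumes "r \<in> carrier M" "s \<in> carrier M" "t \<in> carrier M"
    and "x \<in> carrier (pfib E r)" "y \<in> carrier (pfib E s)" "z \<in> carrier (pfib E t)"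
  shows "(x \<cdot> y) \<cdot> z = x \<cdot> (y \<cdot> z)"
  using assms by (simp add: fibre mult_assoc)

context
  fixes s t assumes s: "s \<in> carrier M" and t: "t \<in> carrier M"
begin

lemma mult_add_left:
  assumes "x \<in> carrier (pfib E s)" "x' \<in> carrier (pfib E s)" "y \<in> carrier (pfib E t)"
  shows "(x \<oplus>\<^bsub>pfib E s\<^esub> x') \<cdot> y = x \<cdot> y \<oplus>\<^bsub>pfib E (s \<star> t)\<^esub> x' \<cdot> y"
proof -
  have "[x, y] \<in> tensor_args [pfib E s, pfib E t]" using assms by (simp add: tensor_args_pair)
  from hilbert_tensor_add[OF unitary[OF s t] this, of 0 x x'] assms show ?thesis by simp
qed

lemma mult_add_right:
  assumes "x \<in> carrier (pfib E s)" "y \<in> carrier (pfib E t)" "y' \<in> carrier (pfib E t)"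
  shows "x \<cdot> (y \<oplus>\<^bsub>pfib E t\<^esub> y') = x \<cdot> y \<oplus>\<^bsub>pfib E (s \<star> t)\<^esub> x \<cdot> y'"
proof -
  have "[x, y] \<in> tensor_args [pfib E s, pfib E t]" using assms by (simp add: tensor_args_pair)
  from hilbert_tensor_add[OF unitary[OF s t] this, of 1 y y'] assms show ?thesis by simp
qed

lemma mult_smult_left:
  assumes "x \<in> carrier (pfib E s)" "y \<in> carrier (pfib E t)"
  shows "(c \<odot>\<^bsub>pfib E s\<^esub> x) \<cdot> y = c \<odot>\<^bsub>pfib E (s \<star> t)\<^esub> (x \<cdot> y)"
proof -
  have "[x, y] \<in> tensor_args [pfib E s, pfib E t]" using assms by (simp add: tensor_args_pair)
  from hilbert_tensor_smult[OF unitary[OF s t] this, of 0 x c] assms show ?thesis by simp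
qed

lemma mult_smult_right:
  assumes "x \<in> carrier (pfib E s)" "y \<in> carrier (pfib E t)"
  shows "x \<cdot> (c \<odot>\<^bsub>pfib E t\<^esub> y) = c \<odot>\<^bsub>pfib E (s \<star> t)\<^esub> (x \<cdot> y)"
proof -
  have "[x, y] \<in> tensor_args [pfib E s, pfib E t]" using assms by (simp add: tensor_args_pair)
  from hilbert_tensor_smult[OF unitary[OF s t] this, of 1 y c] assms show ?thesis by simp
qed

lemma ip_mult:
  assumes "x \<in> carrier (pfib E s)" "y \<in> carrier (pfib E t)" "x' \<in> carrier (pfib E s)" "y' \<in> carrier (pfib E t)"
  shows "ip (pfib E (s \<star> t)) (x \<cdot> y) (x' \<cdot> y') = ip (pfib E s) x x' * ip (pfib E t) y y'"
proof -
  have "[x, y] \<in> tensor_args [pfib E s, pfib E t]" "[x', y'] \<in> tensor_args [pfib E s, pfib E t]"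
    using assms by (simp_all add: tensor_args_pair)
  from hilbert_tensor_ip[OF unitary[OF s t] this] show ?thesis by (simp add: numeral_2_eq_2)
qed

lemma hnorm_mult:
  assumes "x \<in> carrier (pfib E s)" "y \<in> carrier (pfib E t)"
  shows "hnorm (pfib E (s \<star> t)) (x \<cdot> y) = hnorm (pfib E s) x * hnorm (pfib E t) y"
  using assms hilbert_space.ip_self[OF hilbert[OF s]] hilbert_space.ip_self[OF hilbert[OF t]]
    hilbert_space.hnorm_nonneg[OF hilbert[OF s]] hilbert_space.hnorm_nonneg[OF hilbert[OF t]]
  by (simp add: hnorm_def[of "pfib E (s \<star> t)"] ip_mult real_sqrt_mult flip: of_real_mult of_real_power)

lemma total_mult:
  "total_in (pfib E (s \<star> t)) {x \<cdot> y | x y. x \<in> carrier (pfib E s) \<and> y \<in> carrier (pfib E t)}"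
proof -
  have "{x \<cdot> y | x y. x \<in> carrier (pfib E s) \<and> y \<in> carrier (pfib E t)} =
      (\<lambda>xs. xs ! 0 \<cdot> xs ! 1) ` tensor_args [pfib E s, pfib E t]"
    by (force simp: tensor_args_pair image_iff)
  then show ?thesis using hilbert_tensor_total[OF unitary[OF s t]] by simp
qed

lemma hbounded_left_mult:
  assumes "x \<in> carrier (pfib E s)"
  shows "hbounded (pfib E t) (pfib E (s \<star> t)) (hnorm (pfib E s) x) (\<lambda>y. x \<cdot> y)"
  using assms s t hilbert_space.hnorm_nonneg[OF hilbert[OF s] assms]
  unfolding hbounded_def hlinear_def
  by (auto simp: mult_in mult_add_right mult_smult_right hnorm_mult)

lemma mult_zero_left:
  assumes "y \<in> carrier (pfib E t)"
  shows "\<zero>\<^bsub>pfib E s\<^esub> \<cdot> y = \<zero>\<^bsub>pfib E (s \<star> t)\<^esub>"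
proof -
  interpret S: hilbert_space "pfib E s" using hilbert s .
  interpret ST: hilbert_space "pfib E (s \<star> t)" using hilbert s t by simp
  have "\<zero>\<^bsub>pfib E s\<^esub> \<cdot> y = (0 \<odot>\<^bsub>pfib E s\<^esub> \<zero>\<^bsub>pfib E s\<^esub>) \<cdot> y" by simp
  also have "\<dots> = 0 \<odot>\<^bsub>pfib E (s \<star> t)\<^esub> (\<zero>\<^bsub>pfib E s\<^esub> \<cdot> y)"
    by (rule mult_smult_left[OF S.zero_closed assms])
  also have "\<dots> = \<zero>\<^bsub>pfib E (s \<star> t)\<^esub>"
    using mult_in[OF s t S.zero_closed assms] by simp
  finally show ?thesis .
qed

end

text \<open>The products \<open>x \<cdot> y\<close> are total. Identities between amplified
  operators are checked on products in this way.\<close>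

lemma amplification_unique:
  assumes s: "s \<in> carrier M" and t: "t \<in> carrier M" and K: "hilbert_space K"
    and A: "hbounded (pfib E (s \<star> t)) K B A" and A': "hbounded (pfib E (s \<star> t)) K B' A'"
    and eq: "\<And>x y. x \<in> carrier (pfib E s) \<Longrightarrow> y \<in> carrier (pfib E t) \<Longrightarrow> A (x \<cdot> y) = A' (x \<cdot> y)"
    and v: "v \<in> carrier (pfib E (s \<star> t))"
  shows "A v = A' v"
proof -
  interpret hilbert_pair "pfib E (s \<star> t)" K
    using hilbert s t K by (simp add: hilbert_pair.intro)
  show ?thesis using eq by (intro hbounded_eq_on_total[OF A A' total_mult[OF s t] _ v]) auto
qed

text \<open>
  Elements of the algebraic tensor product are written with an orthonormal family in the second
  variable; then the bound for \<open>f \<otimes> 1\<close> is the Pythagorean theorem.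
\<close>

lemma amplification_exists:
  assumes s: "s \<in> carrier M" and s': "s' \<in> carrier M" and t: "t \<in> carrier M"
    and f: "hbounded (pfib E s) (pfib E s') B f"
  obtains A where "hbounded (pfib E (s \<star> t)) (pfib E (s' \<star> t)) B A"
    "\<And>x y. x \<in> carrier (pfib E s) \<Longrightarrow> y \<in> carrier (pfib E t) \<Longrightarrow> A (x \<cdot> y) = f x \<cdot> y"
proof -
  let ?u = "s \<star> t" and ?v = "s' \<star> t"
  let ?S = "pfib E s" and ?S' = "pfib E s'" and ?T = "pfib E t" and ?U = "pfib E ?u" and ?V = "pfib E ?v"
  interpret S: hilbert_pair "?S" "?S'" using hilbert_pair s s' .
  interpret T: hilbert_space "?T" using hilbert t .
  interpret UV: hilbert_pair "?U" "?V" using hilbert_pair s s' t by simp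
  note in_u = mult_in[OF s t] and in_v = mult_in[OF s' t] and f_in = hbounded_in[OF f]
  let ?G = "ampl_graph E s ?u ?v f"
  have G_in: "a \<in> carrier ?U \<and> b \<in> carrier ?V"
    if "?G es a b" "set es \<subseteq> carrier ?T" for es a b
    using that by (induction es arbitrary: a b) (auto simp: in_u in_v f_in)
  have G_zero: "?G es \<zero>\<^bsub>?U\<^esub> \<zero>\<^bsub>?V\<^esub>" if "set es \<subseteq> carrier ?T" for es
    using that
  proof (induction es)
    case (Cons e es)
    have "\<zero>\<^bsub>?U\<^esub> = \<zero>\<^bsub>?S\<^esub> \<cdot> e \<oplus>\<^bsub>?U\<^esub> \<zero>\<^bsub>?U\<^esub>"
      using Cons.prems mult_zero_left[OF s t, of e] by simp
    moreover have "\<zero>\<^bsub>?V\<^esub> = f \<zero>\<^bsub>?S\<^esub> \<cdot> e \<oplus>\<^bsub>?V\<^esub> \<zero>\<^bsub>?V\<^esub>"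
      using Cons.prems mult_zero_left[OF s' t, of e] S.hlinear_zero[OF hbounded_linear[OF f]] by simp
    ultimately show ?case using Cons by (auto intro!: bexI[of _ "\<zero>\<^bsub>?S\<^esub>"])
  qed simp
  have G_add: "?G es (a \<oplus>\<^bsub>?U\<^esub> c) (b \<oplus>\<^bsub>?V\<^esub> d)"
    if "?G es a b" "?G es c d" "set es \<subseteq> carrier ?T" for es a b c d
    using that
  proof (induction es arbitrary: a b c d)
    case (Cons e es)
    have e: "e \<in> carrier ?T" and es: "set es \<subseteq> carrier ?T" using Cons.prems by auto
    obtain x a' b' where x: "x \<in> carrier ?S" "?G es a' b'"
      "a = x \<cdot> e \<oplus>\<^bsub>?U\<^esub> a'" "b = f x \<cdot> e \<oplus>\<^bsub>?V\<^esub> b'" using Cons.prems(1) by auto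
    obtain y c' d' where y: "y \<in> carrier ?S" "?G es c' d'"
      "c = y \<cdot> e \<oplus>\<^bsub>?U\<^esub> c'" "d = f y \<cdot> e \<oplus>\<^bsub>?V\<^esub> d'" using Cons.prems(2) by auto
    note carr = G_in[OF x(2) es] G_in[OF y(2) es]
    have "a \<oplus>\<^bsub>?U\<^esub> c = (x \<oplus>\<^bsub>?S\<^esub> y) \<cdot> e \<oplus>\<^bsub>?U\<^esub> (a' \<oplus>\<^bsub>?U\<^esub> c')"
      unfolding x(3) y(3) mult_add_left[OF s t x(1) y(1) e]
      using carr in_u[OF x(1) e] in_u[OF y(1) e] by (intro UV.H.ip_ext) (simp_all add: UV.H.ip_simps)
    moreover have "b \<oplus>\<^bsub>?V\<^esub> d = f (x \<oplus>\<^bsub>?S\<^esub> y) \<cdot> e \<oplus>\<^bsub>?V\<^esub> (b' \<oplus>\<^bsub>?V\<^esub> d')"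
      unfolding x(4) y(4) hbounded_add[OF f x(1) y(1)] mult_add_left[OF s' t f_in[OF x(1)] f_in[OF y(1)] e]
      using carr in_v[OF f_in[OF x(1)] e] in_v[OF f_in[OF y(1)] e]
      by (intro UV.K.ip_ext) (simp_all add: UV.K.ip_simps)
    moreover have "?G es (a' \<oplus>\<^bsub>?U\<^esub> c') (b' \<oplus>\<^bsub>?V\<^esub> d')" using Cons.IH x(2) y(2) es by blast
    moreover have "x \<oplus>\<^bsub>?S\<^esub> y \<in> carrier ?S" using x(1) y(1) by simp
    ultimately show ?case unfolding ampl_graph.simps by blast
  qed simp
  have G_smult: "?G es (k \<odot>\<^bsub>?U\<^esub> a) (k \<odot>\<^bsub>?V\<^esub> b)"
    if "?G es a b" "set es \<subseteq> carrier ?T" for es a b k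
    using that
  proof (induction es arbitrary: a b)
    case (Cons e es)
    have e: "e \<in> carrier ?T" and es: "set es \<subseteq> carrier ?T" using Cons.prems by auto
    obtain x a' b' where x: "x \<in> carrier ?S" "?G es a' b'"
      "a = x \<cdot> e \<oplus>\<^bsub>?U\<^esub> a'" "b = f x \<cdot> e \<oplus>\<^bsub>?V\<^esub> b'" using Cons.prems(1) by auto
    note carr = G_in[OF x(2) es]
    have "k \<odot>\<^bsub>?U\<^esub> a = (k \<odot>\<^bsub>?S\<^esub> x) \<cdot> e \<oplus>\<^bsub>?U\<^esub> k \<odot>\<^bsub>?U\<^esub> a'"
      unfolding x(3) mult_smult_left[OF s t x(1) e]
      using carr in_u[OF x(1) e] by (intro UV.H.ip_ext) (simp_all add: UV.H.ip_simps algebra_simps)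
    moreover have "k \<odot>\<^bsub>?V\<^esub> b = f (k \<odot>\<^bsub>?S\<^esub> x) \<cdot> e \<oplus>\<^bsub>?V\<^esub> k \<odot>\<^bsub>?V\<^esub> b'"
      unfolding x(4) hbounded_smult[OF f x(1)] mult_smult_left[OF s' t f_in[OF x(1)] e]
      using carr in_v[OF f_in[OF x(1)] e] by (intro UV.K.ip_ext) (simp_all add: UV.K.ip_simps algebra_simps)
    moreover have "?G es (k \<odot>\<^bsub>?U\<^esub> a') (k \<odot>\<^bsub>?V\<^esub> b')" using Cons.IH x(2) es by blast
    moreover have "k \<odot>\<^bsub>?S\<^esub> x \<in> carrier ?S" using x(1) by simp
    ultimately show ?case unfolding ampl_graph.simps by blast
  qed simp
  have G_mult: "?G es (x \<cdot> y) (f x \<cdot> y)"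
    if "set es \<subseteq> carrier ?T" "y \<in> lspan ?T es" "x \<in> carrier ?S" for es x y
    using that
  proof (induction es arbitrary: y)
    case Nil
    have "x \<cdot> \<zero>\<^bsub>?T\<^esub> = \<zero>\<^bsub>?U\<^esub>" "f x \<cdot> \<zero>\<^bsub>?T\<^esub> = \<zero>\<^bsub>?V\<^esub>"
      using mult_smult_right[OF s t Nil(3), of "\<zero>\<^bsub>?T\<^esub>" 0] in_u[OF Nil(3), of "\<zero>\<^bsub>?T\<^esub>"]
        mult_smult_right[OF s' t f_in[OF Nil(3)], of "\<zero>\<^bsub>?T\<^esub>" 0] in_v[OF f_in[OF Nil(3)], of "\<zero>\<^bsub>?T\<^esub>"]
      by simp_all
    then show ?case using Nil by simp
  next
    case (Cons e es)
    have e: "e \<in> carrier ?T" and es: "set es \<subseteq> carrier ?T" using Cons.prems by auto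
    obtain k y' where y: "y = k \<odot>\<^bsub>?T\<^esub> e \<oplus>\<^bsub>?T\<^esub> y'" "y' \<in> lspan ?T es"
      using Cons.prems(2) by auto
    have y': "y' \<in> carrier ?T" using T.lspan_in[OF es y(2)] .
    have x: "x \<in> carrier ?S" using Cons.prems by simp
    have ke: "k \<odot>\<^bsub>?T\<^esub> e \<in> carrier ?T" using e by simp
    have "x \<cdot> y = (k \<odot>\<^bsub>?S\<^esub> x) \<cdot> e \<oplus>\<^bsub>?U\<^esub> x \<cdot> y'"
      unfolding y(1) mult_add_right[OF s t x ke y'] mult_smult_right[OF s t x e] mult_smult_left[OF s t x e] ..
    moreover have "f x \<cdot> y = f (k \<odot>\<^bsub>?S\<^esub> x) \<cdot> e \<oplus>\<^bsub>?V\<^esub> f x \<cdot> y'"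
      unfolding y(1) hbounded_smult[OF f x] mult_add_right[OF s' t f_in[OF x] ke y']
        mult_smult_right[OF s' t f_in[OF x] e] mult_smult_left[OF s' t f_in[OF x] e] ..
    moreover have "?G es (x \<cdot> y') (f x \<cdot> y')" using Cons.IH es y(2) x by blast
    moreover have "k \<odot>\<^bsub>?S\<^esub> x \<in> carrier ?S" using x by simp
    ultimately show ?case unfolding ampl_graph.simps by blast
  qed
  \<comment> \<open>Re-expansion in another list. Two tensors come with different lists and can be
    added only after both are written over a common one.\<close>
  have G_mono: "?G ds a b"
    if "?G es a b" "set es \<subseteq> carrier ?T" "set ds \<subseteq> carrier ?T" "set es \<subseteq> lspan ?T ds"
    for es ds a b
    using that
  proof (induction es arbitrary: a b)
    case Nil
    then show ?case using G_zero by simp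
  next
    case (Cons e es)
    obtain x a' b' where x: "x \<in> carrier ?S" "?G es a' b'"
      "a = x \<cdot> e \<oplus>\<^bsub>?U\<^esub> a'" "b = f x \<cdot> e \<oplus>\<^bsub>?V\<^esub> b'" using Cons.prems(1) by auto
    have "?G ds a' b'" using Cons.IH[OF x(2)] Cons.prems by simp
    moreover have "?G ds (x \<cdot> e) (f x \<cdot> e)" using G_mult Cons.prems x(1) by simp
    ultimately show ?case unfolding x(3,4) using G_add Cons.prems(3) by blast
  qed
  have G_orth: "ip ?U (x \<cdot> e) a = 0 \<and> ip ?V (x' \<cdot> e) b = 0"
    if "?G es a b" "set es \<subseteq> carrier ?T" "e \<in> carrier ?T" "\<forall>d\<in>set es. ip ?T e d = 0"
      "x \<in> carrier ?S" "x' \<in> carrier ?S'" for es a b e x x'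
    using that(1,2,4)
  proof (induction es arbitrary: a b)
    case Nil
    then show ?case using in_u[OF that(5,3)] in_v[OF that(6,3)] by simp
  next
    case (Cons d es)
    have d: "d \<in> carrier ?T" and es: "set es \<subseteq> carrier ?T" using Cons.prems by auto
    obtain y a' b' where y: "y \<in> carrier ?S" "?G es a' b'"
      "a = y \<cdot> d \<oplus>\<^bsub>?U\<^esub> a'" "b = f y \<cdot> d \<oplus>\<^bsub>?V\<^esub> b'" using Cons.prems(1) by auto
    have "ip ?U (x \<cdot> e) a' = 0 \<and> ip ?V (x' \<cdot> e) b' = 0"
      using Cons.IH[OF y(2) es] Cons.prems(3) by simp
    moreover have "ip ?T e d = 0" using Cons.prems(3) by simp
    ultimately show ?case unfolding y(3,4)
      using G_in[OF y(2) es] in_u[OF that(5,3)] in_v[OF that(6,3)] in_u[OF y(1) d] in_v[OF f_in[OF y(1)] d]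
        ip_mult[OF s t that(5,3) y(1) d] ip_mult[OF s' t that(6,3) f_in[OF y(1)] d]
      by (simp add: UV.H.ip_add_right UV.K.ip_add_right)
  qed
  have B: "0 \<le> B" using hbounded_nonneg[OF f] .
  have G_sq: "(hnorm ?V b)\<^sup>2 \<le> B\<^sup>2 * (hnorm ?U a)\<^sup>2"
    if "?G es a b" "orthonormal ?T es" for es a b
    using that
  proof (induction es arbitrary: a b)
    case (Cons e es)
    have e: "e \<in> carrier ?T" "ip ?T e e = 1" "\<forall>d\<in>set es. ip ?T e d = 0"
      "orthonormal ?T es" using Cons.prems by auto
    have es: "set es \<subseteq> carrier ?T" using T.orthonormal_subset[OF e(4)] .
    obtain x a' b' where x: "x \<in> carrier ?S" "?G es a' b'"
      "a = x \<cdot> e \<oplus>\<^bsub>?U\<^esub> a'" "b = f x \<cdot> e \<oplus>\<^bsub>?V\<^esub> b'" using Cons.prems(1) by auto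
    have ab: "a' \<in> carrier ?U" "b' \<in> carrier ?V" using G_in[OF x(2) es] by auto
    note orth = G_orth[OF x(2) es e(1,3) x(1) f_in[OF x(1)]]
    have n: "hnorm ?T e = 1" using e(2) by (simp add: hnorm_def)
    have "(hnorm ?V b)\<^sup>2 = (hnorm ?S' (f x))\<^sup>2 + (hnorm ?V b')\<^sup>2"
      unfolding x(4) using UV.K.pythagoras[OF in_v[OF f_in[OF x(1)] e(1)] ab(2)] orth
        hnorm_mult[OF s' t f_in[OF x(1)] e(1)] n by simp
    \<comment> \<open>The summand at \<open>e\<close> is orthogonal to the rest on both sides, so
      the bound for \<open>f\<close> and the induction hypothesis add up.\<close>
    also have "\<dots> \<le> (B * hnorm ?S x)\<^sup>2 + B\<^sup>2 * (hnorm ?U a')\<^sup>2"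
      using hbounded_le[OF f x(1)] S.K.hnorm_nonneg[OF f_in[OF x(1)]] Cons.IH[OF x(2) e(4)]
      by (intro add_mono power_mono)
    also have "\<dots> = B\<^sup>2 * ((hnorm ?S x)\<^sup>2 + (hnorm ?U a')\<^sup>2)"
      by (simp add: power_mult_distrib distrib_left)
    also have "(hnorm ?S x)\<^sup>2 + (hnorm ?U a')\<^sup>2 = (hnorm ?U a)\<^sup>2"
      unfolding x(3) using UV.H.pythagoras[OF in_u[OF x(1) e(1)] ab(1)] orth hnorm_mult[OF s t x(1) e(1)] n
      by simp
    finally show ?case .
  qed simp
  \<comment> \<open>The graph of \<open>f \<otimes> 1\<close> on the whole algebraic tensor product.
    Admitting only orthonormal lists is what yields the bound; by Gram-Schmidt no tensor is
    lost.\<close>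
  define R where "R a b \<longleftrightarrow> (\<exists>es. orthonormal ?T es \<and> ?G es a b)" for a b
  have R_mult: "R (x \<cdot> y) (f x \<cdot> y)" if x: "x \<in> carrier ?S" and y: "y \<in> carrier ?T" for x y
  proof -
    have "submodule (carrier ?T) complex_field ?T" by (simp add: T.submodule_iff)
    then obtain es where "orthonormal ?T es" "set [y] \<subseteq> lspan ?T es"
      by (rule T.gram_schmidt[of _ "[y]"]) (use y in auto)
    then show ?thesis unfolding R_def using G_mult[OF T.orthonormal_subset] x by auto
  qed
  have R_in: "a \<in> carrier ?U" "b \<in> carrier ?V" if "R a b" for a b
  proof -
    obtain es where es: "orthonormal ?T es" "?G es a b" using \<open>R a b\<close> unfolding R_def by blast
    from G_in[OF es(2) T.orthonormal_subset[OF es(1)]]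
    show "a \<in> carrier ?U" "b \<in> carrier ?V" by auto
  qed
  have R_add: "R (a \<oplus>\<^bsub>?U\<^esub> a') (b \<oplus>\<^bsub>?V\<^esub> b')" if "R a b" "R a' b'" for a b a' b'
  proof -
    obtain es ds where es: "orthonormal ?T es" "?G es a b" and ds: "orthonormal ?T ds" "?G ds a' b'"
      using \<open>R a b\<close> \<open>R a' b'\<close> unfolding R_def by blast
    have "submodule (carrier ?T) complex_field ?T" by (simp add: T.submodule_iff)
    then obtain gs where gs: "orthonormal ?T gs" "set (es @ ds) \<subseteq> lspan ?T gs"
      by (rule T.gram_schmidt[of _ "es @ ds"])
        (use T.orthonormal_subset[OF es(1)] T.orthonormal_subset[OF ds(1)] in auto)
    note sub = T.orthonormal_subset[OF es(1)] T.orthonormal_subset[OF ds(1)] T.orthonormal_subset[OF gs(1)]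
    have "?G gs a b" "?G gs a' b'" using G_mono[OF es(2) sub(1,3)] G_mono[OF ds(2) sub(2,3)] gs(2) by auto
    then show ?thesis unfolding R_def using G_add sub(3) gs(1) by blast
  qed
  have R_smult: "R (k \<odot>\<^bsub>?U\<^esub> a) (k \<odot>\<^bsub>?V\<^esub> b)" if "R a b" for k a b
  proof -
    obtain es where es: "orthonormal ?T es" "?G es a b" using \<open>R a b\<close> unfolding R_def by blast
    then show ?thesis unfolding R_def using G_smult[OF es(2) T.orthonormal_subset[OF es(1)]] by blast
  qed
  have R_le: "hnorm ?V b \<le> B * hnorm ?U a" if "R a b" for a b
  proof -
    obtain es where "orthonormal ?T es" "?G es a b" using \<open>R a b\<close> unfolding R_def by blast
    from G_sq[OF this(2,1)] have "(hnorm ?V b)\<^sup>2 \<le> (B * hnorm ?U a)\<^sup>2"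
      by (simp only: power_mult_distrib)
    then show ?thesis
      by (rule power2_le_imp_le) (simp add: B UV.H.hnorm_nonneg[OF R_in(1)[OF that]])
  qed
  let ?D = "{x \<cdot> y | x y. x \<in> carrier ?S \<and> y \<in> carrier ?T}"
  have D: "?D \<subseteq> carrier ?U" using in_u by auto
  have R_span: "\<exists>b. R a b" if "a \<in> hspan ?U ?D" for a
    using that D
  proof (rule UV.H.hspan_induct)
    have "R \<zero>\<^bsub>?U\<^esub> \<zero>\<^bsub>?V\<^esub>" unfolding R_def by (rule exI[of _ "[]"]) simp
    then show "\<exists>b. R \<zero>\<^bsub>?U\<^esub> b" ..
    show "\<exists>b. R x b" if "x \<in> ?D" for x
    proof -
      from that obtain y z where "x = y \<cdot> z" "y \<in> carrier ?S" "z \<in> carrier ?T" by auto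
      then show ?thesis using R_mult by auto
    qed
    show "\<exists>b. R (x \<oplus>\<^bsub>?U\<^esub> y) b" if "\<exists>b. R x b" "\<exists>b. R y b" for x y
      using that R_add by (elim exE) (rule exI)
    show "\<exists>b. R (k \<odot>\<^bsub>?U\<^esub> x) b" if "\<exists>b. R x b" for k x
      using that R_smult by (elim exE) (rule exI)
  qed
  have dense: "\<exists>a b. R a b \<and> hnorm ?U (a \<ominus>\<^bsub>?U\<^esub> x) < \<epsilon>"
    if "x \<in> carrier ?U" "\<epsilon> > 0" for x \<epsilon>
  proof -
    obtain a where a: "a \<in> hspan ?U ?D" "hnorm ?U (a \<ominus>\<^bsub>?U\<^esub> x) < \<epsilon>"
      by (rule UV.H.total_in_approx[OF total_mult[OF s t] \<open>x \<in> carrier ?U\<close> \<open>\<epsilon> > 0\<close>])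
    moreover obtain b where "R a b" using R_span[OF a(1)] ..
    ultimately show ?thesis by (intro exI[of _ a] exI[of _ b] conjI)
  qed
  show thesis
  proof (rule UV.hbounded_extension[of R B, OF R_in(1) R_in(2) R_add R_smult R_le B dense])
    fix A assume A: "hbounded ?U ?V B A" "\<And>a b. R a b \<Longrightarrow> A a = b"
    show thesis by (rule that[OF A(1)]) (rule A(2)[OF R_mult])
  qed
qed

end

lemma (in hilbert_space) bounded_operator_iff: "bounded_operator H f \<longleftrightarrow> (\<exists>B. hbounded H H B f)"
proof
  assume "bounded_operator H f"
  then obtain B where lin: "hlinear H H f" and B: "\<forall>x\<in>carrier H. hnorm H (f x) \<le> B * hnorm H x"
    unfolding bounded_operator_def hlinear_self_iff by blast
  have "hnorm H (f x) \<le> \<bar>B\<bar> * hnorm H x" if x: "x \<in> carrier H" for x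
  proof -
    have "B * hnorm H x \<le> \<bar>B\<bar> * hnorm H x" by (rule mult_right_mono) (use x in simp_all)
    then show ?thesis using bspec[OF B x] by linarith
  qed
  then have "hbounded H H \<bar>B\<bar> f" using lin by (simp add: hbounded_def)
  then show "\<exists>B. hbounded H H B f" ..
next
  assume "\<exists>B. hbounded H H B f"
  then show "bounded_operator H f"
    unfolding bounded_operator_def hbounded_def hlinear_self_iff by blast
qed

section \<open>The operators \<open>amplify\<close>, the identity element, reduction to rank
  one\<close>

context product_system
begin

text \<open>The restriction of the extended map to the carrier satisfies the definite description in
  \<open>amplify\<close>, and totality of the products excludes any other candidate. The bound of
  \<open>S\<close> is inherited.\<close>

lemma amplify_spec:
  assumes s: "s \<in> carrier M" and t: "t \<in> carrier M" and S: "hbounded (pfib E s) (pfib E s) B S"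
  shows "hbounded (pfib E (s \<star> t)) (pfib E (s \<star> t)) B (amplify M E s t S)"
    and "\<And>x y. x \<in> carrier (pfib E s) \<Longrightarrow> y \<in> carrier (pfib E t) \<Longrightarrow> amplify M E s t S (x \<cdot> y) = S x \<cdot> y"
proof -
  let ?H = "pfib E (s \<star> t)"
  interpret H: hilbert_space ?H using hilbert s t by simp
  interpret HH: hilbert_pair ?H ?H using hilbert_pair s t by simp
  obtain A where A: "hbounded ?H ?H B A"
    "\<And>x y. x \<in> carrier (pfib E s) \<Longrightarrow> y \<in> carrier (pfib E t) \<Longrightarrow> A (x \<cdot> y) = S x \<cdot> y"
    using amplification_exists[OF s s t S] by blast
  let ?A = "restrict A (carrier ?H)"
  have A': "hbounded ?H ?H B ?A" by (rule HH.hbounded_cong[OF A(1)]) simp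
  have A'_mult: "?A (x \<cdot> y) = S x \<cdot> y" if "x \<in> carrier (pfib E s)" "y \<in> carrier (pfib E t)" for x y
    using A(2)[OF that] mult_in[OF s t that] by simp
  have "amplify M E s t S = ?A"
    unfolding amplify_def
  proof (rule the_equality)
    show "?A \<in> extensional (carrier ?H) \<and> bounded_operator ?H ?A \<and>
        (\<forall>x\<in>carrier (pfib E s). \<forall>y\<in>carrier (pfib E t). ?A (x \<cdot> y) = S x \<cdot> y)"
      using A' A'_mult unfolding H.bounded_operator_iff by blast
    fix A'' assume *: "A'' \<in> extensional (carrier ?H) \<and> bounded_operator ?H A'' \<and>
        (\<forall>x\<in>carrier (pfib E s). \<forall>y\<in>carrier (pfib E t). A'' (x \<cdot> y) = S x \<cdot> y)"
    then obtain C where C: "hbounded ?H ?H C A''" unfolding H.bounded_operator_iff by blast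
    show "A'' = ?A"
    proof (rule extensionalityI[of _ "carrier ?H"])
      fix v assume v: "v \<in> carrier ?H"
      show "A'' v = ?A v"
        by (rule amplification_unique[OF s t H.hilbert_space_axioms C A' _ v]) (use * A'_mult in simp)
    qed (use * in auto)
  qed
  then show "hbounded ?H ?H B (amplify M E s t S)"
    "\<And>x y. x \<in> carrier (pfib E s) \<Longrightarrow> y \<in> carrier (pfib E t) \<Longrightarrow> amplify M E s t S (x \<cdot> y) = S x \<cdot> y"
    using A' A'_mult by simp_all
qed

text \<open>The fibre over the identity is spanned by some \<open>v\<close> with
  \<open>v v = c v\<close>. Norms are multiplicative, so \<open>c\<close> is nonzero and
  \<open>v / c\<close> is a nonzero idempotent, of norm 1. Multiplication by it, on either side, is
  isometric and idempotent, hence the identity.\<close>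

lemma unit_exists:
  obtains \<Omega> where "\<Omega> \<in> carrier (pfib E \<one>\<^bsub>M\<^esub>)" "hnorm (pfib E \<one>\<^bsub>M\<^esub>) \<Omega> = 1"
    "\<And>t x. t \<in> carrier M \<Longrightarrow> x \<in> carrier (pfib E t) \<Longrightarrow> \<Omega> \<cdot> x = x"
    "\<And>t x. t \<in> carrier M \<Longrightarrow> x \<in> carrier (pfib E t) \<Longrightarrow> x \<cdot> \<Omega> = x"
proof -
  let ?H = "pfib E \<one>\<^bsub>M\<^esub>"
  interpret H: hilbert_space ?H using hilbert by simp
  obtain v where v: "v \<in> carrier ?H" "v \<noteq> \<zero>\<^bsub>?H\<^esub>" "carrier ?H = range (\<lambda>c. c \<odot>\<^bsub>?H\<^esub> v)"
    using dim_one by blast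
  have mult_H: "x \<cdot> y \<in> carrier ?H" if "x \<in> carrier ?H" "y \<in> carrier ?H" for x y
    using mult_in[OF one_closed one_closed that] by simp
  obtain c where c: "v \<cdot> v = c \<odot>\<^bsub>?H\<^esub> v" using mult_H[OF v(1) v(1)] v(3) by auto
  have nv: "hnorm ?H v \<noteq> 0" using H.hnorm_eq_0 v(1,2) by blast
  have "hnorm ?H (v \<cdot> v) = hnorm ?H v * hnorm ?H v"
    using hnorm_mult[OF one_closed one_closed v(1) v(1)] by simp
  then have c0: "c \<noteq> 0" using c nv v(1) by auto
  define \<Omega> where "\<Omega> = inverse c \<odot>\<^bsub>?H\<^esub> v"
  have \<Omega>: "\<Omega> \<in> carrier ?H" unfolding \<Omega>_def using v(1) by simp
  have "\<Omega> \<cdot> \<Omega> = inverse c \<odot>\<^bsub>?H\<^esub> (inverse c \<odot>\<^bsub>?H\<^esub> (v \<cdot> v))"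
    using mult_smult_left[OF one_closed one_closed v(1) \<Omega>, of "inverse c"]
      mult_smult_right[OF one_closed one_closed v(1) v(1), of "inverse c"] by (simp add: \<Omega>_def)
  then have idem: "\<Omega> \<cdot> \<Omega> = \<Omega>" using c c0 v(1) by (simp add: \<Omega>_def H.smult_smult)
  have "\<Omega> \<noteq> \<zero>\<^bsub>?H\<^esub>"
  proof
    assume "\<Omega> = \<zero>\<^bsub>?H\<^esub>"
    then have "hnorm ?H \<Omega> = 0" by simp
    then show False unfolding \<Omega>_def using v(1) c0 nv by simp
  qed
  then have n0: "hnorm ?H \<Omega> \<noteq> 0" using H.hnorm_eq_0 \<Omega> by blast
  have "hnorm ?H \<Omega> * hnorm ?H \<Omega> = hnorm ?H \<Omega>"
    using hnorm_mult[OF one_closed one_closed \<Omega> \<Omega>] idem by simp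
  then have n: "hnorm ?H \<Omega> = 1" using n0 by simp
  show thesis
  proof
    show "\<Omega> \<in> carrier ?H" "hnorm ?H \<Omega> = 1" by fact+
    show "\<Omega> \<cdot> x = x" if t: "t \<in> carrier M" and x: "x \<in> carrier (pfib E t)" for t x
    proof -
      interpret T: hilbert_space "pfib E t" using hilbert t .
      have x': "\<Omega> \<cdot> x \<in> carrier (pfib E t)" using mult_in[OF one_closed t \<Omega> x] t by simp
      have L: "hbounded (pfib E t) (pfib E t) 1 (\<lambda>y. \<Omega> \<cdot> y)"
        using hbounded_left_mult[OF one_closed t \<Omega>] t n by simp
      interpret TT: hilbert_pair "pfib E t" "pfib E t" using hilbert_pair t t .
      have "\<Omega> \<cdot> (\<Omega> \<cdot> x) = \<Omega> \<cdot> x"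
        using mult_assoc_fib[OF one_closed one_closed t \<Omega> \<Omega> x] idem by simp
      then have "\<Omega> \<cdot> (\<Omega> \<cdot> x \<ominus>\<^bsub>pfib E t\<^esub> x) = \<zero>\<^bsub>pfib E t\<^esub>"
        using TT.hlinear_minus[OF hbounded_linear[OF L] x' x] x' by (simp add: T.minus_eq_zero)
      moreover have "hnorm (pfib E t) (\<Omega> \<cdot> (\<Omega> \<cdot> x \<ominus>\<^bsub>pfib E t\<^esub> x)) = hnorm (pfib E t) (\<Omega> \<cdot> x \<ominus>\<^bsub>pfib E t\<^esub> x)"
        using hnorm_mult[OF one_closed t \<Omega> T.minus_in[OF x' x]] t n by simp
      ultimately have "hnorm (pfib E t) (\<Omega> \<cdot> x \<ominus>\<^bsub>pfib E t\<^esub> x) \<le> 0" by simp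
      then show ?thesis using T.eq_of_hnorm_minus[OF x' x] by blast
    qed
    show "x \<cdot> \<Omega> = x" if t: "t \<in> carrier M" and x: "x \<in> carrier (pfib E t)" for t x
    proof -
      interpret T: hilbert_space "pfib E t" using hilbert t .
      have x': "x \<cdot> \<Omega> \<in> carrier (pfib E t)" using mult_in[OF t one_closed x \<Omega>] t by simp
      have "(x \<cdot> \<Omega> \<ominus>\<^bsub>pfib E t\<^esub> x) \<cdot> \<Omega> = (x \<cdot> \<Omega>) \<cdot> \<Omega> \<oplus>\<^bsub>pfib E t\<^esub> (-1) \<odot>\<^bsub>pfib E t\<^esub> (x \<cdot> \<Omega>)"
        using mult_add_left[OF t one_closed x' T.smult_in[OF x] \<Omega>, of "-1"]
          mult_smult_left[OF t one_closed x \<Omega>, of "-1"] t by (simp add: T.minus_conv_add x x')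
      also have "(x \<cdot> \<Omega>) \<cdot> \<Omega> = x \<cdot> \<Omega>"
        using mult_assoc_fib[OF t one_closed one_closed x \<Omega> \<Omega>] idem by simp
      finally have "(x \<cdot> \<Omega> \<ominus>\<^bsub>pfib E t\<^esub> x) \<cdot> \<Omega> = \<zero>\<^bsub>pfib E t\<^esub>"
        using T.minus_conv_add[OF x' x'] T.minus_eq_zero[OF x' x'] by simp
      moreover have "hnorm (pfib E t) ((x \<cdot> \<Omega> \<ominus>\<^bsub>pfib E t\<^esub> x) \<cdot> \<Omega>) = hnorm (pfib E t) (x \<cdot> \<Omega> \<ominus>\<^bsub>pfib E t\<^esub> x)"
        using hnorm_mult[OF t one_closed T.minus_in[OF x' x] \<Omega>] t n by simp
      ultimately have "hnorm (pfib E t) (x \<cdot> \<Omega> \<ominus>\<^bsub>pfib E t\<^esub> x) \<le> 0" by simp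
      then show ?thesis using T.eq_of_hnorm_minus[OF x' x] by blast
    qed
  qed
qed

text \<open>Reduction to rank one: if \<open>f\<close> is within \<delta> of a finite rank map, then
  so are the amplifications, and the maps sandwiched between \<open>p\<close> and \<open>q\<close>
  differ by at most \<open>Cq \<delta> Cp\<close>. The bounded maps \<open>p\<close> and
  \<open>q\<close> are there because \<open>f \<otimes> 1\<close> alone is rarely compact. It is
  used once with \<open>p\<close> a left multiplication and \<open>q\<close> the identity, once with
  \<open>p\<close> the identity and \<open>q = S \<otimes> 1\<close>.\<close>

lemma hcompact_amplification:
  assumes s: "s \<in> carrier M" and s': "s' \<in> carrier M" and t: "t \<in> carrier M"
    and V: "hilbert_space V" and W: "hilbert_space W"
    and f: "hcompact (pfib E s) (pfib E s') f"
    and A: "hbounded (pfib E (s \<star> t)) (pfib E (s' \<star> t)) C A"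
    and A_mult: "\<And>x y. x \<in> carrier (pfib E s) \<Longrightarrow> y \<in> carrier (pfib E t) \<Longrightarrow> A (x \<cdot> y) = f x \<cdot> y"
    and D: "total_in (pfib E s') D"
    and p: "hbounded V (pfib E (s \<star> t)) Cp p" and q: "hbounded (pfib E (s' \<star> t)) W Cq q"
    and ampl_rank_one: "\<And>B \<phi> d. hfunctional (pfib E s) B \<phi> \<Longrightarrow> d \<in> D \<Longrightarrow>
      \<exists>A1 C1. hbounded (pfib E (s \<star> t)) (pfib E (s' \<star> t)) C1 A1 \<and>
        (\<forall>x\<in>carrier (pfib E s). \<forall>y\<in>carrier (pfib E t). A1 (x \<cdot> y) = (\<phi> x \<odot>\<^bsub>pfib E s'\<^esub> d) \<cdot> y) \<and>
        hcompact V W (\<lambda>v. q (A1 (p v)))"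
  shows "hcompact V W (\<lambda>v. q (A (p v)))"
proof -
  let ?u = "pfib E (s \<star> t)" and ?v = "pfib E (s' \<star> t)"
  interpret S: hilbert_pair "pfib E s" "pfib E s'" using hilbert_pair s s' .
  interpret UV: hilbert_pair ?u ?v using hilbert_pair s s' t by simp
  interpret XY: hilbert_pair V W using V W by (rule hilbert_pair.intro)
  interpret vY: hilbert_pair ?v W using UV.K.hilbert_space_axioms W by (rule hilbert_pair.intro)
  have DK: "D \<subseteq> carrier (pfib E s')" using D by (simp add: total_in_def)
  have fr_in: "g x \<in> carrier (pfib E s')" if "finite_rank (pfib E s) (pfib E s') D g" for g x
    using that by induction (use DK in auto)
  have fr: "\<exists>A1 C1. hbounded ?u ?v C1 A1 \<and>
        (\<forall>x\<in>carrier (pfib E s). \<forall>y\<in>carrier (pfib E t). A1 (x \<cdot> y) = g x \<cdot> y) \<and>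
        hcompact V W (\<lambda>v. q (A1 (p v)))"
    if "finite_rank (pfib E s) (pfib E s') D g" for g
    using that
  proof induction
    case zero
    have "hbounded ?u ?v 0 (\<lambda>_. \<zero>\<^bsub>?v\<^esub>)" by (simp add: hbounded_def hlinear_def)
    moreover have "hcompact V W (\<lambda>v. q \<zero>\<^bsub>?v\<^esub>)"
      using XY.hcompact_zero vY.hlinear_zero[OF hbounded_linear[OF q]] by simp
    ultimately show ?case using mult_zero_left[OF s' t] by (intro exI[of _ "\<lambda>_. \<zero>\<^bsub>?v\<^esub>"] exI[of _ 0]) simp
  next
    case (rank_one B \<phi> d)
    then show ?case by (rule ampl_rank_one)
  next
    case (plus g h)
    obtain A1 C1 where 1: "hbounded ?u ?v C1 A1" "hcompact V W (\<lambda>v. q (A1 (p v)))"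
      "\<forall>x\<in>carrier (pfib E s). \<forall>y\<in>carrier (pfib E t). A1 (x \<cdot> y) = g x \<cdot> y" using plus.IH(1) by blast
    obtain A2 C2 where 2: "hbounded ?u ?v C2 A2" "hcompact V W (\<lambda>v. q (A2 (p v)))"
      "\<forall>x\<in>carrier (pfib E s). \<forall>y\<in>carrier (pfib E t). A2 (x \<cdot> y) = h x \<cdot> y" using plus.IH(2) by blast
    have "hcompact V W (\<lambda>v. q (A1 (p v) \<oplus>\<^bsub>?v\<^esub> A2 (p v)))"
      by (rule XY.hcompact_cong[OF XY.hcompact_plus[OF 1(2) 2(2)]])
        (simp add: hbounded_add[OF q] hbounded_in[OF 1(1)] hbounded_in[OF 2(1)] hbounded_in[OF p])
    moreover have "A1 (x \<cdot> y) \<oplus>\<^bsub>?v\<^esub> A2 (x \<cdot> y) = (g x \<oplus>\<^bsub>pfib E s'\<^esub> h x) \<cdot> y"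
      if "x \<in> carrier (pfib E s)" "y \<in> carrier (pfib E t)" for x y
      using 1(3) 2(3) that mult_add_left[OF s' t fr_in[OF plus.hyps(1)] fr_in[OF plus.hyps(2)] that(2)] by simp
    ultimately show ?case using UV.hbounded_plus[OF 1(1) 2(1)]
      by (intro exI[of _ "\<lambda>v. A1 v \<oplus>\<^bsub>?v\<^esub> A2 v"] exI[of _ "C1 + C2"]) simp
  qed
  show ?thesis
  proof (rule XY.hcompact_approx)
    show "hlinear V W (\<lambda>v. q (A (p v)))"
      using hlinear_comp[OF hlinear_comp[OF hbounded_linear[OF p] hbounded_linear[OF A]] hbounded_linear[OF q]] .
    fix \<epsilon> :: real assume \<epsilon>: "\<epsilon> > 0"
    have Cpq: "0 \<le> Cp" "0 \<le> Cq" using hbounded_nonneg p q by blast+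
    \<comment> \<open>The summand 1 covers the case that one of the bounds \<open>Cp\<close>,
      \<open>Cq\<close> is 0.\<close>
    define \<delta> where "\<delta> = \<epsilon> / (Cp * Cq + 1)"
    have \<delta>: "0 < \<delta>" "(Cp * Cq) * \<delta> \<le> \<epsilon>"
    proof -
      have pos: "0 < Cp * Cq + 1" using Cpq by (simp add: add_nonneg_pos)
      then show "0 < \<delta>" unfolding \<delta>_def using \<epsilon> by simp
      then have "(Cp * Cq) * \<delta> \<le> (Cp * Cq + 1) * \<delta>" by (intro mult_right_mono) auto
      also have "\<dots> = \<epsilon>" unfolding \<delta>_def using pos by simp
      finally show "(Cp * Cq) * \<delta> \<le> \<epsilon>" .
    qed
    obtain g where g: "finite_rank (pfib E s) (pfib E s') D g"
      "hbounded (pfib E s) (pfib E s') \<delta> (\<lambda>x. f x \<ominus>\<^bsub>pfib E s'\<^esub> g x)"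
      using S.hcompact_finite_rank_approx[OF f D \<delta>(1)] by blast
    obtain A1 C1 where A1: "hbounded ?u ?v C1 A1" "hcompact V W (\<lambda>v. q (A1 (p v)))"
      "\<forall>x\<in>carrier (pfib E s). \<forall>y\<in>carrier (pfib E t). A1 (x \<cdot> y) = g x \<cdot> y" using fr[OF g(1)] by blast
    obtain A2 where A2: "hbounded ?u ?v \<delta> A2"
      "\<And>x y. x \<in> carrier (pfib E s) \<Longrightarrow> y \<in> carrier (pfib E t) \<Longrightarrow> A2 (x \<cdot> y) = (f x \<ominus>\<^bsub>pfib E s'\<^esub> g x) \<cdot> y"
      using amplification_exists[OF s s' t g(2)] by blast
    have A12: "A v \<ominus>\<^bsub>?v\<^esub> A1 v = A2 v" if v: "v \<in> carrier ?u" for v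
    proof (rule amplification_unique[OF s t UV.K.hilbert_space_axioms UV.hbounded_diff[OF A A1(1)] A2(1) _ v])
      fix x y assume x: "x \<in> carrier (pfib E s)" and y: "y \<in> carrier (pfib E t)"
      have carr: "f x \<in> carrier (pfib E s')" "g x \<in> carrier (pfib E s')"
        using hlinear_in[OF hcompact_linear[OF f] x] fr_in[OF g(1)] by auto
      have "(f x \<ominus>\<^bsub>pfib E s'\<^esub> g x) \<cdot> y = f x \<cdot> y \<oplus>\<^bsub>?v\<^esub> (-1) \<odot>\<^bsub>?v\<^esub> (g x \<cdot> y)"
        unfolding S.K.minus_conv_add[OF carr] mult_add_left[OF s' t carr(1) S.K.smult_in[OF carr(2)] y]
          mult_smult_left[OF s' t carr(2) y] ..
      also have "\<dots> = f x \<cdot> y \<ominus>\<^bsub>?v\<^esub> g x \<cdot> y"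
        using UV.K.minus_conv_add[OF mult_in[OF s' t carr(1) y] mult_in[OF s' t carr(2) y]] by simp
      finally show "A (x \<cdot> y) \<ominus>\<^bsub>?v\<^esub> A1 (x \<cdot> y) = A2 (x \<cdot> y)"
        using A_mult[OF x y] A1(3) A2(2)[OF x y] x y by simp
    qed
    have "hnorm W (q (A (p x)) \<ominus>\<^bsub>W\<^esub> q (A1 (p x))) \<le> \<epsilon> * hnorm V x" if x: "x \<in> carrier V" for x
    proof -
      have px: "p x \<in> carrier ?u" using hbounded_in[OF p x] .
      have "q (A (p x)) \<ominus>\<^bsub>W\<^esub> q (A1 (p x)) = q (A (p x) \<ominus>\<^bsub>?v\<^esub> A1 (p x))"
        using vY.hlinear_minus[OF hbounded_linear[OF q] hbounded_in[OF A px] hbounded_in[OF A1(1) px]] by simp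
      also have "\<dots> = q (A2 (p x))" using A12[OF px] by simp
      also have "hnorm W \<dots> \<le> (Cq * (\<delta> * Cp)) * hnorm V x"
        using hbounded_le[OF hbounded_comp[OF hbounded_comp[OF p A2(1)] q] x] .
      also have "\<dots> = ((Cp * Cq) * \<delta>) * hnorm V x" by (simp only: ac_simps)
      also have "\<dots> \<le> \<epsilon> * hnorm V x" using \<delta>(2) x by (intro mult_right_mono) auto
      finally show ?thesis .
    qed
    then show "\<exists>g. hcompact V W g \<and> (\<forall>x\<in>carrier V. hnorm W (q (A (p x)) \<ominus>\<^bsub>W\<^esub> g x) \<le> \<epsilon> * hnorm V x)"
      using A1(2) by blast
  qed
qed

section \<open>Transfer of alignment from \<open>c = a a' = b b'\<close> to
  \<open>u c\<close>\<close>

context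
  fixes u a b a' b' c
  assumes u: "u \<in> carrier M" and a: "a \<in> carrier M" and b: "b \<in> carrier M"
    and a': "a' \<in> carrier M" and b': "b' \<in> carrier M"
    and ca: "c = a \<star> a'" and cb: "c = b \<star> b'"
    and aligned: "\<And>S T. hcompact (pfib E a) (pfib E a) S \<Longrightarrow> hcompact (pfib E b) (pfib E b) T \<Longrightarrow>
      hcompact (pfib E c) (pfib E c) (\<lambda>v. amplify M E a a' S (amplify M E b b' T v))"
begin

private lemma c: "c \<in> carrier M"
  using a a' ca by simp

private lemma ua: "u \<star> a \<in> carrier M" and ub: "u \<star> b \<in> carrier M"
  and uc: "u \<star> c \<in> carrier M"
  using u a b c by simp_all

private lemma uaa': "u \<star> a \<star> a' = u \<star> c" and ubb': "u \<star> b \<star> b' = u \<star> c"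
  using m_assoc[OF u a a'] m_assoc[OF u b b'] ca cb by simp_all

text \<open>
  On the range of \<open>\<eta> \<mapsto> z \<eta>\<close> the operator \<open>T \<otimes> 1\<close> is the identity, where \<open>T\<close> is the projection onto
  the span of \<open>z\<close> (for \<open>z = 0\<close> the coefficient \<open>inverse 0 = 0\<close> makes \<open>T = 0\<close>).
\<close>

private lemma hcompact_amplify_left_mult:
  assumes R: "hcompact (pfib E a) (pfib E a) R" and z: "z \<in> carrier (pfib E b)"
  shows "hcompact (pfib E b') (pfib E c) (\<lambda>\<eta>. amplify M E a a' R (z \<cdot> \<eta>))"
proof -
  interpret B: hilbert_pair "pfib E b" "pfib E b" using hilbert_pair b b .
  interpret C: hilbert_pair "pfib E b'" "pfib E c" using hilbert_pair b' c .
  let ?k = "inverse (complex_of_real ((hnorm (pfib E b) z)\<^sup>2))"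
  define T where "T = (\<lambda>w. ip (pfib E b) w z \<odot>\<^bsub>pfib E b\<^esub> (?k \<odot>\<^bsub>pfib E b\<^esub> z))"
  have id: "hbounded (pfib E b) (pfib E b) 1 (\<lambda>w. w)" by (simp add: hbounded_def hlinear_def)
  have T: "hcompact (pfib E b) (pfib E b) T"
    unfolding T_def by (rule B.hcompact_rank_one[OF B.hfunctional_ip[OF id z]]) (use z in simp)
  then obtain C where C: "hbounded (pfib E b) (pfib E b) C T" using B.hcompact_bounded by blast
  have "T z = z"
  proof (cases "z = \<zero>\<^bsub>pfib E b\<^esub>")
    case False
    then have "complex_of_real ((hnorm (pfib E b) z)\<^sup>2) * ?k = 1" using B.H.hnorm_eq_0[OF z] by simp
    then show ?thesis using z by (simp only: T_def B.H.ip_self B.H.smult_smult B.H.smult_1)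
  qed (simp add: T_def)
  then have Tz: "amplify M E b b' T (z \<cdot> \<eta>) = z \<cdot> \<eta>" if "\<eta> \<in> carrier (pfib E b')" for \<eta>
    using amplify_spec(2)[OF b b' C z that] by simp
  have L: "hbounded (pfib E b') (pfib E c) (hnorm (pfib E b) z) (\<lambda>\<eta>. z \<cdot> \<eta>)"
    using hbounded_left_mult[OF b b' z] cb by simp
  show ?thesis
    by (rule C.hcompact_cong[OF hcompact_comp_right[OF C.H.hilbert_space_axioms C.K.hilbert_space_axioms
          C.K.hilbert_space_axioms L aligned[OF R T]]]) (simp add: Tz)
qed

text \<open>\<open>f\<close> runs from the fibre over \<open>a\<close> to the fibre over
  \<open>u a\<close>, where products \<open>x1 x2\<close> are total. For \<open>f\<close> of rank
  one onto such a product, \<open>f \<otimes> 1\<close> is \<open>x1\<close> times the amplification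
  of an operator on the fibre over \<open>a\<close>, and the previous lemma applies to that
  operator.\<close>

private lemma hcompact_amplification_left_mult:
  assumes f: "hcompact (pfib E a) (pfib E (u \<star> a)) f"
    and A: "hbounded (pfib E c) (pfib E (u \<star> c)) B A"
    and A_mult: "\<And>x y. x \<in> carrier (pfib E a) \<Longrightarrow> y \<in> carrier (pfib E a') \<Longrightarrow> A (x \<cdot> y) = f x \<cdot> y"
    and z: "z \<in> carrier (pfib E b)"
  shows "hcompact (pfib E b') (pfib E (u \<star> c)) (\<lambda>\<eta>. A (z \<cdot> \<eta>))"
proof -
  interpret AA: hilbert_pair "pfib E a" "pfib E a" using hilbert_pair a a .
  have L: "hbounded (pfib E b') (pfib E c) (hnorm (pfib E b) z) (\<lambda>\<eta>. z \<cdot> \<eta>)"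
    using hbounded_left_mult[OF b b' z] cb by simp
  have id: "hbounded (pfib E (u \<star> c)) (pfib E (u \<star> c)) 1 (\<lambda>w. w)" by (simp add: hbounded_def hlinear_def)
  show ?thesis
  proof (rule hcompact_amplification[OF a ua a' hilbert[OF b'] hilbert[OF uc] f _ A_mult total_mult[OF u a],
        unfolded uaa' ca[symmetric], OF A _ _ L id])
    fix B \<phi> d
    assume \<phi>: "hfunctional (pfib E a) B \<phi>"
      and "d \<in> {x \<cdot> y | x y. x \<in> carrier (pfib E u) \<and> y \<in> carrier (pfib E a)}"
    then obtain x1 x2 where d: "d = x1 \<cdot> x2" "x1 \<in> carrier (pfib E u)" "x2 \<in> carrier (pfib E a)" by blast
    \<comment> \<open>Only the factor \<open>x2\<close> over \<open>a\<close> enters the operator;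
      \<open>x1\<close> is multiplied on afterwards.\<close>
    let ?R = "\<lambda>x. \<phi> x \<odot>\<^bsub>pfib E a\<^esub> x2"
    have R: "hcompact (pfib E a) (pfib E a) ?R" using AA.hcompact_rank_one[OF \<phi> d(3)] .
    then obtain C where C: "hbounded (pfib E a) (pfib E a) C ?R" using AA.hcompact_bounded by blast
    note amp = amplify_spec[OF a a' C, folded ca]
    note L1 = hbounded_left_mult[OF u c d(2)]
    let ?A1 = "\<lambda>v. x1 \<cdot> amplify M E a a' ?R v"
    have "?A1 (x \<cdot> y) = (\<phi> x \<odot>\<^bsub>pfib E (u \<star> a)\<^esub> d) \<cdot> y"
      if x: "x \<in> carrier (pfib E a)" and y: "y \<in> carrier (pfib E a')" for x y
    proof -
      have Rx: "?R x \<in> carrier (pfib E a)" using d(3) by simp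
      show ?thesis
        unfolding amp(2)[OF x y] d(1) mult_assoc_fib[OF u a a' d(2) Rx y, symmetric]
          mult_smult_right[OF u a d(2,3)] ..
    qed
    moreover have "hcompact (pfib E b') (pfib E (u \<star> c)) (\<lambda>\<eta>. ?A1 (z \<cdot> \<eta>))"
      by (rule hcompact_comp_left[OF hilbert[OF c] hilbert[OF uc] hcompact_amplify_left_mult[OF R z] L1])
    ultimately show "\<exists>A1 C1. hbounded (pfib E c) (pfib E (u \<star> c)) C1 A1 \<and>
        (\<forall>x\<in>carrier (pfib E a). \<forall>y\<in>carrier (pfib E a'). A1 (x \<cdot> y) = (\<phi> x \<odot>\<^bsub>pfib E (u \<star> a)\<^esub> d) \<cdot> y) \<and>
        hcompact (pfib E b') (pfib E (u \<star> c)) (\<lambda>v. A1 (z \<cdot> v))"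
      using hbounded_comp[OF amp(1) L1] by blast
  qed
qed

text \<open>For \<open>T\<close> of rank one onto \<open>y z\<close> the operator
  \<open>T \<otimes> 1\<close> factors through the fibre over \<open>b'\<close>, by
  \<open>\<phi> \<otimes> 1\<close> followed by left multiplication with \<open>z\<close> and then
  with \<open>y\<close>. Compactness is then needed only for
  \<open>\<eta> \<mapsto> (S \<otimes> 1) (y z \<eta>)\<close>.\<close>

lemma hcompact_amplify_left_translate:
  assumes S: "hcompact (pfib E (u \<star> a)) (pfib E (u \<star> a)) S"
    and T: "hcompact (pfib E (u \<star> b)) (pfib E (u \<star> b)) T"
  shows "hcompact (pfib E (u \<star> c)) (pfib E (u \<star> c))
    (\<lambda>v. amplify M E (u \<star> a) a' S (amplify M E (u \<star> b) b' T v))"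
proof -
  let ?uc = "pfib E (u \<star> c)"
  interpret SS: hilbert_pair "pfib E (u \<star> a)" "pfib E (u \<star> a)" using hilbert_pair ua ua .
  interpret TT: hilbert_pair "pfib E (u \<star> b)" "pfib E (u \<star> b)" using hilbert_pair ub ub .
  obtain BS where BS: "hbounded (pfib E (u \<star> a)) (pfib E (u \<star> a)) BS S"
    using SS.hcompact_bounded[OF S] .
  obtain BT where BT: "hbounded (pfib E (u \<star> b)) (pfib E (u \<star> b)) BT T"
    using TT.hcompact_bounded[OF T] .
  let ?A = "amplify M E (u \<star> a) a' S"
  note A = amplify_spec[OF ua a' BS, unfolded uaa'] and AT = amplify_spec[OF ub b' BT, unfolded ubb']
  have id: "hbounded ?uc ?uc 1 (\<lambda>w. w)" by (simp add: hbounded_def hlinear_def)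
  obtain \<Omega> where \<Omega>: "\<Omega> \<in> carrier (pfib E \<one>\<^bsub>M\<^esub>)"
    "\<And>t x. t \<in> carrier M \<Longrightarrow> x \<in> carrier (pfib E t) \<Longrightarrow> \<Omega> \<cdot> x = x"
    using unit_exists by metis
  show ?thesis
  proof (rule hcompact_amplification[OF ub ub b' hilbert[OF uc] hilbert[OF uc] T _ _ total_mult[OF u b],
        unfolded ubb', OF AT id A(1)])
    fix B \<phi> d
    assume \<phi>: "hfunctional (pfib E (u \<star> b)) B \<phi>"
      and "d \<in> {x \<cdot> y | x y. x \<in> carrier (pfib E u) \<and> y \<in> carrier (pfib E b)}"
    then obtain y z where d: "d = y \<cdot> z" "y \<in> carrier (pfib E u)" "z \<in> carrier (pfib E b)" by blast
    interpret T1: hilbert_pair "pfib E (u \<star> b)" "pfib E \<one>\<^bsub>M\<^esub>" using hilbert_pair ub one_closed .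
    \<comment> \<open>Multiplied by \<open>\<Omega>\<close>, the functional becomes a map into the
      fibre over the identity, so that its amplification is again a map of fibres; it ends in the
      fibre over \<open>\<one> b' = b'\<close>.\<close>
    obtain C where C: "hbounded (pfib E (u \<star> b)) (pfib E \<one>\<^bsub>M\<^esub>) C (\<lambda>w. \<phi> w \<odot>\<^bsub>pfib E \<one>\<^bsub>M\<^esub>\<^esub> \<Omega>)"
      using T1.hcompact_bounded[OF T1.hcompact_rank_one[OF \<phi> \<Omega>(1)]] .
    obtain A0 where A0: "hbounded ?uc (pfib E b') C A0"
      "\<And>w \<eta>. w \<in> carrier (pfib E (u \<star> b)) \<Longrightarrow> \<eta> \<in> carrier (pfib E b') \<Longrightarrow>
        A0 (w \<cdot> \<eta>) = (\<phi> w \<odot>\<^bsub>pfib E \<one>\<^bsub>M\<^esub>\<^esub> \<Omega>) \<cdot> \<eta>"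
      using amplification_exists[OF ub one_closed b' C] unfolding ubb' l_one[OF b'] by blast
    note Lz = hbounded_left_mult[OF b b' d(3), folded cb] and Ly = hbounded_left_mult[OF u c d(2)]
    note Lya = hbounded_left_mult[OF u a d(2)]
    let ?A1 = "\<lambda>v. y \<cdot> (z \<cdot> A0 v)"
    have "?A1 (w \<cdot> \<eta>) = (\<phi> w \<odot>\<^bsub>pfib E (u \<star> b)\<^esub> d) \<cdot> \<eta>"
      if w: "w \<in> carrier (pfib E (u \<star> b))" and \<eta>: "\<eta> \<in> carrier (pfib E b')" for w \<eta>
    proof -
      have "A0 (w \<cdot> \<eta>) = \<phi> w \<odot>\<^bsub>pfib E b'\<^esub> \<eta>"
        unfolding A0(2)[OF w \<eta>] using mult_smult_left[OF one_closed b' \<Omega>(1) \<eta>] \<Omega>(2)[OF b' \<eta>] b' by simp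
      then have "?A1 (w \<cdot> \<eta>) = \<phi> w \<odot>\<^bsub>?uc\<^esub> (y \<cdot> (z \<cdot> \<eta>))"
        using hbounded_smult[OF Lz \<eta>] hbounded_smult[OF Ly hbounded_in[OF Lz \<eta>]] by simp
      also have "y \<cdot> (z \<cdot> \<eta>) = d \<cdot> \<eta>" unfolding d(1) using mult_assoc_fib[OF u b b' d(2,3) \<eta>] by simp
      also have "\<phi> w \<odot>\<^bsub>?uc\<^esub> (d \<cdot> \<eta>) = (\<phi> w \<odot>\<^bsub>pfib E (u \<star> b)\<^esub> d) \<cdot> \<eta>"
        unfolding d(1) using mult_smult_left[OF ub b' mult_in[OF u b d(2,3)] \<eta>] ubb' by simp
      finally show ?thesis .
    qed
    moreover have "hcompact ?uc ?uc (\<lambda>v. ?A (?A1 v))"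
    proof (rule hcompact_comp_right[OF hilbert[OF uc] hilbert[OF b'] hilbert[OF uc] A0(1)])
      show "hcompact (pfib E b') ?uc (\<lambda>\<eta>. ?A (y \<cdot> (z \<cdot> \<eta>)))"
      \<comment> \<open>\<open>\<zeta> \<mapsto> (S \<otimes> 1) (y \<zeta>)\<close> is the
        amplification of \<open>x \<mapsto> S (y x)\<close>, which is compact because
        \<open>S\<close> is.\<close>
      proof (rule hcompact_amplification_left_mult[OF _ hbounded_comp[OF Ly A(1)] _ d(3)])
        show "hcompact (pfib E a) (pfib E (u \<star> a)) (\<lambda>x. S (y \<cdot> x))"
          by (rule hcompact_comp_right[OF hilbert[OF a] hilbert[OF ua] hilbert[OF ua] Lya S])
        show "?A (y \<cdot> (x \<cdot> \<eta>)) = S (y \<cdot> x) \<cdot> \<eta>"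
          if x: "x \<in> carrier (pfib E a)" and \<eta>: "\<eta> \<in> carrier (pfib E a')" for x \<eta>
          using A(2)[OF mult_in[OF u a d(2) x] \<eta>] mult_assoc_fib[OF u a a' d(2) x \<eta>] by simp
      qed
    qed
    ultimately show "\<exists>A1 C1. hbounded ?uc ?uc C1 A1 \<and>
        (\<forall>x\<in>carrier (pfib E (u \<star> b)). \<forall>y\<in>carrier (pfib E b'). A1 (x \<cdot> y) = (\<phi> x \<odot>\<^bsub>pfib E (u \<star> b)\<^esub> d) \<cdot> y) \<and>
        hcompact ?uc ?uc (\<lambda>v. ?A (A1 v))"
      using hbounded_comp[OF A0(1) hbounded_comp[OF Lz Ly]] by blast
  qed
qed

end

end

section \<open>Words in a free product\<close>

text \<open>The join is an arbitrary choice among least upper bounds. Pointedness makes the order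
  antisymmetric, so there is only one to choose.\<close>

lemma (in group) join_left_order_eqI:
  assumes P: "submonoid P G" and pointed: "P \<inter> (\<lambda>x. inv x) ` P = {\<one>}"
    and carr: "s \<in> carrier G" "t \<in> carrier G" "d \<in> carrier G"
    and upper: "inv s \<otimes> d \<in> P" "inv t \<otimes> d \<in> P"
    and least: "\<And>r. r \<in> carrier G \<Longrightarrow> inv s \<otimes> r \<in> P \<Longrightarrow> inv t \<otimes> r \<in> P \<Longrightarrow> inv d \<otimes> r \<in> P"
  shows "s \<squnion>\<^bsub>left_order G P\<^esub> t = d"
proof -
  let ?L = "left_order G P"
  have Upper: "Upper ?L {s, t} = {r \<in> carrier G. inv s \<otimes> r \<in> P \<and> inv t \<otimes> r \<in> P}"
    using carr(1,2) by (auto simp: Upper_def left_order_def)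
  have least_iff: "least ?L r (Upper ?L {s, t}) \<longleftrightarrow> r \<in> carrier G \<and> inv s \<otimes> r \<in> P \<and> inv t \<otimes> r \<in> P \<and>
      (\<forall>r'\<in>carrier G. inv s \<otimes> r' \<in> P \<longrightarrow> inv t \<otimes> r' \<in> P \<longrightarrow> inv r \<otimes> r' \<in> P)" for r
    unfolding least_def Upper by (auto simp: left_order_def)
  have unique: "r = d" if "least ?L r (Upper ?L {s, t})" for r
  proof -
    have r: "r \<in> carrier G" "inv d \<otimes> r \<in> P" "inv r \<otimes> d \<in> P"
      using that carr upper least unfolding least_iff by auto
    have "inv (inv r \<otimes> d) = inv d \<otimes> r" using r(1) carr(3) by (simp add: inv_mult_group)
    then have "inv d \<otimes> r \<in> P \<inter> (\<lambda>x. inv x) ` P" using r(2,3) by (metis IntI image_eqI)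
    then have "inv d \<otimes> r = \<one>" using pointed by auto
    then show ?thesis using r(1) carr(3) by (metis inv_closed inv_equality inv_inv)
  qed
  have "least ?L d (Upper ?L {s, t})" unfolding least_iff using carr(3) upper least by blast
  then show ?thesis unfolding join_def sup_def by (rule some_equality) (rule unique)
qed

locale free_product_words =
  fixes \<Lambda> :: "'l set" and G :: "'l \<Rightarrow> ('g, 'b) monoid_scheme" and P :: "'l \<Rightarrow> 'g set"
  assumes qlo: "l \<in> \<Lambda> \<Longrightarrow> quasi_lattice_ordered (G l) (P l)"
begin

abbreviation letters :: "('l \<times> 'g) set" where
  "letters \<equiv> {(l, g). l \<in> \<Lambda> \<and> g \<in> carrier (G l) \<and> g \<noteq> \<one>\<^bsub>G l\<^esub>}"

abbreviation FG where "FG \<equiv> free_prod_group \<Lambda> G"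

abbreviation wmult where "wmult \<equiv> foldr (letter_mult G)"

lemma group_G: "l \<in> \<Lambda> \<Longrightarrow> group (G l)"
  using qlo quasi_lattice_ordered.axioms(1) by blast

lemma P_subset: "l \<in> \<Lambda> \<Longrightarrow> g \<in> P l \<Longrightarrow> g \<in> carrier (G l)"
  using submonoid.subset[OF quasi_lattice_ordered.submonoid[OF qlo]] by blast

lemma P_mult: "l \<in> \<Lambda> \<Longrightarrow> g \<in> P l \<Longrightarrow> h \<in> P l \<Longrightarrow> g \<otimes>\<^bsub>G l\<^esub> h \<in> P l"
  using submonoid.m_closed[OF quasi_lattice_ordered.submonoid[OF qlo]] by blast

lemma P_one: "l \<in> \<Lambda> \<Longrightarrow> \<one>\<^bsub>G l\<^esub> \<in> P l"
  using submonoid.one_closed[OF quasi_lattice_ordered.submonoid[OF qlo]] by blast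

text \<open>\<open>g\<close> is the inverse of \<open>h\<close>, and \<open>P l\<close> is pointed.
  Hence letters of positive words may merge but never cancel.\<close>

lemma P_mult_eq_one:
  assumes l: "l \<in> \<Lambda>" and gh: "g \<in> P l" "h \<in> P l" "g \<otimes>\<^bsub>G l\<^esub> h = \<one>\<^bsub>G l\<^esub>"
  shows "g = \<one>\<^bsub>G l\<^esub>"
proof -
  interpret group "G l" using group_G l .
  have "g = inv\<^bsub>G l\<^esub> h" using gh P_subset[OF l] inv_equality by metis
  then have "g \<in> P l \<inter> (\<lambda>x. inv\<^bsub>G l\<^esub> x) ` P l" using gh by blast
  then show ?thesis using quasi_lattice_ordered.pointed[OF qlo[OF l]] by blast
qed

section \<open>Reduced words and the group they form\<close>

lemma reduced_Nil: "[] \<in> reduced_words \<Lambda> G"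
  by (simp add: reduced_words_def)

lemma reduced_Cons:
  "(l, g) # w \<in> reduced_words \<Lambda> G \<longleftrightarrow>
     (l, g) \<in> letters \<and> w \<in> reduced_words \<Lambda> G \<and> (w = [] \<or> l \<noteq> fst (hd w))"
  by (cases w) (auto simp: reduced_words_def)

lemma letter_mult_reduced:
  assumes "a \<in> letters" "w \<in> reduced_words \<Lambda> G"
  shows "letter_mult G a w \<in> reduced_words \<Lambda> G"
proof -
  obtain l g where a: "a = (l, g)" "l \<in> \<Lambda>" "g \<in> carrier (G l)" "g \<noteq> \<one>\<^bsub>G l\<^esub>" using assms(1) by auto
  interpret group "G l" using group_G a(2) .
  show ?thesis
  proof (cases w)
    case Nil
    then show ?thesis using a by (simp add: reduced_Cons reduced_Nil)
  next
    case (Cons b w')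
    obtain m h where b: "b = (m, h)" by (cases b)
    then have "h \<in> carrier (G m)" using assms(2) Cons by (simp add: reduced_Cons)
    then have "g \<otimes>\<^bsub>G l\<^esub> h \<in> carrier (G l)" if "l = m" using a(3) that m_closed[of g h] by simp
    then show ?thesis using a b assms(2) Cons by (auto simp: reduced_Cons)
  qed
qed

lemma foldr_reduced:
  assumes "set u \<subseteq> letters" "v \<in> reduced_words \<Lambda> G"
  shows "wmult u v \<in> reduced_words \<Lambda> G"
  using assms(1) by (induction u) (use assms(2) letter_mult_reduced in auto)

lemma set_reduced: "u \<in> reduced_words \<Lambda> G \<Longrightarrow> set u \<subseteq> letters"
  by (auto simp: reduced_words_def)

text \<open>
  Letters of the same factor act on reduced words through the group \<open>G l\<close>; this is van der
  Waerden's proof of associativity.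
\<close>

lemma letter_mult_letter_mult:
  assumes l: "l \<in> \<Lambda>" and g: "g \<in> carrier (G l)" "g \<noteq> \<one>\<^bsub>G l\<^esub>" and h: "h \<in> carrier (G l)" "h \<noteq> \<one>\<^bsub>G l\<^esub>"
    and w: "w \<in> reduced_words \<Lambda> G"
  shows "letter_mult G (l, g) (letter_mult G (l, h) w) =
    (if g \<otimes>\<^bsub>G l\<^esub> h = \<one>\<^bsub>G l\<^esub> then w else letter_mult G (l, g \<otimes>\<^bsub>G l\<^esub> h) w)"
proof -
  interpret group "G l" using group_G l .
  show ?thesis
  proof (cases w)
    case Nil
    then show ?thesis by simp
  next
    case (Cons b w')
    obtain m k where b: "b = (m, k)" by (cases b)
    show ?thesis
    proof (cases "m = l")
      case False
      then show ?thesis using Cons b by auto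
    next
      case True
      have k: "k \<in> carrier (G l)" "k \<noteq> \<one>\<^bsub>G l\<^esub>" and w': "w' = [] \<or> l \<noteq> fst (hd w')"
        using w Cons b True by (auto simp: reduced_Cons)
      have new: "letter_mult G (l, g) w' = (l, g) # w'" using w' by (cases w') auto
      have assoc: "g \<otimes>\<^bsub>G l\<^esub> (h \<otimes>\<^bsub>G l\<^esub> k) = (g \<otimes>\<^bsub>G l\<^esub> h) \<otimes>\<^bsub>G l\<^esub> k" using g(1) h(1) k(1) by (simp add: m_assoc)
      show ?thesis
      proof (cases "h \<otimes>\<^bsub>G l\<^esub> k = \<one>\<^bsub>G l\<^esub>")
        case hk: True
        then have "(g \<otimes>\<^bsub>G l\<^esub> h) \<otimes>\<^bsub>G l\<^esub> k = g" using assoc g(1) by simp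
        then show ?thesis using Cons b True hk new g k by auto
      next
        case hk: False
        then show ?thesis using Cons b True assoc g h k by auto
      qed
    qed
  qed
qed

text \<open>The induction step of associativity. If \<open>a\<close> meets a first letter of its own
  factor in \<open>v\<close>, both sides are two letters acting on the reduced word
  \<open>wmult v' w\<close>, where \<open>v'\<close> is the tail of \<open>v\<close>.\<close>

lemma foldr_letter_mult:
  assumes a: "a \<in> letters" and v: "v \<in> reduced_words \<Lambda> G" and w: "w \<in> reduced_words \<Lambda> G"
  shows "wmult (letter_mult G a v) w = letter_mult G a (wmult v w)"
proof (cases v)
  case Nil
  then show ?thesis by simp
next
  case (Cons b v')
  obtain l g where a': "a = (l, g)" "l \<in> \<Lambda>" "g \<in> carrier (G l)" "g \<noteq> \<one>\<^bsub>G l\<^esub>" using a by auto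
  obtain m h where b: "b = (m, h)" by (cases b)
  show ?thesis
  proof (cases "l = m")
    case False
    then show ?thesis using Cons a' b by simp
  next
    case True
    have h: "h \<in> carrier (G l)" "h \<noteq> \<one>\<^bsub>G l\<^esub>" and v': "v' \<in> reduced_words \<Lambda> G"
      using v Cons b True by (auto simp: reduced_Cons)
    have "wmult v' w \<in> reduced_words \<Lambda> G" using foldr_reduced set_reduced v' w by blast
    from letter_mult_letter_mult[OF a'(2-4) h this] show ?thesis
      using Cons a'(1) b True by simp
  qed
qed

lemma foldr_append_reduced:
  assumes "distinct_adj (map fst (u @ v))"
  shows "wmult u v = u @ v"
  using assms
proof (induction u)
  case (Cons a u)
  then have "wmult u v = u @ v" by (auto simp: distinct_adj_Cons)
  then show ?case using Cons.prems by (cases a; cases "u @ v") auto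
qed simp

lemma FG_simps [simp]:
  "carrier FG = reduced_words \<Lambda> G" "\<one>\<^bsub>FG\<^esub> = []" "u \<otimes>\<^bsub>FG\<^esub> v = wmult u v"
  by (simp_all add: free_prod_group_def)

lemma group_FG: "group FG"
proof (rule groupI)
  show assoc: "x \<otimes>\<^bsub>FG\<^esub> y \<otimes>\<^bsub>FG\<^esub> z = x \<otimes>\<^bsub>FG\<^esub> (y \<otimes>\<^bsub>FG\<^esub> z)"
    if "x \<in> carrier FG" "y \<in> carrier FG" "z \<in> carrier FG" for x y z
  proof -
    have yz: "y \<in> reduced_words \<Lambda> G" "z \<in> reduced_words \<Lambda> G" using that by simp_all
    have "wmult (wmult x y) z = wmult x (wmult y z)"
      if "set x \<subseteq> letters" for x
      using that
    proof (induction x)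
      case (Cons a x)
      then show ?case using foldr_letter_mult[of a, OF _ foldr_reduced[of x, OF _ yz(1)] yz(2)] by simp
    qed simp
    then show ?thesis using set_reduced that(1) by simp
  qed
  show "\<exists>y\<in>carrier FG. y \<otimes>\<^bsub>FG\<^esub> x = \<one>\<^bsub>FG\<^esub>" if "x \<in> carrier FG" for x
  proof -
    have "x \<in> reduced_words \<Lambda> G" using that by simp
    then show ?thesis
    proof (induction x)
      case Nil
      then show ?case by (auto intro!: bexI[of _ "[]"])
    next
      case (Cons a x)
      obtain l g where a: "a = (l, g)" by (cases a)
      then have lg: "l \<in> \<Lambda>" "g \<in> carrier (G l)" "g \<noteq> \<one>\<^bsub>G l\<^esub>" and x: "x \<in> reduced_words \<Lambda> G"
        using Cons.prems by (auto simp: reduced_Cons)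
      interpret group "G l" using group_G lg(1) .
      obtain y where y: "y \<in> reduced_words \<Lambda> G" "wmult y x = []" using Cons.IH[OF x] by auto
      \<comment> \<open>The inverse of a word \<open>a # x\<close> is the inverse of
        \<open>x\<close> followed by the inverse letter of \<open>a\<close>.\<close>
      let ?b = "[(l, inv\<^bsub>G l\<^esub> g)]"
      have b: "?b \<in> reduced_words \<Lambda> G" using lg by (simp add: reduced_Cons reduced_Nil)
      have "wmult (wmult y ?b) (a # x) = wmult y (wmult ?b (a # x))"
        using assoc[of y ?b "a # x"] y(1) b Cons.prems by simp
      also have "wmult ?b (a # x) = x" using a lg by simp
      finally show ?case using y foldr_reduced[OF set_reduced[OF y(1)] b]
        by (intro bexI[of _ "wmult y ?b"]) simp_all
    qed
  qed
qed (auto simp: foldr_reduced set_reduced reduced_Nil)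

section \<open>Positive words and their order\<close>

definition pos_words :: "('l, 'g) word set" where
  "pos_words = {w \<in> reduced_words \<Lambda> G. \<forall>(l, g)\<in>set w. g \<in> P l}"

abbreviation word_le (infix \<open>\<preceq>\<close> 50) where
  "s \<preceq> t \<equiv> inv\<^bsub>FG\<^esub> s \<otimes>\<^bsub>FG\<^esub> t \<in> pos_words"

lemma positive_Nil: "[] \<in> pos_words"
  by (simp add: pos_words_def reduced_Nil)

lemma positive_Cons:
  "(l, g) # w \<in> pos_words \<longleftrightarrow>
     l \<in> \<Lambda> \<and> g \<in> P l \<and> g \<noteq> \<one>\<^bsub>G l\<^esub> \<and> w \<in> pos_words \<and> (w = [] \<or> l \<noteq> fst (hd w))"
  using P_subset by (auto simp: pos_words_def reduced_Cons)

lemma positive_append: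
  "u @ v \<in> pos_words \<longleftrightarrow> u \<in> pos_words \<and> v \<in> pos_words \<and>
     (u = [] \<or> v = [] \<or> fst (last u) \<noteq> fst (hd v))"
  by (auto simp: pos_words_def reduced_words_def distinct_adj_append_iff last_map hd_map)

lemma pos_reduced: "w \<in> pos_words \<Longrightarrow> w \<in> carrier FG"
  by (simp add: pos_words_def)

lemma pos_distinct: "w \<in> pos_words \<Longrightarrow> distinct_adj (map fst w)"
  by (simp add: pos_words_def reduced_words_def)

text \<open>Either \<open>w\<close> does not start in the factor \<open>l\<close>, and
  \<open>h\<close> is the unit, or the first letter \<open>h\<close> of \<open>w\<close> is
  absorbed. In both cases the letter \<open>g\<close> only grows in the order of
  \<open>P l\<close>.\<close>

lemma letter_mult_positive:
  assumes "l \<in> \<Lambda>" "g \<in> P l" "g \<noteq> \<one>\<^bsub>G l\<^esub>" "w \<in> pos_words"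
  obtains h q where "letter_mult G (l, g) w = (l, g \<otimes>\<^bsub>G l\<^esub> h) # q" "h \<in> P l" "g \<otimes>\<^bsub>G l\<^esub> h \<noteq> \<one>\<^bsub>G l\<^esub>"
    "(l, g \<otimes>\<^bsub>G l\<^esub> h) # q \<in> pos_words"
proof -
  interpret group "G l" using group_G assms(1) .
  have g1: "g \<otimes>\<^bsub>G l\<^esub> \<one>\<^bsub>G l\<^esub> = g" using P_subset assms by simp
  show thesis
  proof (cases "w = [] \<or> fst (hd w) \<noteq> l")
    case True
    then have "letter_mult G (l, g) w = (l, g) # w" by (cases w) auto
    moreover have "(l, g) # w \<in> pos_words" using True assms by (auto simp: positive_Cons)
    ultimately show thesis using that[of "\<one>\<^bsub>G l\<^esub>" w] g1 assms P_one by simp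
  next
    case False
    then obtain h w' where w: "w = (l, h) # w'" by (cases w) auto
    then have h: "h \<in> P l" "w' \<in> pos_words" "w' = [] \<or> l \<noteq> fst (hd w')" using assms(4) by (auto simp: positive_Cons)
    have "g \<otimes>\<^bsub>G l\<^esub> h \<noteq> \<one>\<^bsub>G l\<^esub>" using P_mult_eq_one assms h(1) by blast
    then show thesis using that[of h w'] w h assms(1,2) P_mult by (simp add: positive_Cons)
  qed
qed

lemma positive_mult:
  assumes "u \<in> pos_words" "v \<in> pos_words"
  shows "wmult u v \<in> pos_words"
  using assms(1)
proof (induction u)
  case Nil
  then show ?case using assms(2) by simp
next
  case (Cons a u)
  obtain l g where a: "a = (l, g)" by (cases a)
  then have lg: "l \<in> \<Lambda>" "g \<in> P l" "g \<noteq> \<one>\<^bsub>G l\<^esub>" and u: "u \<in> pos_words"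
    using Cons.prems by (auto simp: positive_Cons)
  obtain h q where "letter_mult G (l, g) (wmult u v) = (l, g \<otimes>\<^bsub>G l\<^esub> h) # q"
    "(l, g \<otimes>\<^bsub>G l\<^esub> h) # q \<in> pos_words"
    by (rule letter_mult_positive[OF lg Cons.IH[OF u]])
  then show ?case using a by simp
qed

lemma positive_mult_eq_Nil:
  assumes "u \<in> pos_words" "v \<in> pos_words" "wmult u v = []"
  shows "u = []"
proof (cases u)
  case (Cons a u')
  obtain l g where a: "a = (l, g)" by (cases a)
  then have lg: "l \<in> \<Lambda>" "g \<in> P l" "g \<noteq> \<one>\<^bsub>G l\<^esub>" and u': "u' \<in> pos_words"
    using assms(1) Cons by (auto simp: positive_Cons)
  obtain h q where "letter_mult G (l, g) (wmult u' v) = (l, g \<otimes>\<^bsub>G l\<^esub> h) # q"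
    by (rule letter_mult_positive[OF lg positive_mult[OF u' assms(2)]])
  then show ?thesis using assms(3) Cons a by simp
qed

lemma submonoid_positive: "submonoid pos_words FG"
  by unfold_locales (use pos_reduced in \<open>auto simp: positive_Nil positive_mult\<close>)

text \<open>A positive word is the product of its letters, since neighbours belong to different
  factors and do not merge. Membership in the generated semigroup thus becomes a condition on
  letters.\<close>

lemma free_prod_semigroup_eq: "free_prod_semigroup \<Lambda> G P = pos_words"
proof
  show "free_prod_semigroup \<Lambda> G P \<subseteq> pos_words"
    unfolding free_prod_semigroup_def
    using submonoid_positive by (intro hull_minimal) (auto simp: positive_Cons positive_Nil)
  have "w \<in> H" if "w \<in> pos_words" "submonoid H FG"
    "{[(l, p)] | l p. l \<in> \<Lambda> \<and> p \<in> P l \<and> p \<noteq> \<one>\<^bsub>G l\<^esub>} \<subseteq> H" for w H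
    using that(1)
  proof (induction w)
    case Nil
    then show ?case using submonoid.one_closed[OF that(2)] by simp
  next
    case (Cons a w)
    obtain l g where a: "a = (l, g)" by (cases a)
    have "[a] \<in> H" using Cons.prems that(3) a by (auto simp: positive_Cons)
    moreover have "w \<in> H" using Cons a by (auto simp: positive_Cons)
    moreover have "[a] \<otimes>\<^bsub>FG\<^esub> w = a # w"
      using foldr_append_reduced[of "[a]" w] pos_distinct[OF Cons.prems] by simp
    ultimately show ?case using submonoid.m_closed[OF that(2)] by metis
  qed
  then show "pos_words \<subseteq> free_prod_semigroup \<Lambda> G P"
    unfolding free_prod_semigroup_def hull_def by blast
qed

lemma pointed_positive: "pos_words \<inter> (\<lambda>x. inv\<^bsub>FG\<^esub> x) ` pos_words = {\<one>\<^bsub>FG\<^esub>}"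
proof -
  interpret group FG by (rule group_FG)
  have "u = []" if "u \<in> pos_words" "v \<in> pos_words" "u = inv\<^bsub>FG\<^esub> v" for u v
  proof -
    have "u \<otimes>\<^bsub>FG\<^esub> v = \<one>\<^bsub>FG\<^esub>" unfolding that(3) using pos_reduced[OF that(2)] by (rule l_inv)
    then show ?thesis using positive_mult_eq_Nil[OF that(1,2)] by simp
  qed
  moreover have "[] = inv\<^bsub>FG\<^esub> []" using inv_one by simp
  ultimately show ?thesis using positive_Nil by auto
qed

lemma le_positive_iff:
  assumes "s \<in> carrier FG" "r \<in> carrier FG"
  shows "s \<preceq> r \<longleftrightarrow> (\<exists>p\<in>pos_words. r = s \<otimes>\<^bsub>FG\<^esub> p)"
proof -
  interpret group FG by (rule group_FG)
  show ?thesis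
    using assms pos_reduced by (metis inv_closed inv_solve_left m_closed)
qed

text \<open>Right multiplication by a positive word changes at most the last letter of
  \<open>u @ [(l, a)]\<close>, replacing \<open>a\<close> by some \<open>a h\<close> with
  \<open>h\<close> in \<open>P l\<close>. The upper bounds can therefore be read off from the
  letters of \<open>r\<close>.\<close>

lemma le_last_iff:
  assumes s: "u @ [(l, a)] \<in> pos_words" and r: "r \<in> carrier FG"
  shows "(u @ [(l, a)]) \<preceq> r \<longleftrightarrow>
    r \<in> pos_words \<and> (\<exists>c q. r = u @ (l, c) # q \<and> inv\<^bsub>G l\<^esub> a \<otimes>\<^bsub>G l\<^esub> c \<in> P l)"
proof -
  have l: "l \<in> \<Lambda>" "a \<in> P l" "a \<noteq> \<one>\<^bsub>G l\<^esub>" and u: "u \<in> pos_words" "u = [] \<or> fst (last u) \<noteq> l"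
    using s by (auto simp: positive_append positive_Cons)
  have aG: "a \<in> carrier (G l)" using P_subset l by blast
  interpret group "G l" using group_G l(1) .
  have "(\<exists>p\<in>pos_words. r = wmult (u @ [(l, a)]) p) \<longleftrightarrow>
    r \<in> pos_words \<and> (\<exists>c q. r = u @ (l, c) # q \<and> inv\<^bsub>G l\<^esub> a \<otimes>\<^bsub>G l\<^esub> c \<in> P l)"
  proof
    assume "\<exists>p\<in>pos_words. r = wmult (u @ [(l, a)]) p"
    then obtain p where p: "p \<in> pos_words" "r = wmult (u @ [(l, a)]) p" by blast
    obtain h q where h: "letter_mult G (l, a) p = (l, a \<otimes>\<^bsub>G l\<^esub> h) # q" "h \<in> P l"
      "(l, a \<otimes>\<^bsub>G l\<^esub> h) # q \<in> pos_words"
      by (rule letter_mult_positive[OF l p(1)])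
    have uq: "u @ (l, a \<otimes>\<^bsub>G l\<^esub> h) # q \<in> pos_words" using u h(3) by (simp add: positive_append)
    have "r = u @ (l, a \<otimes>\<^bsub>G l\<^esub> h) # q"
      using p(2) h(1) foldr_append_reduced[OF pos_distinct[OF uq]] by simp
    moreover have "inv\<^bsub>G l\<^esub> a \<otimes>\<^bsub>G l\<^esub> (a \<otimes>\<^bsub>G l\<^esub> h) = h" using aG P_subset[OF l(1) h(2)] by (simp flip: m_assoc)
    ultimately show "r \<in> pos_words \<and> (\<exists>c q. r = u @ (l, c) # q \<and> inv\<^bsub>G l\<^esub> a \<otimes>\<^bsub>G l\<^esub> c \<in> P l)"
      using uq h(2) by auto
  next
    assume "r \<in> pos_words \<and> (\<exists>c q. r = u @ (l, c) # q \<and> inv\<^bsub>G l\<^esub> a \<otimes>\<^bsub>G l\<^esub> c \<in> P l)"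
    then obtain c q where r: "r \<in> pos_words" "r = u @ (l, c) # q" and c: "inv\<^bsub>G l\<^esub> a \<otimes>\<^bsub>G l\<^esub> c \<in> P l" by blast
    have cq: "c \<in> P l" "c \<noteq> \<one>\<^bsub>G l\<^esub>" "q \<in> pos_words" "q = [] \<or> l \<noteq> fst (hd q)"
      using r by (auto simp: positive_append positive_Cons)
    have cG: "c \<in> carrier (G l)" using P_subset l cq by blast
    have ac: "a \<otimes>\<^bsub>G l\<^esub> (inv\<^bsub>G l\<^esub> a \<otimes>\<^bsub>G l\<^esub> c) = c" using aG cG by (simp flip: m_assoc)
    \<comment> \<open>For \<open>a = c\<close> the quotient letter is trivial and may not occur in a
      reduced word.\<close>
    define p where "p = (if a = c then q else (l, inv\<^bsub>G l\<^esub> a \<otimes>\<^bsub>G l\<^esub> c) # q)"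
    have "inv\<^bsub>G l\<^esub> a \<otimes>\<^bsub>G l\<^esub> c \<noteq> \<one>\<^bsub>G l\<^esub>" if "a \<noteq> c" using that ac aG by auto
    then have "p \<in> pos_words" using cq c l by (simp add: p_def positive_Cons)
    moreover have "letter_mult G (l, a) p = (l, c) # q"
      using cq(2,4) ac by (cases q) (auto simp: p_def)
    then have "r = wmult (u @ [(l, a)]) p"
      using r(2) foldr_append_reduced[of u "(l, c) # q"] pos_distinct[OF r(1)] by simp
    ultimately show "\<exists>p\<in>pos_words. r = wmult (u @ [(l, a)]) p" by blast
  qed
  then show ?thesis using le_positive_iff[OF pos_reduced[OF s] r] by simp
qed

text \<open>The axiom \<open>lub\<close> speaks of upper bounds inside \<open>P l\<close>. Every
  upper bound \<open>r\<close> of \<open>a\<close> is there anyway, being \<open>a\<close> times an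
  element of \<open>P l\<close>, so its least element is the join in
  \<open>left_order\<close>.\<close>

lemma factor_join:
  assumes l: "l \<in> \<Lambda>" and ab: "a \<in> P l" "b \<in> P l" and c0: "inv\<^bsub>G l\<^esub> a \<otimes>\<^bsub>G l\<^esub> c0 \<in> P l" "inv\<^bsub>G l\<^esub> b \<otimes>\<^bsub>G l\<^esub> c0 \<in> P l"
    and c0P: "c0 \<in> P l"
  defines "c \<equiv> a \<squnion>\<^bsub>left_order (G l) (P l)\<^esub> b"
  shows "Upper (left_order (G l) (P l)) {a, b} \<inter> P l \<noteq> {}" "c \<in> P l"
    "inv\<^bsub>G l\<^esub> a \<otimes>\<^bsub>G l\<^esub> c \<in> P l" "inv\<^bsub>G l\<^esub> b \<otimes>\<^bsub>G l\<^esub> c \<in> P l"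
    "\<And>r. r \<in> P l \<Longrightarrow> inv\<^bsub>G l\<^esub> a \<otimes>\<^bsub>G l\<^esub> r \<in> P l \<Longrightarrow> inv\<^bsub>G l\<^esub> b \<otimes>\<^bsub>G l\<^esub> r \<in> P l \<Longrightarrow> inv\<^bsub>G l\<^esub> c \<otimes>\<^bsub>G l\<^esub> r \<in> P l"
proof -
  interpret quasi_lattice_ordered "G l" "P l" using qlo l .
  let ?L = "left_order (G l) (P l)"
  have carr: "a \<in> carrier (G l)" "b \<in> carrier (G l)" using P_subset l ab by auto
  have Upper: "Upper ?L {a, b} = {r \<in> carrier (G l). inv\<^bsub>G l\<^esub> a \<otimes>\<^bsub>G l\<^esub> r \<in> P l \<and> inv\<^bsub>G l\<^esub> b \<otimes>\<^bsub>G l\<^esub> r \<in> P l}"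
    using carr by (auto simp: Upper_def left_order_def)
  show ne: "Upper ?L {a, b} \<inter> P l \<noteq> {}" unfolding Upper using c0 c0P P_subset l by blast
  obtain d where d: "least ?L d (Upper ?L {a, b} \<inter> P l)" using lub[OF _ _ ne] carr by auto
  have in_P: "r \<in> P l" if "r \<in> carrier (G l)" "inv\<^bsub>G l\<^esub> a \<otimes>\<^bsub>G l\<^esub> r \<in> P l" for r
    using P_mult[OF l ab(1) that(2)] carr(1) that(1) by (simp flip: m_assoc)
  have "Upper ?L {a, b} \<inter> P l = Upper ?L {a, b}" unfolding Upper using in_P by blast
  then have d': "d \<in> Upper ?L {a, b}" "\<And>r. r \<in> Upper ?L {a, b} \<Longrightarrow> inv\<^bsub>G l\<^esub> d \<otimes>\<^bsub>G l\<^esub> r \<in> P l"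
    using d by (auto simp: least_def left_order_def)
  have cd: "c = d"
    unfolding c_def using d' Upper
    by (intro join_left_order_eqI[OF submonoid pointed carr]) auto
  show "c \<in> P l" "inv\<^bsub>G l\<^esub> a \<otimes>\<^bsub>G l\<^esub> c \<in> P l" "inv\<^bsub>G l\<^esub> b \<otimes>\<^bsub>G l\<^esub> c \<in> P l"
    using d'(1) in_P unfolding cd Upper by auto
  show "inv\<^bsub>G l\<^esub> c \<otimes>\<^bsub>G l\<^esub> r \<in> P l"
    if "r \<in> P l" "inv\<^bsub>G l\<^esub> a \<otimes>\<^bsub>G l\<^esub> r \<in> P l" "inv\<^bsub>G l\<^esub> b \<otimes>\<^bsub>G l\<^esub> r \<in> P l" for r
    using d'(2)[of r] that P_subset[OF l] unfolding cd Upper by blast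
qed

abbreviation FL where "FL \<equiv> left_order FG pos_words"

lemma join_comparable:
  assumes "s \<in> pos_words" "t \<in> pos_words" "s \<preceq> t"
  shows "s \<squnion>\<^bsub>FL\<^esub> t = t" "t \<squnion>\<^bsub>FL\<^esub> s = t"
proof -
  interpret group FG by (rule group_FG)
  have st: "s \<in> carrier FG" "t \<in> carrier FG" using assms pos_reduced by auto
  have "t \<preceq> t" using l_inv[OF st(2)] positive_Nil by simp
  then show "s \<squnion>\<^bsub>FL\<^esub> t = t" "t \<squnion>\<^bsub>FL\<^esub> s = t"
    using assms(3) by (auto intro!: join_left_order_eqI[OF submonoid_positive pointed_positive] st simp del: FG_simps)
qed

text \<open>Incomparable words are nonempty, and \<open>le_last_iff\<close> locates both of them as
  prefixes of a common upper bound \<open>r\<close>, up to their last letters. Those letters sit at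
  the same position of \<open>r\<close>. That \<open>c\<close> differs from \<open>a\<close>,
  \<open>b\<close> and the unit is recorded because the quotients and \<open>c\<close> itself must
  be genuine letters.\<close>

lemma join_cases:
  assumes s: "s \<in> pos_words" and t: "t \<in> pos_words"
    and ub: "Upper FL {s, t} \<inter> pos_words \<noteq> {}"
  obtains (le) "s \<preceq> t" "s \<squnion>\<^bsub>FL\<^esub> t = t"
  | (ge) "t \<preceq> s" "s \<squnion>\<^bsub>FL\<^esub> t = s"
  | (last) u l a b c where "s = u @ [(l, a)]" "t = u @ [(l, b)]" "c = a \<squnion>\<^bsub>left_order (G l) (P l)\<^esub> b"
      "Upper (left_order (G l) (P l)) {a, b} \<inter> P l \<noteq> {}" "s \<squnion>\<^bsub>FL\<^esub> t = u @ [(l, c)]"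
      "inv\<^bsub>G l\<^esub> a \<otimes>\<^bsub>G l\<^esub> c \<in> P l" "inv\<^bsub>G l\<^esub> b \<otimes>\<^bsub>G l\<^esub> c \<in> P l"
      "c \<in> P l" "c \<noteq> a" "c \<noteq> b" "c \<noteq> \<one>\<^bsub>G l\<^esub>"
proof -
  consider (le) "s \<preceq> t" | (ge) "t \<preceq> s"
    | (neither) "inv\<^bsub>FG\<^esub> s \<otimes>\<^bsub>FG\<^esub> t \<notin> pos_words" "inv\<^bsub>FG\<^esub> t \<otimes>\<^bsub>FG\<^esub> s \<notin> pos_words" by blast
  then show thesis
  proof cases
    case le
    then show thesis using join_comparable(1)[OF s t le] that(1) by blast
  next
    case ge
    then show thesis using join_comparable(2)[OF t s ge] that(2) by blast
  next
    case neither
    interpret group FG by (rule group_FG)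
    have st: "s \<in> carrier FG" "t \<in> carrier FG" using pos_reduced s t by auto
    obtain r where r: "r \<in> carrier FG" "s \<preceq> r" "t \<preceq> r"
      using ub st by (auto simp: Upper_def left_order_def simp del: FG_simps)
    have inv_Nil: "inv\<^bsub>FG\<^esub> [] = []" using inv_one by simp
    have "s \<noteq> []" using neither(1) t inv_Nil by auto
    then obtain u l a where s_eq: "s = u @ [(l, a)]" by (cases s rule: rev_cases) auto
    have "t \<noteq> []" using neither(2) s inv_Nil by auto
    then obtain v m b where t_eq: "t = v @ [(m, b)]" by (cases t rule: rev_cases) auto
    obtain c1 q1 where r1: "r = u @ (l, c1) # q1" "inv\<^bsub>G l\<^esub> a \<otimes>\<^bsub>G l\<^esub> c1 \<in> P l" and r_pos: "r \<in> pos_words"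
      using r(2) le_last_iff[of u l a r] s r(1) unfolding s_eq by auto
    obtain c2 q2 where r2: "r = v @ (m, c2) # q2" "inv\<^bsub>G m\<^esub> b \<otimes>\<^bsub>G m\<^esub> c2 \<in> P m"
      using r(3) le_last_iff[of v m b r] t r(1) unfolding t_eq by auto
    have s_not_le: "t \<noteq> u @ (l, c) # q" if "inv\<^bsub>G l\<^esub> a \<otimes>\<^bsub>G l\<^esub> c \<in> P l" for c q
      using neither(1) le_last_iff[of u l a t] s t st(2) that unfolding s_eq by blast
    have t_not_le: "s \<noteq> v @ (m, c) # q" if "inv\<^bsub>G m\<^esub> b \<otimes>\<^bsub>G m\<^esub> c \<in> P m" for c q
      using neither(2) le_last_iff[of v m b s] s t st(1) that unfolding t_eq by blast
    have eq: "u @ (l, c1) # q1 = v @ (m, c2) # q2" using r1(1) r2(1) by simp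
    then obtain us where us: "u = v @ us \<and> us @ (l, c1) # q1 = (m, c2) # q2 \<or> u @ us = v \<and> (l, c1) # q1 = us @ (m, c2) # q2"
      unfolding append_eq_append_conv2 by blast
    \<comment> \<open>If \<open>v\<close> were shorter than \<open>u\<close>, then \<open>s\<close>
      would contain the letter of \<open>r\<close> at the position of \<open>b\<close>, and
      \<open>t\<close> would be below \<open>s\<close>; likewise with the roles exchanged.\<close>
    have "us = []"
    proof (rule ccontr)
      assume "us \<noteq> []"
      from us show False
      proof
        assume *: "u = v @ us \<and> us @ (l, c1) # q1 = (m, c2) # q2"
        then obtain us' where "us = (m, c2) # us'" using \<open>us \<noteq> []\<close> by (cases us) auto
        then show False using t_not_le[OF r2(2), of "us' @ [(l, a)]"] * s_eq by simp
      next
        assume *: "u @ us = v \<and> (l, c1) # q1 = us @ (m, c2) # q2"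
        then obtain us' where "us = (l, c1) # us'" using \<open>us \<noteq> []\<close> by (cases us) auto
        then show False using s_not_le[OF r1(2), of "us' @ [(m, b)]"] * t_eq by auto
      qed
    qed
    then have uv: "v = u" "m = l" "c2 = c1" using us by auto
    have l: "l \<in> \<Lambda>" and a: "a \<in> P l" "a \<noteq> \<one>\<^bsub>G l\<^esub>" and u: "u \<in> pos_words" "u = [] \<or> fst (last u) \<noteq> l"
      using s unfolding s_eq by (auto simp: positive_append positive_Cons)
    have b: "b \<in> P l" using t unfolding t_eq uv by (auto simp: positive_append positive_Cons)
    have c1: "c1 \<in> P l" using r_pos unfolding r1(1) by (auto simp: positive_append positive_Cons)
    define c where "c = a \<squnion>\<^bsub>left_order (G l) (P l)\<^esub> b"
    note c = factor_join[OF l a(1) b r1(2) r2(2)[unfolded uv] c1, folded c_def]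
    \<comment> \<open>If \<open>c = a\<close>, then \<open>b\<close> is below \<open>a\<close> and
      \<open>t\<close> below \<open>s\<close>, contrary to incomparability.\<close>
    have ca: "c \<noteq> a" using t_not_le[of a "[]"] c(4) unfolding s_eq uv by auto
    have cb: "c \<noteq> b" using s_not_le[of b "[]"] c(3) unfolding t_eq uv by auto
    have c_one: "c \<noteq> \<one>\<^bsub>G l\<^esub>"
    proof
      interpret L: group "G l" using group_G l .
      assume "c = \<one>\<^bsub>G l\<^esub>"
      then have "a \<otimes>\<^bsub>G l\<^esub> (inv\<^bsub>G l\<^esub> a \<otimes>\<^bsub>G l\<^esub> c) = \<one>\<^bsub>G l\<^esub>" using P_subset[OF l a(1)] by simp
      then show False using P_mult_eq_one[OF l a(1) c(3)] a(2) by blast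
    qed
    let ?d = "u @ [(l, c)]"
    have d: "?d \<in> pos_words" using u l c(2) c_one by (simp add: positive_append positive_Cons positive_Nil)
    have "s \<squnion>\<^bsub>FL\<^esub> t = ?d"
    proof (rule join_left_order_eqI[OF submonoid_positive pointed_positive st pos_reduced[OF d]])
      show "s \<preceq> ?d"
        unfolding s_eq le_last_iff[OF s[unfolded s_eq] pos_reduced[OF d]] using d c(3) by auto
      show "t \<preceq> ?d"
        unfolding t_eq le_last_iff[OF t[unfolded t_eq] pos_reduced[OF d]] using d c(4) uv by auto
      fix r assume r: "r \<in> carrier FG" "s \<preceq> r" "t \<preceq> r"
      obtain k q where k: "r \<in> pos_words" "r = u @ (l, k) # q" "inv\<^bsub>G l\<^esub> a \<otimes>\<^bsub>G l\<^esub> k \<in> P l"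
        using r(2) unfolding s_eq le_last_iff[OF s[unfolded s_eq] r(1)] by blast
      have "inv\<^bsub>G l\<^esub> b \<otimes>\<^bsub>G l\<^esub> k \<in> P l"
        using r(3) k(2) uv unfolding t_eq le_last_iff[OF t[unfolded t_eq] r(1)] by auto
      moreover have "k \<in> P l" using k(1) unfolding k(2) by (auto simp: positive_append positive_Cons)
      ultimately have "inv\<^bsub>G l\<^esub> c \<otimes>\<^bsub>G l\<^esub> k \<in> P l" using c(5) k(3) by blast
      then show "?d \<preceq> r"
        unfolding le_last_iff[OF d r(1)] using k(1,2) by blast
    qed
    then show thesis
      using that(3)[OF s_eq t_eq[unfolded uv] c_def c(1) _ c(3,4,2) ca cb c_one] by blast
  qed
qed

end

section \<open>Compact alignment of free products\<close>

text \<open>The inverse on the image is a graph of norm 1, defined on a dense subspace, and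
  completeness of \<open>H\<close> extends it to all of \<open>K\<close>. Both
  \<open>f \<circ> g\<close> and the identity are bounded and agree on the image, hence
  everywhere.\<close>

lemma (in hilbert_pair) isometry_inverse:
  assumes f: "hlinear H K f" and norm: "\<And>x. x \<in> carrier H \<Longrightarrow> hnorm K (f x) = hnorm H x"
    and total: "total_in K (f ` carrier H)"
  obtains g where "hbounded K H 1 g" "\<And>x. x \<in> carrier H \<Longrightarrow> g (f x) = x" "\<And>y. y \<in> carrier K \<Longrightarrow> f (g y) = y"
proof -
  interpret KH: hilbert_pair K H by unfold_locales
  define R where "R b a \<longleftrightarrow> a \<in> carrier H \<and> b = f a" for a b
  have fK: "f ` carrier H \<subseteq> carrier K" using hlinear_in[OF f] by blast
  have span: "\<exists>a. R b a" if "b \<in> hspan K (f ` carrier H)" for b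
    using that fK
  proof (rule K.hspan_induct)
    show "\<exists>a. R \<zero>\<^bsub>K\<^esub> a" unfolding R_def using hlinear_zero[OF f] by (intro exI[of _ "\<zero>\<^bsub>H\<^esub>"]) simp
    show "\<exists>a. R (x \<oplus>\<^bsub>K\<^esub> y) a" if xy: "\<exists>a. R x a" "\<exists>a. R y a" for x y
    proof -
      obtain a b where "a \<in> carrier H" "x = f a" "b \<in> carrier H" "y = f b" using xy unfolding R_def by blast
      then show ?thesis unfolding R_def using hlinear_add[OF f] by (intro exI[of _ "a \<oplus>\<^bsub>H\<^esub> b"]) simp
    qed
    show "\<exists>a. R (c \<odot>\<^bsub>K\<^esub> x) a" if x: "\<exists>a. R x a" for c x
    proof -
      obtain a where "a \<in> carrier H" "x = f a" using x unfolding R_def by blast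
      then show ?thesis unfolding R_def using hlinear_smult[OF f] by (intro exI[of _ "c \<odot>\<^bsub>H\<^esub> a"]) simp
    qed
  qed (auto simp: R_def)
  show thesis
  proof (rule KH.hbounded_extension[of R 1])
    fix g assume g: "hbounded K H 1 g" "\<And>b a. R b a \<Longrightarrow> g b = a"
    have gf: "g (f x) = x" if "x \<in> carrier H" for x using g(2) that unfolding R_def by blast
    have f': "hbounded H K 1 f" unfolding hbounded_def using f norm by simp
    interpret KK: hilbert_pair K K by unfold_locales
    have id: "hbounded K K 1 (\<lambda>y. y)" by (simp add: hbounded_def hlinear_def)
    have "f (g y) = y" if "y \<in> carrier K" for y
      by (rule KK.hbounded_eq_on_total[OF hbounded_comp[OF g(1) f'] id total _ that]) (auto simp: gf)
    then show thesis using that g(1) gf by blast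
  next
    show "\<exists>a b. R a b \<and> hnorm K (a \<ominus>\<^bsub>K\<^esub> x) < \<epsilon>" if x: "x \<in> carrier K" "\<epsilon> > 0" for x \<epsilon>
    proof -
      obtain y where y: "y \<in> hspan K (f ` carrier H)" "hnorm K (y \<ominus>\<^bsub>K\<^esub> x) < \<epsilon>"
        by (rule K.total_in_approx[OF total x])
      then show ?thesis using span[OF y(1)] by blast
    qed
  qed (use hlinear_in[OF f] hlinear_add[OF f] hlinear_smult[OF f] norm in \<open>auto simp: R_def\<close>)
qed

lemma tensor_args_single: "tensor_args [H] = {[x] | x. x \<in> carrier H}"
  by (auto simp: tensor_args_def list_all2_Cons2)

context product_system
begin

text \<open>Right multiplication by the identity element does nothing, so
  \<open>S \<otimes> 1\<close> is \<open>S\<close> itself. This is the operator whose own word is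
  already the join.\<close>

lemma hcompact_amplify_one:
  assumes s: "s \<in> carrier M" and S: "hcompact (pfib E s) (pfib E s) S"
  shows "hcompact (pfib E s) (pfib E s) (amplify M E s \<one>\<^bsub>M\<^esub> S)"
proof -
  interpret S: hilbert_pair "pfib E s" "pfib E s" using hilbert_pair s s .
  obtain B where B: "hbounded (pfib E s) (pfib E s) B S" using S.hcompact_bounded[OF S] .
  obtain \<Omega> where \<Omega>: "\<Omega> \<in> carrier (pfib E \<one>\<^bsub>M\<^esub>)"
    "\<And>t x. t \<in> carrier M \<Longrightarrow> x \<in> carrier (pfib E t) \<Longrightarrow> x \<cdot> \<Omega> = x"
    using unit_exists by metis
  have "amplify M E s \<one>\<^bsub>M\<^esub> S x = S x" if x: "x \<in> carrier (pfib E s)" for x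
    using amplify_spec(2)[OF s one_closed B x \<Omega>(1)] \<Omega>(2)[OF s x] \<Omega>(2)[OF s hbounded_in[OF B x]] by simp
  then show ?thesis by (rule S.hcompact_cong[OF S])
qed

lemma hbounded_amplify:
  assumes s: "s \<in> carrier M" and t: "t \<in> carrier M" and S: "hcompact (pfib E s) (pfib E s) S"
  obtains B where "hbounded (pfib E (s \<otimes>\<^bsub>M\<^esub> t)) (pfib E (s \<otimes>\<^bsub>M\<^esub> t)) B (amplify M E s t S)"
proof -
  interpret S: hilbert_pair "pfib E s" "pfib E s" using hilbert_pair s s .
  obtain B where B: "hbounded (pfib E s) (pfib E s) B S" using S.hcompact_bounded[OF S] .
  show thesis using that amplify_spec(1)[OF s t B] .
qed

end

locale free_product_of_product_systems =
  free_product_words \<Lambda> G P + free_product_system \<Lambda> G P E F ten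
  for \<Lambda> :: "'l set" and G :: "'l \<Rightarrow> ('g, 'b) monoid_scheme" and P :: "'l \<Rightarrow> 'g set"
    and E :: "'l \<Rightarrow> ('g, 'x) prodsys" and F :: "(('l, 'g) word, 'y) prodsys"
    and ten :: "('l, 'g) word \<Rightarrow> 'x list \<Rightarrow> 'y" +
  assumes factor: "l \<in> \<Lambda> \<Longrightarrow> product_system ((G l)\<lparr>carrier := P l\<rparr>) (E l)"
begin

abbreviation FM where "FM \<equiv> FG\<lparr>carrier := pos_words\<rparr>"

sublocale FP: product_system FM F
  using product_system unfolding free_prod_semigroup_eq .

section \<open>One-letter words: the factors inside the free product\<close>

context
  fixes l assumes l: "l \<in> \<Lambda>"
begin

abbreviation LE where "LE a \<equiv> pfib (E l) a"

abbreviation LF where "LF a \<equiv> pfib F [(l, a)]"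

lemma letter_positive: "a \<in> P l \<Longrightarrow> a \<noteq> \<one>\<^bsub>G l\<^esub> \<Longrightarrow> [(l, a)] \<in> carrier FM"
  using l by (simp add: positive_Cons positive_Nil)

lemma letter_mult_letter: "a \<otimes>\<^bsub>G l\<^esub> b \<noteq> \<one>\<^bsub>G l\<^esub> \<Longrightarrow> [(l, a)] \<otimes>\<^bsub>FM\<^esub> [(l, b)] = [(l, a \<otimes>\<^bsub>G l\<^esub> b)]"
  by simp

lemma letter_tensor:
  assumes "a \<in> P l" "a \<noteq> \<one>\<^bsub>G l\<^esub>"
  shows "hilbert_tensor [LE a] (LF a) (ten [(l, a)])"
  using fibre[of "[(l, a)]"] letter_positive[OF assms] by (simp add: free_prod_semigroup_eq word_fibres_def)

text \<open>A tensor product with one factor is that factor: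
  \<open>x \<mapsto> ten [(l, a)] [x]\<close> is linear and isometric, and
  \<open>letter_inverse\<close> shows that it is onto.\<close>

lemma letter_bounded:
  assumes a: "a \<in> P l" "a \<noteq> \<one>\<^bsub>G l\<^esub>"
  shows "hbounded (LE a) (LF a) 1 (\<lambda>x. ten [(l, a)] [x])"
    and "\<And>x. x \<in> carrier (LE a) \<Longrightarrow> hnorm (LF a) (ten [(l, a)] [x]) = hnorm (LE a) x"
proof -
  note T = letter_tensor[OF a]
  have args: "[x] \<in> tensor_args [LE a]" if "x \<in> carrier (LE a)" for x
    using that by (simp add: tensor_args_single)
  show norm: "hnorm (LF a) (ten [(l, a)] [x]) = hnorm (LE a) x"
    if "x \<in> carrier (LE a)" for x
    using hilbert_tensor_ip[OF T args[OF that] args[OF that]] by (simp add: hnorm_def)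
  have "ten [(l, a)] [x \<oplus>\<^bsub>LE a\<^esub> y] = ten [(l, a)] [x] \<oplus>\<^bsub>LF a\<^esub> ten [(l, a)] [y]"
    if "x \<in> carrier (LE a)" "y \<in> carrier (LE a)" for x y
    using hilbert_tensor_add[OF T args[OF that(1)], of 0 x y] that by simp
  moreover have "ten [(l, a)] [c \<odot>\<^bsub>LE a\<^esub> x] = c \<odot>\<^bsub>LF a\<^esub> ten [(l, a)] [x]"
    if "x \<in> carrier (LE a)" for c x
    using hilbert_tensor_smult[OF T args[OF that], of 0 x c] that by simp
  ultimately show "hbounded (LE a) (LF a) 1 (\<lambda>x. ten [(l, a)] [x])"
    using hilbert_tensor_in[OF T args] norm unfolding hbounded_def hlinear_def by auto
qed

lemma letter_inverse:
  assumes a: "a \<in> P l" "a \<noteq> \<one>\<^bsub>G l\<^esub>"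
  shows "\<exists>k. hbounded (LF a) (LE a) 1 k \<and>
    (\<forall>x\<in>carrier (LE a). k (ten [(l, a)] [x]) = x) \<and>
    (\<forall>y\<in>carrier (LF a). ten [(l, a)] [k y] = y)"
proof -
  interpret EF: hilbert_pair "LE a" "LF a"
    using product_system.hilbert[OF factor[OF l], of a] FP.hilbert[OF letter_positive[OF a]] a(1)
    by (simp add: hilbert_pair.intro)
  have "ten [(l, a)] ` tensor_args [LE a] = (\<lambda>x. ten [(l, a)] [x]) ` carrier (LE a)"
    by (auto simp: tensor_args_single)
  then have "total_in (LF a) ((\<lambda>x. ten [(l, a)] [x]) ` carrier (LE a))"
    using hilbert_tensor_total[OF letter_tensor[OF a]] by simp
  from EF.isometry_inverse[OF hbounded_linear[OF letter_bounded(1)[OF a]] letter_bounded(2)[OF a] this]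
  show ?thesis by metis
qed

lemma letter_mult_ten:
  assumes a: "a \<in> P l" "a \<noteq> \<one>\<^bsub>G l\<^esub>" and b: "b \<in> P l" "b \<noteq> \<one>\<^bsub>G l\<^esub>" and ab: "a \<otimes>\<^bsub>G l\<^esub> b \<noteq> \<one>\<^bsub>G l\<^esub>"
    and x: "x \<in> carrier (LE a)" and y: "y \<in> carrier (LE b)"
  shows "ten [(l, a)] [x] \<cdot>\<^bsub>F\<^esub> ten [(l, b)] [y] = ten [(l, a \<otimes>\<^bsub>G l\<^esub> b)] [x \<cdot>\<^bsub>E l\<^esub> y]"
  using mult[of "[(l, a)]" "[(l, b)]" "[x]" "[y]"] letter_positive[OF a] letter_positive[OF b] ab x y
  by (simp add: free_prod_semigroup_eq word_fibres_def tensor_args_single tensor_concat_def)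

text \<open>The identification of the fibres of \<open>E l\<close> with those over one-letter words
  respects products, so it carries the amplification of \<open>S\<close> to that of the conjugated
  operator \<open>S'\<close>. It suffices to compare both on products, whose factors are themselves
  one-letter tensors.\<close>

lemma amplify_letter:
  assumes a: "a \<in> P l" "a \<noteq> \<one>\<^bsub>G l\<^esub>" and a': "a' \<in> P l" "a' \<noteq> \<one>\<^bsub>G l\<^esub>"
    and c: "c = a \<otimes>\<^bsub>G l\<^esub> a'" "c \<noteq> \<one>\<^bsub>G l\<^esub>"
    and S: "hcompact (LF a) (LF a) S"
    and ka: "hbounded (LF a) (LE a) 1 ka"
      "\<forall>x\<in>carrier (LE a). ka (ten [(l, a)] [x]) = x"
      "\<forall>y\<in>carrier (LF a). ten [(l, a)] [ka y] = y"
    and kc: "hbounded (LF c) (LE c) 1 kc"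
      "\<forall>x\<in>carrier (LE c). kc (ten [(l, c)] [x]) = x"
    and S': "S' = (\<lambda>x. ka (S (ten [(l, a)] [x])))"
    and v: "v \<in> carrier (LF c)"
  shows "hcompact (LE a) (LE a) S'"
    and "amplify FM F [(l, a)] [(l, a')] S v = ten [(l, c)] [amplify (G l) (E l) a a' S' (kc v)]"
    and "amplify (G l) (E l) a a' S' (kc v) \<in> carrier (LE c)"
proof -
  interpret E: product_system "(G l)\<lparr>carrier := P l\<rparr>" "E l" using factor l .
  have cP: "c \<in> P l" using c a a' P_mult[OF l] by simp
  have Ea: "hilbert_space (LE a)" "hilbert_space (LE c)" using E.hilbert a(1) cP by simp_all
  have Fa: "hilbert_space (LF a)" using FP.hilbert[OF letter_positive[OF a]] .
  interpret FaFa: hilbert_pair "LF a" "LF a" by (rule hilbert_pair.intro[OF Fa Fa])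
  interpret EaEa: hilbert_pair "LE a" "LE a" by (rule hilbert_pair.intro[OF Ea(1) Ea(1)])
  note ja = letter_bounded(1)[OF a]
  show S'_compact: "hcompact (LE a) (LE a) S'"
    unfolding S' by (rule hcompact_comp_left[OF Fa Ea(1) hcompact_comp_right[OF Ea(1) Fa Fa ja S] ka(1)])
  obtain B' where B': "hbounded (LE a) (LE a) B' S'" using EaEa.hcompact_bounded[OF S'_compact] .
  obtain B where B: "hbounded (LF a) (LF a) B S" using FaFa.hcompact_bounded[OF S] .
  \<comment> \<open>\<open>amplify\<close> refers to the group only through its multiplication,
    which the submonoid shares.\<close>
  have ampE_eq: "amplify (G l) (E l) = amplify ((G l)\<lparr>carrier := P l\<rparr>) (E l)"
    by (simp add: amplify_def fun_eq_iff)
  have aE: "a \<in> carrier ((G l)\<lparr>carrier := P l\<rparr>)" "a' \<in> carrier ((G l)\<lparr>carrier := P l\<rparr>)" using a(1) a'(1) by auto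
  have cE: "a \<otimes>\<^bsub>(G l)\<lparr>carrier := P l\<rparr>\<^esub> a' = c" using c by simp
  note ampE = E.amplify_spec[OF aE B', unfolded cE, folded ampE_eq]
  note aF = letter_positive[OF a] letter_positive[OF a']
  have cF: "[(l, a)] \<otimes>\<^bsub>FM\<^esub> [(l, a')] = [(l, c)]" using c letter_mult_letter by simp
  note ampF = FP.amplify_spec[OF aF B, unfolded cF]
  let ?A = "\<lambda>v. ten [(l, c)] [amplify (G l) (E l) a a' S' (kc v)]"
  have A: "hbounded (LF c) (LF c) (1 * (B' * 1)) ?A"
    using hbounded_comp[OF hbounded_comp[OF kc(1) ampE(1)] letter_bounded(1)[OF cP c(2)]] .
  show "amplify (G l) (E l) a a' S' (kc v) \<in> carrier (LE c)"
    using hbounded_in[OF ampE(1) hbounded_in[OF kc(1) v]] .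
  have Fc: "hilbert_space (LF c)" using FP.hilbert[OF letter_positive[OF cP c(2)]] .
  have eq_mult: "amplify FM F [(l, a)] [(l, a')] S (\<xi> \<cdot>\<^bsub>F\<^esub> \<eta>) = ?A (\<xi> \<cdot>\<^bsub>F\<^esub> \<eta>)"
    if \<xi>: "\<xi> \<in> carrier (LF a)" and \<eta>: "\<eta> \<in> carrier (LF a')" for \<xi> \<eta>
  proof -
    obtain ka' where ka': "hbounded (LF a') (LE a') 1 ka'"
      "\<forall>x\<in>carrier (LE a'). ka' (ten [(l, a')] [x]) = x"
      "\<forall>y\<in>carrier (LF a'). ten [(l, a')] [ka' y] = y"
      using letter_inverse[OF a'] by (elim exE conjE) (rule that)
    define x y where "x = ka \<xi>" and "y = ka' \<eta>"
    have x: "x \<in> carrier (LE a)" "\<xi> = ten [(l, a)] [x]"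
      unfolding x_def using hbounded_in[OF ka(1) \<xi>] bspec[OF ka(3) \<xi>] by simp_all
    have y: "y \<in> carrier (LE a')" "\<eta> = ten [(l, a')] [y]"
      unfolding y_def using hbounded_in[OF ka'(1) \<eta>] bspec[OF ka'(3) \<eta>] by simp_all
    have ne: "a \<otimes>\<^bsub>G l\<^esub> a' \<noteq> \<one>\<^bsub>G l\<^esub>" using c by simp
    have xy: "\<xi> \<cdot>\<^bsub>F\<^esub> \<eta> = ten [(l, c)] [x \<cdot>\<^bsub>E l\<^esub> y]"
      unfolding x(2) y(2) c(1) by (rule letter_mult_ten[OF a a' ne x(1) y(1)])
    have xyE: "x \<cdot>\<^bsub>E l\<^esub> y \<in> carrier (LE c)" using E.mult_in[OF aE x(1) y(1)] cE by simp
    have S'x: "S' x \<in> carrier (LE a)" using hbounded_in[OF B' x(1)] .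
    have "?A (\<xi> \<cdot>\<^bsub>F\<^esub> \<eta>) = ten [(l, c)] [S' x \<cdot>\<^bsub>E l\<^esub> y]"
      unfolding xy bspec[OF kc(2) xyE] ampE(2)[OF x(1) y(1)] ..
    also have "\<dots> = ten [(l, a)] [S' x] \<cdot>\<^bsub>F\<^esub> \<eta>"
      unfolding y(2) c(1) by (rule letter_mult_ten[OF a a' ne S'x y(1), symmetric])
    also have "ten [(l, a)] [S' x] = S \<xi>" unfolding S' x(2)[symmetric] using bspec[OF ka(3) hbounded_in[OF B \<xi>]] .
    finally show ?thesis using ampF(2)[OF \<xi> \<eta>] by simp
  qed
  note unique = FP.amplification_unique[OF aF Fc, unfolded cF]
  show "amplify FM F [(l, a)] [(l, a')] S v = ?A v"
    by (rule unique[OF ampF(1) A eq_mult v])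
qed

text \<open>Conjugation by the identification of fibres turns \<open>S\<close> and \<open>T\<close>
  into compact operators of the factor, where alignment applies; the product of their amplifications
  is carried back.\<close>

lemma hcompact_amplify_letters:
  assumes aligned: "compactly_aligned (G l) (P l) (E l)"
    and ab: "a \<in> P l" "b \<in> P l" "a \<noteq> \<one>\<^bsub>G l\<^esub>" "b \<noteq> \<one>\<^bsub>G l\<^esub>"
    and ub: "Upper (left_order (G l) (P l)) {a, b} \<inter> P l \<noteq> {}"
    and c: "c = a \<squnion>\<^bsub>left_order (G l) (P l)\<^esub> b" "c \<noteq> \<one>\<^bsub>G l\<^esub>" "c \<in> P l"
    and a': "a' = inv\<^bsub>G l\<^esub> a \<otimes>\<^bsub>G l\<^esub> c" "a' \<in> P l" "a' \<noteq> \<one>\<^bsub>G l\<^esub>"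
    and b': "b' = inv\<^bsub>G l\<^esub> b \<otimes>\<^bsub>G l\<^esub> c" "b' \<in> P l" "b' \<noteq> \<one>\<^bsub>G l\<^esub>"
    and S: "hcompact (LF a) (LF a) S" and T: "hcompact (LF b) (LF b) T"
  shows "hcompact (LF c) (LF c)
    (\<lambda>v. amplify FM F [(l, a)] [(l, a')] S (amplify FM F [(l, b)] [(l, b')] T v))"
proof -
  interpret group "G l" using group_G l .
  have carr: "a \<in> carrier (G l)" "b \<in> carrier (G l)" "c \<in> carrier (G l)" using P_subset[OF l] ab c by auto
  have ca: "c = a \<otimes>\<^bsub>G l\<^esub> a'" and cb: "c = b \<otimes>\<^bsub>G l\<^esub> b'" unfolding a'(1) b'(1) using carr by (simp_all flip: m_assoc)
  have Ec: "hilbert_space (LE c)" using product_system.hilbert[OF factor[OF l]] c(3) by simp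
  have Fc: "hilbert_space (LF c)" using FP.hilbert[OF letter_positive[OF c(3,2)]] .
  obtain ka where ka: "hbounded (LF a) (LE a) 1 ka"
    "\<forall>x\<in>carrier (LE a). ka (ten [(l, a)] [x]) = x"
    "\<forall>y\<in>carrier (LF a). ten [(l, a)] [ka y] = y"
    using letter_inverse[OF ab(1,3)] by (elim exE conjE) (rule that)
  obtain kb where kb: "hbounded (LF b) (LE b) 1 kb"
    "\<forall>x\<in>carrier (LE b). kb (ten [(l, b)] [x]) = x"
    "\<forall>y\<in>carrier (LF b). ten [(l, b)] [kb y] = y"
    using letter_inverse[OF ab(2,4)] by (elim exE conjE) (rule that)
  obtain kc where kc: "hbounded (LF c) (LE c) 1 kc"
    "\<forall>x\<in>carrier (LE c). kc (ten [(l, c)] [x]) = x"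
    "\<forall>y\<in>carrier (LF c). ten [(l, c)] [kc y] = y"
    using letter_inverse[OF c(3,2)] by (elim exE conjE) (rule that)
  define S' where "S' = (\<lambda>x. ka (S (ten [(l, a)] [x])))"
  define T' where "T' = (\<lambda>x. kb (T (ten [(l, b)] [x])))"
  note ampS = amplify_letter[OF ab(1,3) a'(2,3) ca c(2) S ka kc(1,2) S'_def]
  note ampT = amplify_letter[OF ab(2,4) b'(2,3) cb c(2) T kb kc(1,2) T'_def]
  interpret Fcc: hilbert_pair "LF c" "LF c" by (rule hilbert_pair.intro[OF Fc Fc])
  interpret Fc: hilbert_space "LF c" using Fc .
  \<comment> \<open>An arbitrary vector to instantiate \<open>v\<close>, on which the compactness of
    \<open>S'\<close> and \<open>T'\<close> does not depend.\<close>
  have zero: "\<zero>\<^bsub>LF c\<^esub> \<in> carrier (LF c)" by simp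
  have "compact_operator (LE a) S'" "compact_operator (LE b) T'"
    using ampS(1)[OF zero] ampT(1)[OF zero] product_system.hilbert[OF factor[OF l]] ab(1,2)
    by (simp_all add: hilbert_space.compact_operator_iff)
  then have "compact_operator (LE c) (amplify (G l) (E l) a a' S' \<circ> amplify (G l) (E l) b b' T')"
    using aligned[unfolded compactly_aligned_def Let_def, rule_format, OF ab(1,2) ub, of S' T']
    unfolding c(1)[symmetric] a'(1)[symmetric] b'(1)[symmetric] by blast
  then have "hcompact (LE c) (LE c) (\<lambda>v. amplify (G l) (E l) a a' S' (amplify (G l) (E l) b b' T' v))"
    using hilbert_space.compact_operator_iff[OF Ec] by (simp add: comp_def)
  from hcompact_comp_left[OF Ec Fc hcompact_comp_right[OF Fc Ec Ec kc(1) this] letter_bounded(1)[OF c(3,2)]]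
  show ?thesis
  proof (rule Fcc.hcompact_cong)
    fix v assume v: "v \<in> carrier (LF c)"
    let ?Tv = "amplify (G l) (E l) b b' T' (kc v)"
    have Tv: "?Tv \<in> carrier (LE c)" using ampT(3)[OF v] .
    have jTv: "ten [(l, c)] [?Tv] \<in> carrier (LF c)"
      using hbounded_in[OF letter_bounded(1)[OF c(3,2)] Tv] .
    show "amplify FM F [(l, a)] [(l, a')] S (amplify FM F [(l, b)] [(l, b')] T v) =
        ten [(l, c)] [amplify (G l) (E l) a a' S' ?Tv]"
      unfolding ampT(2)[OF v] ampS(2)[OF jTv] bspec[OF kc(2) Tv] ..
  qed
qed

end

lemma compactly_aligned_free_product:
  assumes aligned: "\<And>l. l \<in> \<Lambda> \<Longrightarrow> compactly_aligned (G l) (P l) (E l)"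
  shows "compactly_aligned FG (free_prod_semigroup \<Lambda> G P) F"
  unfolding compactly_aligned_def Let_def free_prod_semigroup_eq
proof (intro ballI impI allI)
  fix s t S T
  assume s: "s \<in> pos_words" and t: "t \<in> pos_words"
    and ub: "Upper FL {s, t} \<inter> pos_words \<noteq> {}"
    and S: "compact_operator (pfib F s) S" and T: "compact_operator (pfib F t) T"
  interpret FG: group FG by (rule group_FG)
  have sM: "s \<in> carrier FM" and tM: "t \<in> carrier FM" using s t by auto
  have sG: "s \<in> carrier FG" and tG: "t \<in> carrier FG" using pos_reduced s t by auto
  have S: "hcompact (pfib F s) (pfib F s) S" and T: "hcompact (pfib F t) (pfib F t) T"
    using S T hilbert_space.compact_operator_iff[OF FP.hilbert[OF sM]] hilbert_space.compact_operator_iff[OF FP.hilbert[OF tM]] by simp_all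
  have amp_eq: "amplify FG F = amplify FM F" by (simp add: amplify_def fun_eq_iff)
  have mult_eq: "x \<otimes>\<^bsub>FM\<^esub> y = x \<otimes>\<^bsub>FG\<^esub> y" for x y by simp
  have one_eq: "\<one>\<^bsub>FM\<^esub> = \<one>\<^bsub>FG\<^esub>" by simp
  \<comment> \<open>The interface to the three cases: \<open>r\<close> is the join, and
    \<open>s'\<close>, \<open>t'\<close> are the words that complete \<open>s\<close> and
    \<open>t\<close> to it.\<close>
  have goal: "compact_operator (pfib F (s \<squnion>\<^bsub>FL\<^esub> t))
      (amplify FG F s (inv\<^bsub>FG\<^esub> s \<otimes>\<^bsub>FG\<^esub> (s \<squnion>\<^bsub>FL\<^esub> t)) S \<circ> amplify FG F t (inv\<^bsub>FG\<^esub> t \<otimes>\<^bsub>FG\<^esub> (s \<squnion>\<^bsub>FL\<^esub> t)) T)"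
    if "r \<in> carrier FM" "s \<squnion>\<^bsub>FL\<^esub> t = r" "inv\<^bsub>FG\<^esub> s \<otimes>\<^bsub>FG\<^esub> r = s'" "inv\<^bsub>FG\<^esub> t \<otimes>\<^bsub>FG\<^esub> r = t'"
      "hcompact (pfib F r) (pfib F r) (\<lambda>v. amplify FM F s s' S (amplify FM F t t' T v))" for r s' t'
    using that(5) unfolding that(2-4) amp_eq hilbert_space.compact_operator_iff[OF FP.hilbert[OF that(1)]] comp_def .
  have cancel: "x \<otimes>\<^bsub>FG\<^esub> (inv\<^bsub>FG\<^esub> x \<otimes>\<^bsub>FG\<^esub> y) = y" if "x \<in> carrier FG" "y \<in> carrier FG" for x y
    using that by (metis FG.inv_closed FG.r_inv FG.l_one FG.m_assoc)
  show "compact_operator (pfib F (s \<squnion>\<^bsub>FL\<^esub> t))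
      (amplify FG F s (inv\<^bsub>FG\<^esub> s \<otimes>\<^bsub>FG\<^esub> (s \<squnion>\<^bsub>FL\<^esub> t)) S \<circ> amplify FG F t (inv\<^bsub>FG\<^esub> t \<otimes>\<^bsub>FG\<^esub> (s \<squnion>\<^bsub>FL\<^esub> t)) T)"
    using s t ub
  proof (cases rule: join_cases)
    \<comment> \<open>The join is \<open>t\<close>, so \<open>T \<otimes> 1\<close> is the compact
      \<open>T\<close> and \<open>S \<otimes> 1\<close> is bounded and composed on the left.\<close>
    case le
    have s': "inv\<^bsub>FG\<^esub> s \<otimes>\<^bsub>FG\<^esub> t \<in> carrier FM" using le(1) by simp
    have st: "s \<otimes>\<^bsub>FM\<^esub> (inv\<^bsub>FG\<^esub> s \<otimes>\<^bsub>FG\<^esub> t) = t" unfolding mult_eq using cancel[OF sG tG] .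
    obtain B where B: "hbounded (pfib F t) (pfib F t) B (amplify FM F s (inv\<^bsub>FG\<^esub> s \<otimes>\<^bsub>FG\<^esub> t) S)"
      using FP.hbounded_amplify[OF sM s' S] unfolding st .
    have "hcompact (pfib F t) (pfib F t) (amplify FM F t \<one>\<^bsub>FG\<^esub> T)"
      using FP.hcompact_amplify_one[OF tM T] unfolding one_eq .
    from hcompact_comp_left[OF FP.hilbert[OF tM] FP.hilbert[OF tM] this B]
    show ?thesis by (rule goal[OF tM le(2) refl FG.l_inv[OF tG]])
  next
    \<comment> \<open>The join is \<open>s\<close>; now the compact factor is \<open>S\<close>, and
      the bounded \<open>T \<otimes> 1\<close> is composed on the right.\<close>
    case ge
    have t': "inv\<^bsub>FG\<^esub> t \<otimes>\<^bsub>FG\<^esub> s \<in> carrier FM" using ge(1) by simp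
    have ts: "t \<otimes>\<^bsub>FM\<^esub> (inv\<^bsub>FG\<^esub> t \<otimes>\<^bsub>FG\<^esub> s) = s" unfolding mult_eq using cancel[OF tG sG] .
    obtain B where B: "hbounded (pfib F s) (pfib F s) B (amplify FM F t (inv\<^bsub>FG\<^esub> t \<otimes>\<^bsub>FG\<^esub> s) T)"
      using FP.hbounded_amplify[OF tM t' T] unfolding ts .
    have "hcompact (pfib F s) (pfib F s) (amplify FM F s \<one>\<^bsub>FG\<^esub> S)"
      using FP.hcompact_amplify_one[OF sM S] unfolding one_eq .
    from hcompact_comp_right[OF FP.hilbert[OF sM] FP.hilbert[OF sM] FP.hilbert[OF sM] B this]
    show ?thesis by (rule goal[OF sM ge(2) FG.l_inv[OF sG] refl])
  next
    case (last u l a b c)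
    have l: "l \<in> \<Lambda>" and a: "a \<in> P l" "a \<noteq> \<one>\<^bsub>G l\<^esub>" and u: "u \<in> pos_words" "u = [] \<or> fst (last u) \<noteq> l"
      using s unfolding last(1) by (auto simp: positive_append positive_Cons)
    have b: "b \<in> P l" "b \<noteq> \<one>\<^bsub>G l\<^esub>" using t unfolding last(2) by (auto simp: positive_append positive_Cons)
    interpret L: group "G l" using group_G l .
    have carr: "a \<in> carrier (G l)" "b \<in> carrier (G l)" "c \<in> carrier (G l)"
      using P_subset[OF l] a b last(8) by auto
    define a' b' where "a' = inv\<^bsub>G l\<^esub> a \<otimes>\<^bsub>G l\<^esub> c" and "b' = inv\<^bsub>G l\<^esub> b \<otimes>\<^bsub>G l\<^esub> c"
    have ca: "c = a \<otimes>\<^bsub>G l\<^esub> a'" and cb: "c = b \<otimes>\<^bsub>G l\<^esub> b'"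
      unfolding a'_def b'_def using carr by (simp_all flip: L.m_assoc)
    \<comment> \<open>Nontrivial because \<open>c\<close> differs from \<open>a\<close> and
      \<open>b\<close>; hence the one-letter words of \<open>a'\<close> and \<open>b'\<close> are
      reduced.\<close>
    have a': "a' \<in> P l" "a' \<noteq> \<one>\<^bsub>G l\<^esub>" and b': "b' \<in> P l" "b' \<noteq> \<one>\<^bsub>G l\<^esub>"
    proof -
      show "a' \<in> P l" "b' \<in> P l" using last(6,7) by (simp_all add: a'_def b'_def)
      show "a' \<noteq> \<one>\<^bsub>G l\<^esub>"
      proof
        assume "a' = \<one>\<^bsub>G l\<^esub>"
        then have "c = a" using ca carr(1) by (metis L.r_one)
        with last(9) show False ..
      qed
      show "b' \<noteq> \<one>\<^bsub>G l\<^esub>"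
      proof
        assume "b' = \<one>\<^bsub>G l\<^esub>"
        then have "c = b" using cb carr(2) by (metis L.r_one)
        with last(10) show False ..
      qed
    qed
    have uM: "u \<in> carrier FM" using u by simp
    have app: "u \<otimes>\<^bsub>FM\<^esub> [(l, g)] = u @ [(l, g)]" if "g \<in> P l" "g \<noteq> \<one>\<^bsub>G l\<^esub>" for g
    proof -
      have "u @ [(l, g)] \<in> pos_words" using u l that by (simp add: positive_append positive_Cons positive_Nil)
      then show ?thesis using foldr_append_reduced[OF pos_distinct] by simp
    qed
    note lM = letter_positive[OF l]
    have ca': "[(l, c)] = [(l, a)] \<otimes>\<^bsub>FM\<^esub> [(l, a')]" and cb': "[(l, c)] = [(l, b)] \<otimes>\<^bsub>FM\<^esub> [(l, b')]"
      using letter_mult_letter[of l a a'] letter_mult_letter[of l b b'] ca cb last(11) l by simp_all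
    have rM: "u @ [(l, c)] \<in> carrier FM"
      unfolding app[OF last(8,11), symmetric] using uM lM[OF last(8,11)] by (rule FP.m_closed)
    have cancel': "inv\<^bsub>FG\<^esub> x \<otimes>\<^bsub>FG\<^esub> (x \<otimes>\<^bsub>FG\<^esub> y) = y" if "x \<in> carrier FG" "y \<in> carrier FG" for x y
      using that by (metis FG.inv_closed FG.l_inv FG.l_one FG.m_assoc)
    \<comment> \<open>The word completing \<open>s\<close> to the join is the single letter
      \<open>a'\<close>, so everything to the left of the last letters is the common factor
      \<open>u\<close>.\<close>
    have "s \<otimes>\<^bsub>FM\<^esub> [(l, a')] = u @ [(l, c)]"
      unfolding last(1) app[OF a, symmetric] FP.m_assoc[OF uM lM[OF a] lM[OF a']] ca'[symmetric]
      by (rule app[OF last(8,11)])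
    with cancel'[OF sG, of "[(l, a')]"] lM[OF a'] pos_reduced
    have s': "inv\<^bsub>FG\<^esub> s \<otimes>\<^bsub>FG\<^esub> (u @ [(l, c)]) = [(l, a')]" unfolding mult_eq by auto
    have "t \<otimes>\<^bsub>FM\<^esub> [(l, b')] = u @ [(l, c)]"
      unfolding last(2) app[OF b, symmetric] FP.m_assoc[OF uM lM[OF b] lM[OF b']] cb'[symmetric]
      by (rule app[OF last(8,11)])
    with cancel'[OF tG, of "[(l, b')]"] lM[OF b'] pos_reduced
    have t': "inv\<^bsub>FG\<^esub> t \<otimes>\<^bsub>FG\<^esub> (u @ [(l, c)]) = [(l, b')]" unfolding mult_eq by auto
    show ?thesis
    proof (rule goal[OF rM last(5) s' t'])
      have "hcompact (pfib F (u \<otimes>\<^bsub>FM\<^esub> [(l, c)])) (pfib F (u \<otimes>\<^bsub>FM\<^esub> [(l, c)]))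
        (\<lambda>v. amplify FM F (u \<otimes>\<^bsub>FM\<^esub> [(l, a)]) [(l, a')] S (amplify FM F (u \<otimes>\<^bsub>FM\<^esub> [(l, b)]) [(l, b')] T v))"
      proof (rule FP.hcompact_amplify_left_translate[OF uM lM[OF a] lM[OF b] lM[OF a'] lM[OF b'] ca' cb'])
        show "hcompact (pfib F [(l, c)]) (pfib F [(l, c)])
            (\<lambda>v. amplify FM F [(l, a)] [(l, a')] S0 (amplify FM F [(l, b)] [(l, b')] T0 v))"
          if "hcompact (pfib F [(l, a)]) (pfib F [(l, a)]) S0" "hcompact (pfib F [(l, b)]) (pfib F [(l, b)]) T0" for S0 T0
          using hcompact_amplify_letters[OF l aligned[OF l] a(1) b(1) a(2) b(2) last(4,3) last(11,8)
              a'_def a' b'_def b' that] .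
      qed (use S T last(1,2) app[OF a] app[OF b] in simp_all)
      then show "hcompact (pfib F (u @ [(l, c)])) (pfib F (u @ [(l, c)]))
          (\<lambda>v. amplify FM F s [(l, a')] S (amplify FM F t [(l, b')] T v))"
        unfolding app[OF a] app[OF b] app[OF last(8,11)] last(1,2) .
    qed
  qed
qed

end

theorem proposition1p10:
  fixes \<Lambda> :: "'l set"
    and G :: "'l \<Rightarrow> 'g monoid"
    and P :: "'l \<Rightarrow> 'g set"
    and E :: "'l \<Rightarrow> ('g, 'x) prodsys"
    and F :: "(('l, 'g) word, 'y) prodsys"
    and ten :: "('l, 'g) word \<Rightarrow> 'x list \<Rightarrow> 'y"
  assumes qlo: "\<And>l. l \<in> \<Lambda> \<Longrightarrow> quasi_lattice_ordered (G l) (P l)"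
    and product_systems: "\<And>l. l \<in> \<Lambda> \<Longrightarrow> product_system ((G l)\<lparr>carrier := P l\<rparr>) (E l)"
    and aligned: "\<And>l. l \<in> \<Lambda> \<Longrightarrow> compactly_aligned (G l) (P l) (E l)"
    and free_product: "free_product_system \<Lambda> G P E F ten"
  shows "compactly_aligned (free_prod_group \<Lambda> G) (free_prod_semigroup \<Lambda> G P) F"
proof -
  have "free_product_of_product_systems \<Lambda> G P E F ten"
    by (intro free_product_of_product_systems.intro free_product_words.intro
        free_product_of_product_systems_axioms.intro free_product qlo product_systems)
  then show ?thesis
    by (rule free_product_of_product_systems.compactly_aligned_free_product) (rule aligned)
qed

end
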